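(* Consider the multi-agent system in which each agent $i\in\mathcal{V}=\{1,\dots,N\}$ is a chain-integrator system with disturbance (superscript $i$ omitted) $$\dot x_q=x_{q+1},\ q=1,\dots,m-1,\qquad\dot x_m=u+\varphi(x,d),\qquad y=x_1,$$ together with the optimal trajectory generator $$\dot\varpi^i=-\alpha(\mu)\Big(\sum_{j\in\mathcal{N}^i}a_{ij}(\varpi^i-\varpi^j)+\nabla f^i(\varpi^i)+p^i\Big),\qquad\dot p^i=\alpha(\mu)\sum_{j\in\mathcal{N}^i}a_{ij}(\varpi^i-\varpi^j),$$ and the controller $$u=-(v+\psi^2(x)+1)\,\mathrm{sign}(k_1)\,\tilde e_s-\pi(x)-(B(\mu))^{-1}\delta_s(\mu)\tilde s,\qquad v>0,$$ with all objects as defined in the context. Suppose $\sum_{i=1}^Np^i(t_0)=0$, $\alpha\in\mathcal{K}_\infty$ is differentiable with $\frac{\mathrm{d}\alpha(s)}{\mathrm{d}s}\le\frac{c^*}{2}s^{-2}(\alpha(s))^2$ for $s>0$, and the design criteria $DC_1$ and $DC_2$ of the context hold. Then the distributed prescribed-time convex optimization (DPTCO) problem for the chain-integrator multi-agent system is solved: $\lim_{t\to T+t_0}(y^i(t)-z^* )=0$ for all $i\in\mathcal{V}$, and $x^i(t),y^i(t),u^i(t)$ are bounded for $t\in\mathcal{T}_p$, $i\in\mathcal{V}$.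
   Context: **Time and gains.** $t_0$ is the initial time, $T>0$ an arbitrary prescribed time, $\mathcal{T}_p=[t_0,T+t_0)$, $\mu=\mu(t)=1/(T+t_0-t)$, with values in $\mathbb{R}_p=[1/T,\infty)$. $\mathcal{K}_\infty$: continuous strictly increasing unbounded functions on $[0,\infty)$ vanishing at $0$. **Graph and optimization problem.** $\mathcal{G}$ is an undirected connected graph on $\mathcal{V}$ with symmetric weighted adjacency matrix $[a_{ij}]$, $a_{ii}=0$, neighbour sets $\mathcal{N}^i$, Laplacian $\mathcal{L}$; $\lambda_2,\lambda_N$ are the second smallest and largest eigenvalues of $\mathcal{L}$. Each $f^i:\mathbb{R}^n\to\mathbb{R}$ is differentiable with $(\nabla f^i(x)-\nabla f^i(y))^T(x-y)\ge\rho_c\|x-y\|^2$ and $\|\nabla f^i(x)-\nabla f^i(y)\|\le\varrho_c\|x-y\|$, $\rho_c,\varrho_c>0$, known only to agent $i$. The problem $\min\sum_if^i(y^i)$ subject to $y^i=y^j$ for all $i,j$ has finite optimal value and nonempty compact optimum set; its optimum is $1_N\otimes z^*$, $z^*\in\mathbb{R}^n$. Constants: $c_1=\max\{1/\lambda_2,(1+2\varrho_c^2)/(2\rho_c)\}$, $c_3=c_1\max\{1,1/\lambda_2\}+1$, $c^*=1/(4c_3)$. **DPTCO problem.** For any prescribed $T>0$, with distributed controllers, $\lim_{t\to T+t_0}(y^i(t)-z^* )=0$ for all $i$ irrespective of initial values and of control parameters other than $T$, with $x^i,y^i,u^i$ bounded on $\mathcal{T}_p$. **Agent.** (Superscript $i$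 omitted; all objects below may depend on $i$.) $x=[x_1^T,\dots,x_m^T]^T\in\mathbb{R}^{mn}$, $x_q\in\mathbb{R}^n$, $u,y\in\mathbb{R}^n$, $m\ge2$; $d(t)\in\mathbb{D}$, $\mathbb{D}\subset\mathbb{R}^{n_d}$ compact; $\varphi:\mathbb{R}^{mn}\times\mathbb{D}\to\mathbb{R}^n$ is sufficiently smooth and, for each fixed $d$, bounded in $x$; and $\|\varphi(x,d)\|\le h(\|d\|)\psi(x)$ with $h\in\mathcal{K}_\infty$ unknown and $\psi$ a known positive function bounded on $\mathbb{R}^{mn}$. **Controller objects.** $K=[k_1,\dots,k_{m-1}]^T$ is such that the companion matrix $\Lambda\in\mathbb{R}^{(m-1)\times(m-1)}$ with first $m-2$ rows $[0_{m-2},I_{m-2}]$ and last row $[-k_1,\dots,-k_{m-1}]$ is Hurwitz. $L_j=j-1$, $\tilde K=[K^T,1]^T$. $\alpha_x,\alpha_s\in\mathcal{K}_\infty$ are first-order differentiable. $\Phi(\mu)=\mathrm{diag}\{1,(\alpha_x(\mu))^{-L_2},\dots,(\alpha_x(\mu))^{-L_m}\}$; $e_s=[(x_1-\varpi^i)^T,x_2^T,\dots,x_m^T]^T$; $r_1=[x_1^T,(\alpha_x(\mu))^{-L_2}x_2^T,\dots,(\alpha_x(\mu))^{-L_{m-1}}x_{m-1}^T]^T$; $\tilde s=k_1^{-1}(\tilde K^T\Phi(\mu)\otimes I_n)e_s=k_1^{-1}(K^T\otimes I_n)r_1+k_1^{-1}(\alpha_x(\mu))^{-L_m}x_m-\varpi^i$;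 $\tilde e_s=\alpha_s(\mu)\tilde s$. $B(s)=k_1^{-1}(\alpha_x(s))^{-L_m}$, $\delta_s(s)=\frac{\mathrm{d}\alpha_s(s)}{\mathrm{d}s}s^2(\alpha_s(s))^{-1}$, $\delta_x(s)=\frac{\mathrm{d}\alpha_x(s)}{\mathrm{d}s}s^2(\alpha_x(s))^{-1}$, $\pi(x)=(\alpha_x(\mu))^{L_m}(K^T\otimes I_n)\dot r_1-L_m\delta_x(\mu)x_m$, where $\dot r_1=[x_2;(\alpha_x(\mu))^{-L_2}(x_3-L_2\delta_x(\mu)x_2);\dots;(\alpha_x(\mu))^{-L_{m-1}}(x_m-L_{m-1}\delta_x(\mu)x_{m-1})]$. **Design criteria.** $P,Q$ are positive definite matrices with $P(\Lambda\otimes I_n)+(\Lambda^T\otimes I_n)P=-Q$; $v_1=\lambda_{\min}(Q)/\lambda_{\max}(P)$, $v_2=2m\lambda_{\max}(P)/\lambda_{\min}(P)$. $DC_1$: $\frac{\mathrm{d}\alpha_x(s)}{\mathrm{d}s}\le\frac{v_1}{2v_2}s^{-2}(\alpha_x(s))^2$ and $\alpha_x(s)\le\frac{c^*}{v_1}\alpha(s)$, for $s\in\mathbb{R}_p$. $DC_2$: $\alpha_s(s)=(\alpha_x(s))^m\exp\big(\frac{v_1}2\int_0^s\tau^{-2}\alpha_x(\tau)\,\mathrm{d}\tau\big)$ (the integral being finite, so that $\alpha_s$ is well defined). *)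

theory Defs
  imports
    "HOL-Analysis.Analysis"
    "Jordan_Normal_Form.Spectral_Radius"
begin

section \<open>Stacked vectors of agent-dependent length\<close>

text \<open>
  The orders \<open>m\<^sup>i\<close> and the disturbance dimensions differ from agent to agent, so they cannot be
  types. A stacked vector \<open>[x\<^sub>1; ...; x\<^sub>k]\<close> is a function on the naturals with blocks at \<open>1..k\<close> and
  zero elsewhere. The product topology of the function type, restricted to this set, is the
  Euclidean one. The library metric on \<open>nat \<Rightarrow> _\<close> is a bounded one, however, so boundedness of
  stacked vectors is expressed by \<open>stacked_norm\<close> and never by \<^const>\<open>bounded\<close>.
\<close>

definition stacked :: "nat \<Rightarrow> (nat \<Rightarrow> 'b::real_normed_vector) set" where
  "stacked k = {x. \<forall>q. q \<notin> {1..k} \<longrightarrow> x q = 0}"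

definition stacked_norm :: "nat \<Rightarrow> (nat \<Rightarrow> 'b::real_normed_vector) \<Rightarrow> real" where
  "stacked_norm k x = sqrt (\<Sum>q=1..k. (norm (x q))\<^sup>2)"

text \<open>
  Continuous differentiability on \<open>\<real>\<^sup>m\<^sup>n \<times> D\<close> for a set \<open>D\<close> that need not be open: there is an
  extension to a neighbourhood all of whose first partial derivatives exist and are continuous.
\<close>

definition C1_state_disturbance ::
  "nat \<Rightarrow> nat \<Rightarrow> (nat \<Rightarrow> real) set \<Rightarrow> ((nat \<Rightarrow> real^'n) \<Rightarrow> (nat \<Rightarrow> real) \<Rightarrow> real^'n) \<Rightarrow> bool" where
  "C1_state_disturbance m nd D \<phi> \<longleftrightarrow>
    (\<exists>W F gx gd. open W \<and> stacked m \<times> D \<subseteq> W \<and>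
       (\<forall>x\<in>stacked m. \<forall>d\<in>D. F x d = \<phi> x d) \<and>
       (\<forall>q\<in>{1..m}. \<forall>j. continuous_on (W \<inter> stacked m \<times> stacked nd) (gx q j)) \<and>
       (\<forall>l\<in>{1..nd}. continuous_on (W \<inter> stacked m \<times> stacked nd) (gd l)) \<and>
       (\<forall>(x, d) \<in> W \<inter> stacked m \<times> stacked nd.
          (\<forall>q\<in>{1..m}. \<forall>j.
             ((\<lambda>s. F (x(q := x q + s *\<^sub>R axis j 1)) d) has_vector_derivative gx q j (x, d)) (at 0)) \<and>
          (\<forall>l\<in>{1..nd}.
             ((\<lambda>s. F x (d(l := d l + s))) has_vector_derivative gd l (x, d)) (at 0))))"

section \<open>Time and gains\<close>

definition \<mu> :: "real \<Rightarrow> real \<Rightarrow> real \<Rightarrow> real" where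
  "\<mu> T t0 t = 1 / (T + t0 - t)"

definition class_K_inf :: "(real \<Rightarrow> real) \<Rightarrow> bool" where
  "class_K_inf \<alpha> \<longleftrightarrow>
     continuous_on {0..} \<alpha> \<and> strict_mono_on {0..} \<alpha> \<and> \<alpha> 0 = 0 \<and> \<not> bdd_above (\<alpha> ` {0..})"

section \<open>Matrices\<close>

text \<open>Real eigenvalues in increasing order, repeated according to algebraic multiplicity.\<close>

definition eigenvalues_sorted :: "real mat \<Rightarrow> real list" where
  "eigenvalues_sorted A = sorted_list_of_multiset (proots (char_poly A))"

definition lambda_min :: "real mat \<Rightarrow> real" where
  "lambda_min A = Min (spectrum A)"

definition lambda_max :: "real mat \<Rightarrow> real" where
  "lambda_max A = Max (spectrum A)"

definition pos_def :: "nat \<Rightarrow> real mat \<Rightarrow> bool" where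
  "pos_def k A \<longleftrightarrow> A \<in> carrier_mat k k \<and> transpose_mat A = A \<and>
     (\<forall>w\<in>carrier_vec k. w \<noteq> 0\<^sub>v k \<longrightarrow> 0 < scalar_prod w (A *\<^sub>v w))"

definition hurwitz :: "real mat \<Rightarrow> bool" where
  "hurwitz A \<longleftrightarrow> (\<forall>z\<in>spectrum (map_mat complex_of_real A). Re z < 0)"

definition kronecker :: "real mat \<Rightarrow> real mat \<Rightarrow> real mat" where
  "kronecker A B = mat (dim_row A * dim_row B) (dim_col A * dim_col B)
     (\<lambda>(i, j). A $$ (i div dim_row B, j div dim_col B) * B $$ (i mod dim_row B, j mod dim_col B))"

text \<open>Matrix indices start at 0, whereas the gains are \<open>k 1, ..., k (m - 1)\<close>.\<close>

definition companion :: "nat \<Rightarrow> (nat \<Rightarrow> real) \<Rightarrow> real mat" where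
  "companion m k = mat (m - 1) (m - 1)
     (\<lambda>(r, c). if r < m - 2 then (if c = r + 1 then 1 else 0) else - k (c + 1))"

section \<open>Graph and optimization problem\<close>

definition connected_weighted_graph :: "nat \<Rightarrow> (nat \<Rightarrow> nat \<Rightarrow> real) \<Rightarrow> bool" where
  "connected_weighted_graph N a \<longleftrightarrow>
     (\<forall>i\<in>{1..N}. a i i = 0) \<and>
     (\<forall>i\<in>{1..N}. \<forall>j\<in>{1..N}. a i j = a j i \<and> 0 \<le> a i j) \<and>
     (\<forall>i\<in>{1..N}. \<forall>j\<in>{1..N}. (i, j) \<in> {(k, l). k \<in> {1..N} \<and> l \<in> {1..N} \<and> 0 < a k l}\<^sup>*)"

definition neighbours :: "nat \<Rightarrow> (nat \<Rightarrow> nat \<Rightarrow> real) \<Rightarrow> nat \<Rightarrow> nat set" where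
  "neighbours N a i = {j\<in>{1..N}. 0 < a i j}"

text \<open>Agent \<open>i\<close> corresponds to the matrix index \<open>i - 1\<close>.\<close>

definition laplacian :: "nat \<Rightarrow> (nat \<Rightarrow> nat \<Rightarrow> real) \<Rightarrow> real mat" where
  "laplacian N a = mat N N
     (\<lambda>(r, c). if r = c then (\<Sum>j\<in>neighbours N a (r + 1). a (r + 1) j) else - a (r + 1) (c + 1))"

definition lambda2 :: "nat \<Rightarrow> (nat \<Rightarrow> nat \<Rightarrow> real) \<Rightarrow> real" where
  "lambda2 N a = eigenvalues_sorted (laplacian N a) ! 1"

text \<open>\<open>\<rho>\<close> is the strong monotonicity and \<open>\<kappa>\<close> the Lipschitz constant of the gradients.\<close>

definition c1 :: "real \<Rightarrow> real \<Rightarrow> real \<Rightarrow> real" where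
  "c1 l2 \<rho> \<kappa> = max (1 / l2) ((1 + 2 * \<kappa>\<^sup>2) / (2 * \<rho>))"

definition c3 :: "real \<Rightarrow> real \<Rightarrow> real \<Rightarrow> real" where
  "c3 l2 \<rho> \<kappa> = c1 l2 \<rho> \<kappa> * max 1 (1 / l2) + 1"

definition c_star :: "real \<Rightarrow> real \<Rightarrow> real \<Rightarrow> real" where
  "c_star l2 \<rho> \<kappa> = 1 / (4 * c3 l2 \<rho> \<kappa>)"

definition gradient :: "('b::real_inner \<Rightarrow> real) \<Rightarrow> 'b \<Rightarrow> 'b" where
  "gradient f x = (THE g. GDERIV f x :> g)"

definition consensus_profiles :: "nat \<Rightarrow> (nat \<Rightarrow> real^'n) set" where
  "consensus_profiles N = {y \<in> stacked N. \<forall>i\<in>{1..N}. \<forall>j\<in>{1..N}. y i = y j}"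

definition total_cost :: "nat \<Rightarrow> (nat \<Rightarrow> real^'n \<Rightarrow> real) \<Rightarrow> (nat \<Rightarrow> real^'n) \<Rightarrow> real" where
  "total_cost N f y = (\<Sum>i=1..N. f i (y i))"

definition optimum_set :: "nat \<Rightarrow> (nat \<Rightarrow> real^'n \<Rightarrow> real) \<Rightarrow> (nat \<Rightarrow> real^'n) set" where
  "optimum_set N f =
     {y \<in> consensus_profiles N. \<forall>y'\<in>consensus_profiles N. total_cost N f y \<le> total_cost N f y'}"

definition replicate_profile :: "nat \<Rightarrow> real^'n \<Rightarrow> nat \<Rightarrow> real^'n" where
  "replicate_profile N z = (\<lambda>i. if i \<in> {1..N} then z else 0)"

section \<open>Controller\<close>

text \<open>
  Below \<open>s\<close> is the value of \<open>\<mu>\<close>, \<open>\<alpha>x\<close> and \<open>\<alpha>s\<close> are the two gain functions, \<open>w\<close> is the reference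
  generated for the agent and \<open>x\<close> a stacked state. One has \<open>L\<^sub>q = q - 1\<close>, and \<open>\<delta>\<close> applied to \<open>\<alpha>x\<close> and to \<open>\<alpha>s\<close> gives
  \<open>\<delta>\<^sub>x\<close> and \<open>\<delta>\<^sub>s\<close>.
\<close>

definition \<delta> :: "(real \<Rightarrow> real) \<Rightarrow> real \<Rightarrow> real" where
  "\<delta> \<alpha> s = deriv \<alpha> s * s\<^sup>2 * inverse (\<alpha> s)"

definition B_gain :: "nat \<Rightarrow> (nat \<Rightarrow> real) \<Rightarrow> (real \<Rightarrow> real) \<Rightarrow> real \<Rightarrow> real" where
  "B_gain m k \<alpha>x s = inverse (k 1) * inverse (\<alpha>x s ^ (m - 1))"

definition K_tilde :: "nat \<Rightarrow> (nat \<Rightarrow> real) \<Rightarrow> nat \<Rightarrow> real" where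
  "K_tilde m k q = (if q < m then k q else 1)"

definition e_s :: "real^'n \<Rightarrow> (nat \<Rightarrow> real^'n) \<Rightarrow> nat \<Rightarrow> real^'n" where
  "e_s w x q = (if q = 1 then x 1 - w else x q)"

definition s_tilde ::
  "nat \<Rightarrow> (nat \<Rightarrow> real) \<Rightarrow> (real \<Rightarrow> real) \<Rightarrow> real \<Rightarrow> real^'n \<Rightarrow> (nat \<Rightarrow> real^'n) \<Rightarrow> real^'n" where
  "s_tilde m k \<alpha>x s w x =
     inverse (k 1) *\<^sub>R (\<Sum>q=1..m. (K_tilde m k q * inverse (\<alpha>x s ^ (q - 1))) *\<^sub>R e_s w x q)"

text \<open>Blocks \<open>1..m - 1\<close> of the time derivative of \<open>r\<^sub>1\<close> along the chain of integrators.\<close>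

definition r1_dot :: "(real \<Rightarrow> real) \<Rightarrow> real \<Rightarrow> (nat \<Rightarrow> real^'n) \<Rightarrow> nat \<Rightarrow> real^'n" where
  "r1_dot \<alpha>x s x q =
     inverse (\<alpha>x s ^ (q - 1)) *\<^sub>R (x (q + 1) - (real (q - 1) * \<delta> \<alpha>x s) *\<^sub>R x q)"

definition \<pi>_term ::
  "nat \<Rightarrow> (nat \<Rightarrow> real) \<Rightarrow> (real \<Rightarrow> real) \<Rightarrow> real \<Rightarrow> (nat \<Rightarrow> real^'n) \<Rightarrow> real^'n" where
  "\<pi>_term m k \<alpha>x s x =
     (\<alpha>x s ^ (m - 1)) *\<^sub>R (\<Sum>q=1..m-1. k q *\<^sub>R r1_dot \<alpha>x s x q)
       - (real (m - 1) * \<delta> \<alpha>x s) *\<^sub>R x m"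

definition controller ::
  "nat \<Rightarrow> (nat \<Rightarrow> real) \<Rightarrow> (real \<Rightarrow> real) \<Rightarrow> (real \<Rightarrow> real) \<Rightarrow> real \<Rightarrow> ((nat \<Rightarrow> real^'n) \<Rightarrow> real)
     \<Rightarrow> real \<Rightarrow> real^'n \<Rightarrow> (nat \<Rightarrow> real^'n) \<Rightarrow> real^'n" where
  "controller m k \<alpha>x \<alpha>s v \<psi> s w x =
     - (((v + (\<psi> x)\<^sup>2 + 1) * sgn (k 1)) *\<^sub>R (\<alpha>s s *\<^sub>R s_tilde m k \<alpha>x s w x))
     - \<pi>_term m k \<alpha>x s x
     - (inverse (B_gain m k \<alpha>x s) * \<delta> \<alpha>s s) *\<^sub>R s_tilde m k \<alpha>x s w x"

section \<open>Closed-loop trajectories on a time interval\<close>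

definition generator_trajectory ::
  "nat \<Rightarrow> (nat \<Rightarrow> nat \<Rightarrow> real) \<Rightarrow> (nat \<Rightarrow> real^'n \<Rightarrow> real) \<Rightarrow> (real \<Rightarrow> real) \<Rightarrow> real \<Rightarrow> real \<Rightarrow> real set
     \<Rightarrow> (nat \<Rightarrow> real \<Rightarrow> real^'n) \<Rightarrow> (nat \<Rightarrow> real \<Rightarrow> real^'n) \<Rightarrow> bool" where
  "generator_trajectory N a f \<alpha> T t0 I w p \<longleftrightarrow>
     (\<forall>i\<in>{1..N}. \<forall>t\<in>I.
        (w i has_vector_derivative
           - (\<alpha> (\<mu> T t0 t) *\<^sub>R
                ((\<Sum>j\<in>neighbours N a i. a i j *\<^sub>R (w i t - w j t)) + gradient (f i) (w i t) + p i t)))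
           (at t within I) \<and>
        (p i has_vector_derivative
           \<alpha> (\<mu> T t0 t) *\<^sub>R (\<Sum>j\<in>neighbours N a i. a i j *\<^sub>R (w i t - w j t)))
           (at t within I))"

definition chain_trajectory ::
  "nat \<Rightarrow> ((nat \<Rightarrow> real^'n) \<Rightarrow> (nat \<Rightarrow> real) \<Rightarrow> real^'n) \<Rightarrow> real set
     \<Rightarrow> (real \<Rightarrow> nat \<Rightarrow> real) \<Rightarrow> (real \<Rightarrow> real^'n) \<Rightarrow> (real \<Rightarrow> nat \<Rightarrow> real^'n) \<Rightarrow> bool" where
  "chain_trajectory m \<phi> I d u x \<longleftrightarrow>
     (\<forall>t\<in>I. x t \<in> stacked m \<and>
        (\<forall>q\<in>{1..m-1}. ((\<lambda>\<tau>. x \<tau> q) has_vector_derivative x t (q + 1)) (at t within I)) \<and>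
        ((\<lambda>\<tau>. x \<tau> m) has_vector_derivative u t + \<phi> (x t) (d t)) (at t within I))"

end

theory Submission
  imports Defs
begin

text \<open>
  Write \<open>g\<close>, \<open>a\<close> and \<open>\<sigma>\<close> for \<open>\<alpha>\<close>, \<open>\<alpha>x\<close> and \<open>\<alpha>s\<close> evaluated at \<open>\<mu>(t)\<close>. Because \<open>\<mu>' = \<mu>^2\<close>, the growth
  conditions become \<open>g' \<le> (cs/2) g^2\<close>, \<open>a' \<le> v1/(2 v2) a^2\<close> and \<open>a \<le> (cs/v1) g\<close> in ordinary time.
  The generator has a Lyapunov function \<open>E\<close> with \<open>E' \<le> - 2 cs g E\<close>, so \<open>E g^2 a^(2(m-1))\<close> is
  nonincreasing: \<open>a^(m-1) w'\<close> is bounded, and \<open>w\<close> tends to \<open>z\<close> since \<open>g\<close> tends to infinity. The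
  scaled sliding variable \<open>\<sigma> s\<close> then satisfies a dissipative inequality and stays bounded, and \<open>DC2\<close>
  turns this into a bound on \<open>a^m s\<close>. For the scaled errors \<open>e\<close>, with blocks \<open>x 1 - w\<close> and
  \<open>x q / a^(q-1)\<close>, the function \<open>Y = a^(2m) e\<^sup>TPe\<close> satisfies \<open>Y' \<le> a (C - \<epsilon> Y)\<close> and is therefore
  bounded. Hence \<open>x\<close> and \<open>u\<close> are bounded, and \<open>x 1 - w = O(a^(-m))\<close> tends to zero.
\<close>

section \<open>Spectral decomposition of real symmetric matrices\<close>

text \<open>The exponents of the weights are dictated by the input. Both \<open>\<pi>_term\<close>
  and the term with \<open>inverse (B_gain m k \<alpha>x s)\<close> multiply the scaled errors by
  \<open>a^m\<close> up to bounded factors, so a bounded \<open>u\<close> requires errors of order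
  \<open>a^(-m)\<close>, not mere convergence. The exponent \<open>m - 1\<close> for
  \<open>w'\<close> has another source: the disturbance reaches the sliding variable through the
  factor \<open>B\<close> of order \<open>a^(-(m-1))\<close>, whereas \<open>w'\<close> enters
  without it, and the damping can dominate both only if \<open>w'\<close> is of that order too. Each
  Lyapunov argument is then a balance of logarithmic rates: the decay must exceed the growth of all
  weights multiplied to the function. All bounds are a priori estimates on \<open>{t0..<b}\<close>.
  The constants refer to a list of eigenvalues with algebraic multiplicity, while the estimates need
  orthonormal eigenvectors in increasing order; the spectral theory below ties the two
  together.\<close>

definition dot :: "nat \<Rightarrow> (nat \<Rightarrow> real) \<Rightarrow> (nat \<Rightarrow> real) \<Rightarrow> real" where
  "dot n x y = (\<Sum>i<n. x i * y i)"

text \<open>The dimension is an argument, not a type, because \<open>(m - 1) * CARD('n)\<close>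
  varies with the agent. Entries with index \<open>n\<close> or more are ignored, so vectors may be
  arbitrary functions.\<close>

definition bil :: "nat \<Rightarrow> (nat \<Rightarrow> nat \<Rightarrow> real) \<Rightarrow> (nat \<Rightarrow> real) \<Rightarrow> (nat \<Rightarrow> real) \<Rightarrow> real" where
  "bil n A x y = (\<Sum>i<n. \<Sum>j<n. A i j * x i * y j)"

lemma dot_commute: "dot n x y = dot n y x"
  by (simp add: dot_def mult.commute)

lemma dot_add_right: "dot n x (\<lambda>i. y i + z i) = dot n x y + dot n x z"
  by (simp add: dot_def algebra_simps sum.distrib)

lemma dot_scale_right: "dot n x (\<lambda>i. c * y i) = c * dot n x y"
  by (simp add: dot_def sum_distrib_left mult.left_commute)

lemma dot_self_nonneg: "0 \<le> dot n x x"
  by (simp add: dot_def sum_nonneg)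

lemma dot_self_eq_0_iff: "dot n x x = 0 \<longleftrightarrow> (\<forall>i<n. x i = 0)"
  by (auto simp: dot_def sum_nonneg_eq_0_iff)

lemma bil_eq_dot: "bil n A x y = dot n x (\<lambda>i. \<Sum>j<n. A i j * y j)"
  by (simp add: bil_def dot_def sum_distrib_left mult_ac)

lemma bil_commute:
  assumes "\<And>i j. i < n \<Longrightarrow> j < n \<Longrightarrow> A i j = A j i"
  shows "bil n A x y = bil n A y x"
proof -
  have "bil n A x y = (\<Sum>j<n. \<Sum>i<n. A i j * x i * y j)"
    unfolding bil_def by (rule sum.swap)
  also have "\<dots> = bil n A y x"
    unfolding bil_def by (intro sum.cong refl) (simp add: assms mult_ac)
  finally show ?thesis .
qed

lemma bil_add_right: "bil n A x (\<lambda>i. y i + z i) = bil n A x y + bil n A x z"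
  by (simp add: bil_def algebra_simps sum.distrib)

lemma bil_scale_right: "bil n A x (\<lambda>i. c * y i) = c * bil n A x y"
  by (simp add: bil_def sum_distrib_left mult_ac)

lemma bil_add_left: "bil n A (\<lambda>i. y i + z i) x = bil n A y x + bil n A z x"
  by (simp add: bil_def algebra_simps sum.distrib)

lemma bil_scale_left: "bil n A (\<lambda>i. c * y i) x = c * bil n A y x"
  by (simp add: bil_def sum_distrib_left mult_ac)

text \<open>The \<open>r\<close> vectors are padded with zero rows to an \<open>n\<close> by
  \<open>n\<close> matrix. As \<open>r < n\<close>, some row is zero, the determinant vanishes, and
  a kernel vector is orthogonal to all of them.\<close>

lemma exists_orthogonal_vector:
  fixes V :: "nat \<Rightarrow> nat \<Rightarrow> real"
  assumes "r < n"
  shows "\<exists>x. dot n x x \<noteq> 0 \<and> (\<forall>j<r. dot n (V j) x = 0)"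
proof -
  define c where "c j = (if j < r then vec n (V j) else 0\<^sub>v n)" for j
  define M where "M = mat\<^sub>r n n (\<lambda>i. if i = r then 0\<^sub>v n else c i)"
  have M: "M \<in> carrier_mat n n" by (simp add: M_def)
  have "Determinant.det M = 0"
    unfolding M_def by (rule det_row_0) (use assms in \<open>auto simp: c_def\<close>)
  then obtain v where v: "v \<in> carrier_vec n" "v \<noteq> 0\<^sub>v n" "M *\<^sub>v v = 0\<^sub>v n"
    using det_0_iff_vec_prod_zero[OF M] by auto
  define x where "x i = v $ i" for i
  have 1: "dot n x x \<noteq> 0"
    using v(1,2) by (auto simp: dot_self_eq_0_iff x_def vec_eq_iff)
  have "dot n (V j) x = 0" if "j < r" for j
  proof -
    have jn: "j < n" using that assms by simp
    have "0 = (M *\<^sub>v v) $ j" using v(3) jn by simp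
    also have "\<dots> = row M j \<bullet> v" using M jn by simp
    also have "row M j = vec n (V j)"
      using jn that unfolding M_def by (subst row_mat_of_row_fun) (auto simp: c_def)
    also have "vec n (V j) \<bullet> v = dot n (V j) x"
      using v(1) by (auto simp: scalar_prod_def dot_def x_def atLeast0LessThan intro!: sum.cong)
    finally show ?thesis by simp
  qed
  with 1 show ?thesis by blast
qed

text \<open>Compactness rests on the constraint \<open>x i = 0\<close> from \<open>n\<close> on,
  since \<open>dot n\<close> does not see these coordinates. With it the set is a closed part of a
  product of compact intervals, and Tychonoff's theorem applies.\<close>

lemma compact_orthogonal_sphere:
  "compact {x. (\<forall>i\<ge>n. x i = (0::real)) \<and> dot n x x = 1 \<and> (\<forall>j<(r::nat). dot n (V j) x = 0)}"
    (is "compact ?K")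
proof -
  let ?S = "\<lambda>i. if i < n then {-1..1::real} else {0}"
  have 1: "compact (PiE UNIV ?S)"
  proof -
    have "compactin (product_topology (\<lambda>_. euclideanreal) UNIV) (PiE UNIV ?S)"
      by (subst compactin_PiE) auto
    then show ?thesis
      by (simp add: euclidean_product_topology)
  qed
  have c: "continuous_on UNIV (\<lambda>x::nat\<Rightarrow>real. x i)" for i
    by (rule continuous_on_product_coordinates)
  have cd: "continuous_on UNIV (\<lambda>x. dot n x x)" "continuous_on UNIV (\<lambda>x. dot n (V j) x)" for j
    unfolding dot_def by (intro continuous_intros c)+
  have "?K = (\<Inter>i\<in>{n..}. {x. x i = 0}) \<inter> {x. dot n x x = 1} \<inter> (\<Inter>j\<in>{..<r}. {x. dot n (V j) x = 0})"
    by auto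
  also have "closed \<dots>"
    by (intro closed_Int closed_INT ballI closed_Collect_eq c cd continuous_on_const)
  finally have 2: "closed ?K" .
  have "?K \<subseteq> PiE UNIV ?S"
  proof (clarsimp simp: PiE_def Pi_def)
    fix x :: "nat \<Rightarrow> real" and i
    assume d: "dot n x x = 1" and i: "i < n"
    have "x i * x i \<le> dot n x x"
      unfolding dot_def by (rule member_le_sum) (use i in auto)
    then have "(x i)\<^sup>2 \<le> 1\<^sup>2" using d by (simp add: power2_eq_square)
    then have "\<bar>x i\<bar> \<le> 1" using abs_le_square_iff[of "x i" 1] by simp
    then show "- 1 \<le> x i \<and> x i \<le> 1" by linarith
  qed
  then have "?K = PiE UNIV ?S \<inter> ?K" by blast
  then show ?thesis using compact_Int_closed[OF 1 2] by simp
qed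

text \<open>Courant-Fischer step: a minimiser of the quadratic form on the unit sphere of the
  orthogonal complement of \<open>V 0, ..., V (r - 1)\<close> is an eigenvector, with the minimum as
  eigenvalue. Minimality is kept in the conclusion because the ordering of the eigenvalues depends
  on it.\<close>

lemma next_eigenvector:
  assumes sym: "\<And>i j. i < n \<Longrightarrow> j < n \<Longrightarrow> A i j = A j i"
    and r: "r < n"
    and ev: "\<And>j i. j < r \<Longrightarrow> i < n \<Longrightarrow> (\<Sum>k<n. A i k * V j k) = lam j * V j i"
  shows "\<exists>w l. dot n w w = 1 \<and> (\<forall>j<r. dot n (V j) w = 0) \<and>
    (\<forall>i<n. (\<Sum>k<n. A i k * w k) = l * w i) \<and>
    (\<forall>x. (\<forall>j<r. dot n (V j) x = 0) \<longrightarrow> l * dot n x x \<le> bil n A x x)"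
proof -
  let ?K = "{x. (\<forall>i\<ge>n. x i = (0::real)) \<and> dot n x x = 1 \<and> (\<forall>j<r. dot n (V j) x = 0)}"
  let ?nrm = "\<lambda>x i. if i < n then inverse (sqrt (dot n x x)) * x i else 0"
  have cong: "dot n y (?nrm x) = inverse (sqrt (dot n x x)) * dot n y x" for x y
    unfolding dot_def sum_distrib_left by (intro sum.cong) (auto simp: mult_ac)
  have nK: "?nrm x \<in> ?K" if "dot n x x \<noteq> 0" "\<forall>j<r. dot n (V j) x = 0" for x
  proof -
    have pos: "dot n x x > 0" using that(1) dot_self_nonneg[of n x] by linarith
    have "dot n (?nrm x) (?nrm x) = inverse (sqrt (dot n x x)) * (inverse (sqrt (dot n x x)) * dot n x x)"
      by (subst cong, subst dot_commute, subst cong) simp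
    also have "\<dots> = 1" using pos by (simp add: field_simps)
    finally show ?thesis using that(2) by (simp add: cong)
  qed
  obtain x0 where x0: "dot n x0 x0 \<noteq> 0" "\<forall>j<r. dot n (V j) x0 = 0"
    using exists_orthogonal_vector[OF r] by blast
  have ne: "?K \<noteq> {}"
  proof
    assume "?K = {}"
    with nK[OF x0] show False by (simp only: empty_iff)
  qed
  have c: "continuous_on UNIV (\<lambda>x::nat\<Rightarrow>real. x i)" for i
    by (rule continuous_on_product_coordinates)
  have "continuous_on ?K (\<lambda>x. bil n A x x)"
    unfolding bil_def by (rule continuous_on_subset[where s=UNIV]) (intro continuous_intros c, simp)
  from continuous_attains_inf[OF compact_orthogonal_sphere ne this]
  obtain w where w: "w \<in> ?K" "\<And>x. x \<in> ?K \<Longrightarrow> bil n A w w \<le> bil n A x x"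
    by (elim bexE) (rule that, assumption, erule bspec)
  define l where "l = bil n A w w"
  have min: "l * dot n x x \<le> bil n A x x" if o: "\<forall>j<r. dot n (V j) x = 0" for x
  proof (cases "dot n x x = 0")
    case True
    then have "\<forall>i<n. x i = 0" by (simp add: dot_self_eq_0_iff)
    with True show ?thesis by (simp add: bil_def)
  next
    case False
    then have pos: "dot n x x > 0" using dot_self_nonneg[of n x] by linarith
    let ?c = "inverse (sqrt (dot n x x))"
    have "l \<le> bil n A (?nrm x) (?nrm x)" unfolding l_def by (intro w(2) nK False o)
    also have "\<dots> = bil n A (\<lambda>i. ?c * x i) (\<lambda>i. ?c * x i)"
      unfolding bil_def by (intro sum.cong) auto
    also have "\<dots> = ?c * ?c * bil n A x x" by (simp add: bil_scale_left bil_scale_right)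
    also have "?c * ?c = inverse (dot n x x)" using pos
      by (simp flip: inverse_mult_distrib)
    finally show ?thesis using pos by (simp add: field_simps)
  qed
  define hh where "hh i = (\<Sum>k<n. A i k * w k) + (- l) * w i" for i
  have ho: "dot n (V j) hh = 0" if "j < r" for j
  proof -
    have "dot n (V j) hh = bil n A (V j) w - l * dot n (V j) w"
      unfolding hh_def by (simp only: dot_add_right dot_scale_right bil_eq_dot)
    also have "bil n A (V j) w = bil n A w (V j)" by (rule bil_commute[OF sym])
    also have "\<dots> = (\<Sum>i<n. w i * (lam j * V j i))"
      unfolding bil_eq_dot dot_def by (intro sum.cong) (use ev that in auto)
    also have "\<dots> = lam j * dot n (V j) w"
      by (simp add: dot_def sum_distrib_left mult_ac)
    finally show ?thesis using w(1) that by simp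
  qed
  define q where "q x = bil n A x x - l * dot n x x" for x
  have hq: "bil n A w hh - l * dot n w hh = dot n hh hh"
  proof -
    have "dot n hh hh = dot n hh (\<lambda>i. (\<Sum>k<n. A i k * w k) + (- l) * w i)"
      by (rule arg_cong[where f = "dot n hh"]) (rule ext, rule hh_def)
    also have "\<dots> = bil n A hh w - l * dot n hh w"
      by (simp only: dot_add_right dot_scale_right bil_eq_dot)
    also have "bil n A hh w = bil n A w hh" by (rule bil_commute[OF sym])
    finally show ?thesis by (simp add: dot_commute[of n w hh])
  qed
  have hq': "bil n A w hh = dot n hh hh + l * dot n w hh" using hq by simp
  have ww: "dot n w w = 1" using w(1) by simp
  have bwh: "bil n A hh w = bil n A w hh" by (rule bil_commute[OF sym])
  (* The residual hh is admissible, so moving the minimiser w along - hh would otherwise decrease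
     the quadratic form to first order. *)
  have "dot n hh hh = 0"
  proof (rule ccontr)
    assume "dot n hh hh \<noteq> 0"
    then have pos: "dot n hh hh > 0" using dot_self_nonneg[of n hh] by linarith
    have ineq: "0 \<le> 2 * t * dot n hh hh + t\<^sup>2 * q hh" for t
    proof -
      let ?x = "\<lambda>i. w i + t * hh i"
      have "\<forall>j<r. dot n (V j) ?x = 0"
        using w(1) ho by (simp add: dot_add_right dot_scale_right)
      from min[OF this] have "0 \<le> bil n A ?x ?x - l * dot n ?x ?x" by simp
      also have "bil n A ?x ?x = bil n A w w + 2 * t * bil n A w hh + t\<^sup>2 * bil n A hh hh"
        unfolding bil_add_right bil_scale_right bil_add_left bil_scale_left bwh
        by (simp add: power2_eq_square algebra_simps)
      also have "dot n ?x ?x = dot n w w + 2 * t * dot n w hh + t\<^sup>2 * dot n hh hh"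
        by (simp add: dot_add_right dot_scale_right dot_commute[of n ?x] power2_eq_square algebra_simps
            dot_commute[of n hh w])
      finally show ?thesis unfolding l_def[symmetric] q_def hq' ww by (simp add: algebra_simps)
    qed
    \<comment> \<open>\<open>q hh\<close> may be zero, so the parabola in \<open>t\<close> is
      majorised with the strictly positive coefficient \<open>Q\<close>. At its minimiser
      \<open>t = - dot n hh hh / Q\<close> the majorant is negative.\<close>
    define Q where "Q = \<bar>q hh\<bar> + 1"
    have Q: "Q > 0" "q hh \<le> Q" by (auto simp: Q_def)
    have "0 \<le> 2 * (- dot n hh hh / Q) * dot n hh hh + (- dot n hh hh / Q)\<^sup>2 * q hh"
      by (rule ineq)
    also have "\<dots> \<le> 2 * (- dot n hh hh / Q) * dot n hh hh + (- dot n hh hh / Q)\<^sup>2 * Q"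
      using Q by (intro add_left_mono mult_left_mono) auto
    also have "\<dots> = - (dot n hh hh)\<^sup>2 / Q"
      using Q by (simp add: power2_eq_square field_simps)
    also have "\<dots> < 0" using Q pos by (simp add: field_simps)
    finally show False by simp
  qed
  then have "\<forall>i<n. (\<Sum>k<n. A i k * w k) = l * w i"
    by (simp add: dot_self_eq_0_iff hh_def)
  then show ?thesis using w(1) min by blast
qed

definition ordered_eigenbasis ::
  "nat \<Rightarrow> (nat \<Rightarrow> nat \<Rightarrow> real) \<Rightarrow> (nat \<Rightarrow> real) \<Rightarrow> (nat \<Rightarrow> nat \<Rightarrow> real) \<Rightarrow> bool" where
  "ordered_eigenbasis n A lam V \<longleftrightarrow>
     (\<forall>j<n. \<forall>i\<le>j. lam i \<le> lam j) \<and>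
     (\<forall>i<n. \<forall>j<n. dot n (V i) (V j) = (if i = j then 1 else 0)) \<and>
     (\<forall>j<n. \<forall>i<n. (\<Sum>k<n. A i k * V j k) = lam j * V j i)"

lemma ordered_eigenbasisD:
  assumes "ordered_eigenbasis n A lam V"
  shows "i \<le> j \<Longrightarrow> j < n \<Longrightarrow> lam i \<le> lam j"
    and "i < n \<Longrightarrow> j < n \<Longrightarrow> dot n (V i) (V j) = (if i = j then 1 else 0)"
    and "j < n \<Longrightarrow> i < n \<Longrightarrow> (\<Sum>k<n. A i k * V j k) = lam j * V j i"
  using assms unfolding ordered_eigenbasis_def by blast+

lemma spectral_decomposition:
  assumes sym: "\<And>i j. i < n \<Longrightarrow> j < n \<Longrightarrow> A i j = (A j i :: real)"
  obtains lam V where "ordered_eigenbasis n A lam V"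
proof -
  \<comment> \<open>The fourth conjunct strengthens the induction: \<open>lam j\<close> is minimal
    on the complement of the earlier eigenvectors. The new vector lies in all these complements,
    whence \<open>lam i \<le> l\<close> for \<open>i < r\<close>.\<close>
  have "\<exists>lam V. (\<forall>j<r. \<forall>i\<le>j. lam i \<le> lam j) \<and>
      (\<forall>i<r. \<forall>j<r. dot n (V i) (V j) = (if i = j then 1 else (0::real))) \<and>
      (\<forall>j<r. \<forall>i<n. (\<Sum>k<n. A i k * V j k) = lam j * V j i) \<and>
      (\<forall>j<r. \<forall>x. (\<forall>i<j. dot n (V i) x = 0) \<longrightarrow> lam j * dot n x x \<le> bil n A x x)"
    if "r \<le> n" for r
    using that
  proof (induction r)
    case 0
    show ?case by simp
  next
    case (Suc r)
    from Suc.IH[OF Suc_leD[OF Suc.prems]] obtain lam V where IH0: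
        "\<forall>j<r. \<forall>i\<le>j. lam i \<le> (lam j :: real)"
        "\<forall>i<r. \<forall>j<r. dot n (V i) (V j) = (if i = j then 1 else (0::real))"
        "\<forall>j<r. \<forall>i<n. (\<Sum>k<n. A i k * V j k) = lam j * V j i"
        "\<forall>j<r. \<forall>x. (\<forall>i<j. dot n (V i) x = 0) \<longrightarrow> lam j * dot n x x \<le> bil n A x x"
      by (elim exE conjE) (rule that)
    then have
      IH: "\<And>j i. j < r \<Longrightarrow> i \<le> j \<Longrightarrow> lam i \<le> lam j"
        "\<And>i j. i < r \<Longrightarrow> j < r \<Longrightarrow> dot n (V i) (V j) = (if i = j then 1 else 0)"
        "\<And>j i. j < r \<Longrightarrow> i < n \<Longrightarrow> (\<Sum>k<n. A i k * V j k) = lam j * V j i"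
        "\<And>j x. j < r \<Longrightarrow> (\<forall>i<j. dot n (V i) x = 0) \<Longrightarrow> lam j * dot n x x \<le> bil n A x x"
      by blast+
    have rn: "r < n" using Suc.prems by simp
    obtain w l where w: "dot n w w = 1" "\<forall>j<r. dot n (V j) w = 0"
      "\<forall>i<n. (\<Sum>k<n. A i k * w k) = l * w i"
      "\<forall>x. (\<forall>j<r. dot n (V j) x = 0) \<longrightarrow> l * dot n x x \<le> bil n A x x"
      using next_eigenvector[where A=A and V=V and lam=lam, OF sym rn IH(3)] by blast
    have bw: "bil n A w w = l"
    proof -
      have "bil n A w w = dot n w (\<lambda>i. l * w i)"
        unfolding bil_eq_dot using w(3) by (simp add: dot_def)
      then show ?thesis by (simp add: dot_scale_right w(1))
    qed
    have wV: "dot n w (V j) = 0" if "j < r" for j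
      using w(2) that dot_commute[of n w "V j"] by simp
    have lw: "lam i \<le> l" if "i < r" for i
      using IH(4)[OF that, of w] w(1,2) bw that by simp
    show ?case
    proof (intro exI[of _ "lam(r := l)"] exI[of _ "V(r := w)"] conjI)
      show "\<forall>j<Suc r. \<forall>i\<le>j. (lam(r := l)) i \<le> (lam(r := l)) j"
        using IH(1) lw by (auto simp: less_Suc_eq)
      show "\<forall>i<Suc r. \<forall>j<Suc r. dot n ((V(r := w)) i) ((V(r := w)) j) = (if i = j then 1 else 0)"
        using IH(2) w(1,2) wV by (simp add: less_Suc_eq all_conj_distrib disj_imp)
      show "\<forall>j<Suc r. \<forall>i<n. (\<Sum>k<n. A i k * (V(r := w)) j k) = (lam(r := l)) j * (V(r := w)) j i"
        using IH(3) w(3) by (auto simp: less_Suc_eq)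
      show "\<forall>j<Suc r. \<forall>x. (\<forall>i<j. dot n ((V(r := w)) i) x = 0) \<longrightarrow>
          (lam(r := l)) j * dot n x x \<le> bil n A x x"
        using IH(4) w(4) by (auto simp: less_Suc_eq)
    qed
  qed
  from this[of n, OF order_refl] obtain lam V where
    "\<forall>j<n. \<forall>i\<le>j. lam i \<le> (lam j :: real)"
    "\<forall>i<n. \<forall>j<n. dot n (V i) (V j) = (if i = j then 1 else (0::real))"
    "\<forall>j<n. \<forall>i<n. (\<Sum>k<n. A i k * V j k) = lam j * V j i"
    by (elim exE conjE) (rule that)
  then have "ordered_eigenbasis n A lam V"
    unfolding ordered_eigenbasis_def by (intro conjI)
  then show ?thesis by (rule that)
qed

text \<open>The matrix with rows \<open>V j\<close> has its transpose as right inverse. For a square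
  matrix this is also a left inverse, so the columns are orthonormal too.\<close>

lemma orthonormal_dual:
  assumes "\<And>i j. i < n \<Longrightarrow> j < n \<Longrightarrow> dot n (V i) (V j) = (if i = j then 1 else 0)"
    and "i < n" "k < n"
  shows "(\<Sum>j<n. V j i * V j k) = (if i = k then 1 else 0)"
proof -
  define W where "W = mat n n (\<lambda>(j, i). V j i)"
  have W: "W \<in> carrier_mat n n" by (simp add: W_def)
  have "W * transpose_mat W = 1\<^sub>m n"
    by (rule eq_matI) (use assms(1) in \<open>auto simp: W_def scalar_prod_def dot_def atLeast0LessThan\<close>)
  then have "transpose_mat W * W = 1\<^sub>m n"
    using W by (intro mat_mult_left_right_inverse[of W n]) auto
  then have "(transpose_mat W * W) $$ (i, k) = 1\<^sub>m n $$ (i, k)" by simp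
  then show ?thesis using assms(2,3)
    by (auto simp: W_def scalar_prod_def atLeast0LessThan split: if_splits)
qed

text \<open>The entries are vectors of an inner product space because each agent carries a state in
  R^n: only the agent index is expanded, which amounts to using \<open>V\<close> tensored with the
  identity.\<close>

lemma parseval:
  fixes w u :: "nat \<Rightarrow> 'b::real_inner"
  assumes "\<And>i j. i < n \<Longrightarrow> j < n \<Longrightarrow> dot n (V i) (V j) = (if i = j then 1 else 0)"
  shows "(\<Sum>j<n. inner (\<Sum>i<n. V j i *\<^sub>R w i) (\<Sum>i<n. V j i *\<^sub>R u i)) = (\<Sum>i<n. inner (w i) (u i))"
proof -
  have "(\<Sum>j<n. inner (\<Sum>i<n. V j i *\<^sub>R w i) (\<Sum>i<n. V j i *\<^sub>R u i)) =
      (\<Sum>j<n. \<Sum>i<n. \<Sum>k<n. V j i * V j k * inner (w i) (u k))"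
    by (intro sum.cong refl, subst inner_sum_left) (simp add: inner_sum_right mult_ac sum_distrib_left)
  also have "\<dots> = (\<Sum>i<n. \<Sum>j<n. \<Sum>k<n. V j i * V j k * inner (w i) (u k))"
    by (rule sum.swap)
  also have "\<dots> = (\<Sum>i<n. \<Sum>k<n. \<Sum>j<n. V j i * V j k * inner (w i) (u k))"
    by (intro sum.cong refl sum.swap)
  also have "\<dots> = (\<Sum>i<n. \<Sum>k<n. (\<Sum>j<n. V j i * V j k) * inner (w i) (u k))"
    by (simp add: sum_distrib_right)
  also have "\<dots> = (\<Sum>i<n. \<Sum>k<n. if i = k then inner (w i) (u k) else 0)"
    by (intro sum.cong refl) (simp add: orthonormal_dual[OF assms])
  also have "\<dots> = (\<Sum>i<n. inner (w i) (u i))"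
    by (intro sum.cong refl) (simp add: sum.delta)
  finally show ?thesis .
qed

text \<open>Symmetry moves the matrix from \<open>w\<close> onto the eigenvector, so in
  eigencoordinates it acts as multiplication by the eigenvalue.\<close>

lemma eigenvector_coordinates:
  fixes w :: "nat \<Rightarrow> 'b::real_vector"
  assumes sym: "\<And>i j. i < n \<Longrightarrow> j < n \<Longrightarrow> A i j = (A j i :: real)"
    and ev: "\<And>i. i < n \<Longrightarrow> (\<Sum>k<n. A i k * v k) = l * v i"
  shows "(\<Sum>i<n. v i *\<^sub>R (\<Sum>k<n. A i k *\<^sub>R w k)) = l *\<^sub>R (\<Sum>k<n. v k *\<^sub>R w k)"
proof -
  have "(\<Sum>i<n. v i *\<^sub>R (\<Sum>k<n. A i k *\<^sub>R w k)) = (\<Sum>i<n. \<Sum>k<n. (A i k * v i) *\<^sub>R w k)"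
    by (simp add: scaleR_sum_right mult.commute)
  also have "\<dots> = (\<Sum>k<n. \<Sum>i<n. (A i k * v i) *\<^sub>R w k)" by (rule sum.swap)
  also have "\<dots> = (\<Sum>k<n. (\<Sum>i<n. A k i * v i) *\<^sub>R w k)"
    by (intro sum.cong refl) (simp add: scaleR_sum_left sym)
  also have "\<dots> = l *\<^sub>R (\<Sum>k<n. v k *\<^sub>R w k)"
    by (simp add: ev scaleR_sum_right)
  finally show ?thesis .
qed

text \<open>Identifies the minima found above with the algebraic notions. The basis makes
  \<open>A\<close> similar to a diagonal matrix, so the characteristic polynomial is the product of
  the factors \<open>X - lam j\<close>. Since \<open>lam\<close> is increasing, sorting its roots
  gives this very list, multiplicities included.\<close>

lemma symmetric_matrix_spectral:
  fixes A :: "real mat"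
  assumes A: "A \<in> carrier_mat n n" and sym: "\<And>i j. i < n \<Longrightarrow> j < n \<Longrightarrow> A $$ (i, j) = A $$ (j, i)"
  obtains lam V where "ordered_eigenbasis n (\<lambda>i j. A $$ (i, j)) lam V"
    "eigenvalues_sorted A = map lam [0..<n]" "spectrum A = lam ` {..<n}"
proof -
  obtain lam V where ob: "ordered_eigenbasis n (\<lambda>i j. A $$ (i, j)) lam V"
    by (rule spectral_decomposition[OF sym])
  note V = ordered_eigenbasisD[OF ob]
  define W where "W = mat n n (\<lambda>(j, i). V j i)"
  define L where "L = mat_diag n lam"
  have W: "W \<in> carrier_mat n n" and L: "L \<in> carrier_mat n n" by (simp_all add: W_def L_def mat_diag_def)
  have WW: "W * transpose_mat W = 1\<^sub>m n"
    by (rule eq_matI) (use V(2) in \<open>auto simp: W_def scalar_prod_def dot_def atLeast0LessThan\<close>)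
  then have WW': "transpose_mat W * W = 1\<^sub>m n"
    using W by (intro mat_mult_left_right_inverse[of W n]) auto
  have AW: "A * transpose_mat W = transpose_mat W * L"
  proof (rule eq_matI)
    fix i j assume "i < dim_row (transpose_mat W * L)" "j < dim_col (transpose_mat W * L)"
    then have ij: "i < n" "j < n" using W L by auto
    have "(A * transpose_mat W) $$ (i, j) = (\<Sum>k<n. A $$ (i, k) * V j k)"
      using ij A by (simp add: W_def scalar_prod_def atLeast0LessThan)
    also have "\<dots> = lam j * V j i" by (rule V(3)[OF ij(2,1)])
    also have "\<dots> = (\<Sum>k<n. V k i * (if k = j then lam j else 0))"
      using ij by (simp add: sum.delta if_distrib cong: if_cong)
    also have "\<dots> = (transpose_mat W * L) $$ (i, j)"
      using ij by (simp add: W_def L_def mat_diag_def scalar_prod_def atLeast0LessThan)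
    finally show "(A * transpose_mat W) $$ (i, j) = (transpose_mat W * L) $$ (i, j)" .
  qed (use A W L in auto)
  have "A = A * (transpose_mat W * W)" using A WW' by simp
  also have "\<dots> = transpose_mat W * L * W" using A W by (simp add: AW flip: assoc_mult_mat[of _ n n _ n _ n])
  finally have "similar_mat A L"
    using WW WW' A W L by (intro similar_matI[of A L "transpose_mat W" W n]) auto
  then have "char_poly A = char_poly L" by (rule char_poly_similar)
  also have "\<dots> = (\<Prod>a\<leftarrow>diag_mat L. [:- a, 1:])"
    by (rule char_poly_upper_triangular[OF L]) (auto simp: L_def mat_diag_def)
  also have "diag_mat L = map lam [0..<n]"
    by (auto simp: diag_mat_def L_def mat_diag_def)
  finally have cp: "char_poly A = (\<Prod>a\<leftarrow>map lam [0..<n]. [:- a, 1:])" .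
  have proots_list: "proots (\<Prod>a\<leftarrow>xs. [:- a, 1:]) = mset xs" for xs :: "real list"
  proof (induction xs)
    case (Cons a xs)
    have "(\<Prod>a\<leftarrow>xs. [:- a, 1:]) \<noteq> 0" by (auto simp: prod_list_zero_iff)
    then show ?case using Cons by (simp add: proots_mult del: mult_pCons_left)
  qed simp
  have "sorted (map lam [0..<n])" using V(1) by (auto simp: sorted_iff_nth_mono)
  then have "eigenvalues_sorted A = map lam [0..<n]"
    unfolding eigenvalues_sorted_def cp proots_list sorted_list_of_multiset_mset by (rule sorted_sort_id)
  moreover have "spectrum A = lam ` {..<n}"
    unfolding spectrum_def eigenvalue_root_char_poly[OF A] cp
    by (auto simp: poly_prod_list prod_list_zero_iff)
  ultimately show ?thesis by (rule that[OF ob])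
qed

lemma bil_coordinates:
  assumes sym: "\<And>i j. i < n \<Longrightarrow> j < n \<Longrightarrow> A i j = A j i"
    and ob: "ordered_eigenbasis n A lam V"
  shows "bil n A x x = (\<Sum>j<n. lam j * (dot n (V j) x)\<^sup>2)" "dot n x x = (\<Sum>j<n. (dot n (V j) x)\<^sup>2)"
proof -
  have "bil n A x x = (\<Sum>i<n. inner (x i) (\<Sum>k<n. A i k *\<^sub>R x k))"
    by (simp add: bil_eq_dot dot_def)
  also have "\<dots> = (\<Sum>j<n. inner (\<Sum>i<n. V j i *\<^sub>R x i) (\<Sum>i<n. V j i *\<^sub>R (\<Sum>k<n. A i k *\<^sub>R x k)))"
    by (rule parseval[OF ordered_eigenbasisD(2)[OF ob], symmetric])
  also have "\<dots> = (\<Sum>j<n. lam j * (dot n (V j) x)\<^sup>2)"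
    by (intro sum.cong refl, subst eigenvector_coordinates[where A=A, OF sym ordered_eigenbasisD(3)[OF ob]])
      (auto simp: dot_def power2_eq_square)
  finally show "bil n A x x = (\<Sum>j<n. lam j * (dot n (V j) x)\<^sup>2)" .
  show "dot n x x = (\<Sum>j<n. (dot n (V j) x)\<^sup>2)"
    using parseval[OF ordered_eigenbasisD(2)[OF ob], where w=x and u=x]
    by (simp add: dot_def power2_eq_square)
qed

lemma pos_def_rayleigh:
  assumes "pos_def n A" and "0 < n"
  shows "0 < lambda_min A" "lambda_min A \<le> lambda_max A"
    "lambda_min A * dot n x x \<le> bil n (\<lambda>i j. A $$ (i, j)) x x"
    "bil n (\<lambda>i j. A $$ (i, j)) x x \<le> lambda_max A * dot n x x"
proof -
  let ?A = "\<lambda>i j. A $$ (i, j)"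
  have A: "A \<in> carrier_mat n n" and T: "transpose_mat A = A"
    and pd: "\<And>w. w \<in> carrier_vec n \<Longrightarrow> w \<noteq> 0\<^sub>v n \<Longrightarrow> 0 < scalar_prod w (A *\<^sub>v w)"
    using assms by (auto simp: pos_def_def)
  have sym: "?A i j = ?A j i" if "i < n" "j < n" for i j
    using that A T by (metis carrier_matD index_transpose_mat(1))
  obtain lam V where ob: "ordered_eigenbasis n ?A lam V"
    and sp: "eigenvalues_sorted A = map lam [0..<n]" "spectrum A = lam ` {..<n}"
    by (rule symmetric_matrix_spectral[OF A sym])
  note V = ordered_eigenbasisD[OF ob]
  have co: "bil n ?A x x = (\<Sum>j<n. lam j * (dot n (V j) x)\<^sup>2)"
    "dot n x x = (\<Sum>j<n. (dot n (V j) x)\<^sup>2)" for x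
    by (rule bil_coordinates[OF _ ob], erule sym, assumption)+
  have mem: "lambda_min A \<in> lam ` {..<n}" "lambda_max A \<in> lam ` {..<n}"
    unfolding lambda_min_def lambda_max_def sp(2)
    using assms(2) by (intro Min_in Max_in; force)+
  have le: "lambda_min A \<le> lam j" "lam j \<le> lambda_max A" if "j < n" for j
    unfolding lambda_min_def lambda_max_def sp(2) using that by auto
  have pos: "0 < lam j" if j: "j < n" for j
  proof -
    let ?w = "vec n (V j)"
    have d: "dot n (V j) (V j) = 1" using V(2)[OF j j] by simp
    have "?w \<noteq> 0\<^sub>v n"
    proof
      assume "?w = 0\<^sub>v n"
      then have "V j i = 0" if "i < n" for i using that by (metis index_vec index_zero_vec(1))
      then show False using d by (simp add: dot_def)
    qed
    then have "0 < scalar_prod ?w (A *\<^sub>v ?w)" by (intro pd) auto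
    also have "\<dots> = dot n (V j) (\<lambda>i. \<Sum>k<n. ?A i k * V j k)"
      using A by (auto simp: scalar_prod_def dot_def atLeast0LessThan)
    also have "\<dots> = dot n (V j) (\<lambda>i. lam j * V j i)"
      unfolding dot_def by (intro sum.cong) (simp_all add: V(3) j)
    also have "\<dots> = lam j" by (simp add: dot_scale_right d)
    finally show ?thesis .
  qed
  show "0 < lambda_min A" using mem(1) pos by auto
  show "lambda_min A \<le> lambda_max A" using le[OF assms(2)] by linarith
  show "lambda_min A * dot n x x \<le> bil n ?A x x"
    unfolding co sum_distrib_left by (intro sum_mono mult_right_mono) (use le in auto)
  show "bil n ?A x x \<le> lambda_max A * dot n x x"
    unfolding co sum_distrib_left by (intro sum_mono mult_right_mono) (use le in auto)
qed

text \<open>Expansion of the nonnegative form at \<open>c x - y\<close>, divided by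
  \<open>c\<close>.\<close>

lemma bil_young:
  assumes sym: "\<And>i j. i < n \<Longrightarrow> j < n \<Longrightarrow> A i j = A j i"
    and psd: "\<And>x. 0 \<le> bil n A x x" and c: "0 < c"
  shows "2 * bil n A x y \<le> c * bil n A x x + inverse c * bil n A y y"
proof -
  have "0 \<le> bil n A (\<lambda>i. c * x i + (- 1) * y i) (\<lambda>i. c * x i + (- 1) * y i)" by (rule psd)
  also have "\<dots> = c * (c * bil n A x x) - c * (2 * bil n A x y) + bil n A y y"
    unfolding bil_add_right bil_scale_right bil_add_left bil_scale_left
    by (simp add: bil_commute[where A = A and x = y and y = x, OF sym] algebra_simps)
  finally have "c * (2 * bil n A x y) \<le> c * (c * bil n A x x) + bil n A y y" by simp
  also have "\<dots> = c * (c * bil n A x x + inverse c * bil n A y y)"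
    using c by (simp add: field_simps)
  finally show ?thesis using c by simp
qed

section \<open>Differential inequalities\<close>

lemma at_within_Ico:
  fixes t :: real
  assumes "t0 < t" "t < b"
  shows "at t within {t0..<b} = at t"
  using assms by (intro at_within_interior) auto

text \<open>The sign is required only strictly between \<open>s\<close> and \<open>r\<close>: at the
  moment of leaving a sublevel set the derivative has no known sign.\<close>

lemma nonincreasing_if_deriv_nonpos:
  fixes V :: "real \<Rightarrow> real"
  assumes d: "\<And>t. t \<in> {t0..<b} \<Longrightarrow> (V has_real_derivative V' t) (at t within {t0..<b})"
    and le: "\<And>t. s < t \<Longrightarrow> t < r \<Longrightarrow> V' t \<le> 0"
    and sr: "t0 \<le> s" "s \<le> r" "r < b"
  shows "V r \<le> V s"
proof (rule DERIV_nonpos_imp_decreasing_open[OF sr(2)])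
  show "\<exists>y. DERIV V t :> y \<and> y \<le> 0" if "s < t" "t < r" for t
    using d[of t] le[OF that] that sr at_within_Ico[of t0 t b] by auto
  have "continuous_on {t0..<b} V"
    using d by (meson DERIV_continuous continuous_on_eq_continuous_within)
  then show "continuous_on {s..r} V"
    by (rule continuous_on_subset) (use sr in auto)
qed

text \<open>Take the last time \<open>s\<close> up to \<open>t\<close> at which \<open>V\<close> is
  at most \<open>max (V t0) c\<close>. Beyond it \<open>V\<close> exceeds \<open>c\<close> and is
  nonincreasing, so it cannot have risen above the level. No decay rate enters, hence coefficients
  that blow up at the terminal time do no harm.\<close>

lemma barrier_bound:
  fixes V :: "real \<Rightarrow> real"
  assumes d: "\<And>t. t \<in> {t0..<b} \<Longrightarrow> (V has_real_derivative V' t) (at t within {t0..<b})"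
    and le: "\<And>t. t \<in> {t0..<b} \<Longrightarrow> c < V t \<Longrightarrow> V' t \<le> 0"
    and t: "t \<in> {t0..<b}"
  shows "V t \<le> max (V t0) c"
proof (rule ccontr)
  let ?M = "max (V t0) c"
  assume "\<not> V t \<le> ?M"
  then have gt: "V t > ?M" by (simp only: not_le)
  define S where "S = {s \<in> {t0..t}. V s \<le> ?M}"
  have "continuous_on {t0..<b} V"
    using d by (meson DERIV_continuous continuous_on_eq_continuous_within)
  then have "continuous_on {t0..t} V"
    by (rule continuous_on_subset) (use t in auto)
  then have "closed S"
    unfolding S_def by (intro continuous_on_closed_Collect_le continuous_on_const closed_atLeastAtMost)
  moreover have ne: "t0 \<in> S" and bd: "bdd_above S"
    using t by (auto simp: S_def intro!: bdd_aboveI[of _ t])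
  ultimately have sS: "Sup S \<in> S" using closed_contains_Sup by blast
  define s where "s = Sup S"
  have s: "t0 \<le> s" "s \<le> t" "V s \<le> ?M" using sS by (auto simp: S_def s_def)
  have "V t \<le> V s"
  proof (rule nonincreasing_if_deriv_nonpos[where V=V and V'=V', OF d])
    fix r assume r: "s < r" "r < t"
    have "r \<notin> S" using r cSup_upper[OF _ bd, of r] by (auto simp: s_def)
    then have "V r > ?M" using r s by (auto simp: S_def)
    then show "V' r \<le> 0" using r s t by (intro le) auto
  qed (use s t in auto)
  then show False using s gt by simp
qed

section \<open>The graph Laplacian\<close>

lemma symmetric_graph_index:
  assumes "connected_weighted_graph N a" "r < N" "c < N"
  shows "a (Suc r) (Suc c) = a (Suc c) (Suc r)" "0 \<le> a (Suc r) (Suc c)" "a (Suc r) (Suc r) = 0"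
  using assms by (auto simp: connected_weighted_graph_def)

lemma neighbours_sum:
  fixes g :: "nat \<Rightarrow> 'b::real_vector"
  assumes "connected_weighted_graph N a" "r < N"
  shows "(\<Sum>j\<in>neighbours N a (Suc r). a (Suc r) j *\<^sub>R g j) = (\<Sum>c<N. a (Suc r) (Suc c) *\<^sub>R g (Suc c))"
proof -
  have "(\<Sum>j\<in>neighbours N a (Suc r). a (Suc r) j *\<^sub>R g j) = (\<Sum>j\<in>{1..N}. a (Suc r) j *\<^sub>R g j)"
  proof (rule sum.mono_neutral_left)
    show "\<forall>j\<in>{1..N} - neighbours N a (Suc r). a (Suc r) j *\<^sub>R g j = 0"
    proof
      fix j assume j: "j \<in> {1..N} - neighbours N a (Suc r)"
      moreover have "0 \<le> a (Suc r) j"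
        using assms j unfolding connected_weighted_graph_def by auto
      ultimately have "a (Suc r) j = 0" by (auto simp: neighbours_def)
      then show "a (Suc r) j *\<^sub>R g j = 0" by simp
    qed
  qed (auto simp: neighbours_def)
  then show ?thesis by (simp add: sum.atLeast1_atMost_eq)
qed

lemma laplacian_apply:
  fixes w :: "nat \<Rightarrow> 'b::real_vector"
  assumes G: "connected_weighted_graph N a" and r: "r < N"
  shows "(\<Sum>k<N. laplacian N a $$ (r, k) *\<^sub>R w (Suc k)) =
    (\<Sum>j\<in>neighbours N a (Suc r). a (Suc r) j *\<^sub>R (w (Suc r) - w j))"
proof -
  let ?d = "\<Sum>c<N. a (Suc r) (Suc c)"
  have d: "(\<Sum>j\<in>neighbours N a (Suc r). a (Suc r) j) = ?d"
    using neighbours_sum[OF G r, of "\<lambda>_. 1::real"] by simp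
  have "(\<Sum>k<N. laplacian N a $$ (r, k) *\<^sub>R w (Suc k)) =
      (\<Sum>k<N. (if r = k then ?d *\<^sub>R w (Suc r) else 0) - a (Suc r) (Suc k) *\<^sub>R w (Suc k))"
    by (intro sum.cong refl) (use r d symmetric_graph_index(3)[OF G r] in \<open>auto simp: laplacian_def\<close>)
  also have "\<dots> = (\<Sum>c<N. a (Suc r) (Suc c) *\<^sub>R (w (Suc r) - w (Suc c)))"
    using r by (simp add: sum_subtractf sum.delta scaleR_diff_right scaleR_sum_left)
  finally show ?thesis by (simp add: neighbours_sum[OF G r])
qed

lemma laplacian_symmetric:
  assumes "connected_weighted_graph N a" "i < N" "j < N"
  shows "laplacian N a $$ (i, j) = laplacian N a $$ (j, i)"
  using assms symmetric_graph_index(1)[OF assms] by (auto simp: laplacian_def)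

lemma laplacian_quadratic_form:
  assumes G: "connected_weighted_graph N a"
  shows "2 * bil N (\<lambda>i j. laplacian N a $$ (i, j)) x x =
    (\<Sum>r<N. \<Sum>c<N. a (Suc r) (Suc c) * (x r - x c)\<^sup>2)"
proof -
  let ?a = "\<lambda>r c. a (Suc r) (Suc c)"
  have "bil N (\<lambda>i j. laplacian N a $$ (i, j)) x x =
      (\<Sum>r<N. x r * (\<Sum>k<N. laplacian N a $$ (r, k) *\<^sub>R x (Suc k - 1)))"
    by (simp add: bil_eq_dot dot_def)
  also have "\<dots> = (\<Sum>r<N. x r * (\<Sum>c<N. ?a r c * (x r - x c)))"
    by (intro sum.cong refl, subst laplacian_apply[where w="\<lambda>k. x (k - 1)", OF G])
      (auto simp: neighbours_sum[where 'b=real, simplified, OF G])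
  finally have 1: "bil N (\<lambda>i j. laplacian N a $$ (i, j)) x x = (\<Sum>r<N. \<Sum>c<N. ?a r c * x r * (x r - x c))"
    by (simp add: sum_distrib_left mult_ac)
  also have "\<dots> = (\<Sum>c<N. \<Sum>r<N. ?a r c * x r * (x r - x c))" by (rule sum.swap)
  also have "\<dots> = (\<Sum>r<N. \<Sum>c<N. ?a r c * x c * (x c - x r))"
    by (intro sum.cong refl) (simp add: symmetric_graph_index(1)[OF G])
  finally have 2: "bil N (\<lambda>i j. laplacian N a $$ (i, j)) x x = (\<Sum>r<N. \<Sum>c<N. ?a r c * x c * (x c - x r))" .
  have "(\<Sum>r<N. \<Sum>c<N. ?a r c * (x r - x c)\<^sup>2) =
      (\<Sum>r<N. \<Sum>c<N. ?a r c * x r * (x r - x c)) + (\<Sum>r<N. \<Sum>c<N. ?a r c * x c * (x c - x r))"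
    unfolding sum.distrib[symmetric] by (intro sum.cong refl) (simp add: power2_eq_square algebra_simps)
  then show ?thesis using 1 2 by simp
qed

text \<open>The form is a sum of nonnegative edge terms. If it vanishes, \<open>x\<close> agrees
  across every edge, and by connectedness along paths between any two agents.\<close>

lemma laplacian_kernel:
  assumes G: "connected_weighted_graph N a"
    and z: "bil N (\<lambda>i j. laplacian N a $$ (i, j)) x x = 0" and ij: "i < N" "j < N"
  shows "x i = x j"
proof -
  let ?E = "{(k, l). k \<in> {1..N} \<and> l \<in> {1..N} \<and> 0 < a k l}"
  have "(\<Sum>r<N. \<Sum>c<N. a (Suc r) (Suc c) * (x r - x c)\<^sup>2) = 0"
    using laplacian_quadratic_form[OF G, of x] z by simp
  moreover have nn: "0 \<le> a (Suc r) (Suc c) * (x r - x c)\<^sup>2" if "r < N" "c < N" for r c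
    using symmetric_graph_index(2)[OF G that] by simp
  ultimately have "(\<Sum>c<N. a (Suc r) (Suc c) * (x r - x c)\<^sup>2) = 0" if "r < N" for r
    using that by (subst (asm) sum_nonneg_eq_0_iff) (auto intro!: sum_nonneg)
  then have "a (Suc r) (Suc c) * (x r - x c)\<^sup>2 = 0" if "r < N" "c < N" for r c
    using that sum_nonneg_eq_0_iff[of "{..<N}" "\<lambda>c. a (Suc r) (Suc c) * (x r - x c)\<^sup>2"] nn by simp
  then have edge: "x r = x c" if "r < N" "c < N" "0 < a (Suc r) (Suc c)" for r c
    using that by fastforce
  have "(k, l) \<in> ?E\<^sup>* \<Longrightarrow> x (k - 1) = x (l - 1)" for k l
  proof (induction rule: rtrancl_induct)
    case (step l l')
    then obtain r c where "l = Suc r" "l' = Suc c" "r < N" "c < N"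
      by (cases l; cases l') auto
    then show ?case using edge[of r c] step by auto
  qed simp
  moreover have "(Suc i, Suc j) \<in> ?E\<^sup>*"
    using G ij unfolding connected_weighted_graph_def by auto
  ultimately show ?thesis by fastforce
qed

text \<open>Constancy of \<open>V 0\<close> is recorded because it makes the zeroth coordinate of a
  family proportional to its sum over the agents, which vanishes for the multiplier error.\<close>

lemma laplacian_spectrum:
  assumes G: "connected_weighted_graph N a" and N: "2 \<le> N"
  obtains lam V where "ordered_eigenbasis N (\<lambda>i j. laplacian N a $$ (i, j)) lam V"
    "lam 1 = lambda2 N a" "lam 0 = 0" "0 < lam 1" "\<And>i. i < N \<Longrightarrow> V 0 i = V 0 0"
proof -
  let ?L = "\<lambda>i j. laplacian N a $$ (i, j)"
  obtain lam V where ob: "ordered_eigenbasis N ?L lam V"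
    and sp: "eigenvalues_sorted (laplacian N a) = map lam [0..<N]"
    by (rule symmetric_matrix_spectral[of "laplacian N a" N])
      (auto simp: laplacian_symmetric[OF G], simp add: laplacian_def)
  note V = ordered_eigenbasisD[OF ob]
  have q: "bil N ?L (V j) (V j) = lam j" if "j < N" for j
  proof -
    have "bil N ?L (V j) (V j) = dot N (V j) (\<lambda>i. lam j * V j i)"
      unfolding bil_eq_dot dot_def using that by (intro sum.cong) (simp_all add: V(3))
    then show ?thesis using V(2)[OF that that] by (simp add: dot_scale_right)
  qed
  have "0 \<le> 2 * bil N ?L x x" for x
    unfolding laplacian_quadratic_form[OF G]
    by (intro sum_nonneg mult_nonneg_nonneg) (auto simp: symmetric_graph_index(2)[OF G])
  then have nn: "0 \<le> lam j" if "j < N" for j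
    using q[OF that] by (metis mult_2 add_neg_neg not_less)
  have const: "V j i = V j 0" if "j < N" "lam j = 0" "i < N" for i j
    using laplacian_kernel[OF G, of "V j" i 0] q that by simp
  \<comment> \<open>If \<open>lam 1\<close> were zero, \<open>V 0\<close> and \<open>V 1\<close>
    would both be constant, hence parallel. The inner products of these two vectors then contradict
    orthonormality.\<close>
  have pos: "0 < lam 1"
  proof (rule ccontr)
    assume "\<not> 0 < lam 1"
    then have "lam 1 = 0" "lam 0 = 0" using nn[of 0] nn[of 1] V(1)[of 0 1] N by auto
    then have c: "V 1 i = V 1 0" "V 0 i = V 0 0" if "i < N" for i
      using const[of 1 i] const[of 0 i] that N by auto
    have "dot N (V k) (V l) = real N * (V k 0 * V l 0)" if "k \<le> 1" "l \<le> 1" for k l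
    proof -
      have "k = 0 \<or> k = 1" "l = 0 \<or> l = 1" using that by auto
      then have e: "V k i * V l i = V k 0 * V l 0" if "i < N" for i
        using c(1)[OF that] c(2)[OF that] by auto
      have "dot N (V k) (V l) = (\<Sum>i<N. V k 0 * V l 0)"
        unfolding dot_def by (intro sum.cong refl, rule e) simp
      then show ?thesis by simp
    qed
    from this[of 0 0] this[of 1 1] this[of 0 1] show False
      using V(2)[of 0 0] V(2)[of 1 1] V(2)[of 0 1] N by auto
  qed
  \<comment> \<open>Otherwise all eigenvalues are positive, while the form vanishes at the all-ones
    vector. That vector would have only zero coordinates and would itself be zero.\<close>
  have z: "lam 0 = 0"
  proof (rule ccontr)
    assume "lam 0 \<noteq> 0"
    then have l: "lam j > 0" if "j < N" for j
      using nn[of 0] V(1)[of 0 j] that N by fastforce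
    have "2 * bil N ?L (\<lambda>_. 1) (\<lambda>_. 1) = 0"
      by (simp add: laplacian_quadratic_form[OF G])
    moreover have "bil N ?L (\<lambda>_. 1) (\<lambda>_. 1) = (\<Sum>j<N. lam j * (dot N (V j) (\<lambda>_. 1))\<^sup>2)"
      by (rule bil_coordinates[OF _ ob]) (rule laplacian_symmetric[OF G])
    ultimately have "(\<Sum>j<N. lam j * (dot N (V j) (\<lambda>_. 1))\<^sup>2) = 0" by simp
    then have "\<forall>j<N. lam j * (dot N (V j) (\<lambda>_. 1))\<^sup>2 = 0"
      by (subst (asm) sum_nonneg_eq_0_iff) (auto simp: nn)
    then have "\<forall>j<N. dot N (V j) (\<lambda>_. 1) = 0" using l by fastforce
    moreover have "dot N (\<lambda>_. 1) (\<lambda>_. 1) = (\<Sum>j<N. (dot N (V j) (\<lambda>_. 1))\<^sup>2)"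
      by (rule bil_coordinates[OF _ ob]) (rule laplacian_symmetric[OF G])
    ultimately have "dot N (\<lambda>_. 1) (\<lambda>_. 1) = 0" by simp
    then show False using N by (simp add: dot_def)
  qed
  show ?thesis
  proof (rule that[OF ob _ z pos])
    show "lam 1 = lambda2 N a" using N by (simp add: lambda2_def sp)
    show "V 0 i = V 0 0" if "i < N" for i using const[of 0 i] z that N by simp
  qed
qed

section \<open>The optimal trajectory generator\<close>

definition coord :: "nat \<Rightarrow> (nat \<Rightarrow> nat \<Rightarrow> real) \<Rightarrow> (nat \<Rightarrow> 'b::real_vector) \<Rightarrow> nat \<Rightarrow> 'b" where
  "coord N V x j = (\<Sum>i<N. V j i *\<^sub>R x i)"

text \<open>\<open>W\<close> is the reference error, \<open>P\<close> the multiplier error. The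
  second sum is the form of the pseudo-inverse of the Laplacian at \<open>P\<close>; it starts at 1
  because \<open>lam 0 = 0\<close>, and its derivative cancels the product of \<open>W\<close> and
  \<open>P\<close> coming from the first sum. The last summand supplies the missing decay in
  \<open>P\<close>: in the derivative of \<open>W + P\<close> the Laplacian drops out.\<close>

definition energy ::
  "real \<Rightarrow> nat \<Rightarrow> (nat \<Rightarrow> real) \<Rightarrow> (nat \<Rightarrow> nat \<Rightarrow> real) \<Rightarrow> (nat \<Rightarrow> 'b::real_inner) \<Rightarrow> (nat \<Rightarrow> 'b) \<Rightarrow> real" where
  "energy c N lam V W P =
     c / 2 * ((\<Sum>r<N. inner (W r) (W r)) + (\<Sum>j=1..<N. inner (coord N V P j) (coord N V P j) / lam j))
       + (\<Sum>r<N. inner (W r + P r) (W r + P r)) / 2"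

definition energy_rate ::
  "real \<Rightarrow> nat \<Rightarrow> (nat \<Rightarrow> real) \<Rightarrow> (nat \<Rightarrow> nat \<Rightarrow> real) \<Rightarrow> (nat \<Rightarrow> 'b::real_inner) \<Rightarrow> (nat \<Rightarrow> 'b)
     \<Rightarrow> (nat \<Rightarrow> 'b) \<Rightarrow> (nat \<Rightarrow> 'b) \<Rightarrow> real" where
  "energy_rate c N lam V W P W' P' =
     c * ((\<Sum>r<N. inner (W r) (W' r)) + (\<Sum>j=1..<N. inner (coord N V P j) (coord N V P' j) / lam j))
       + (\<Sum>r<N. inner (W r + P r) (W' r + P' r))"

lemma inner_young:
  fixes x y :: "'b::real_inner"
  shows "- inner x y \<le> inner x x + inner y y / 4"
proof -
  have "0 \<le> inner (x + (1/2) *\<^sub>R y) (x + (1/2) *\<^sub>R y)" by (rule inner_ge_zero)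
  also have "\<dots> = inner x x + inner x y + inner y y / 4"
    by (simp add: inner_add_left inner_add_right inner_commute[of y x] algebra_simps)
  finally show ?thesis by simp
qed

lemma sum_from_1:
  fixes g :: "nat \<Rightarrow> 'b::comm_monoid_add"
  assumes "0 < N" "g 0 = 0"
  shows "(\<Sum>j<N. g j) = (\<Sum>j=1..<N. g j)"
proof -
  have "{..<N} = insert 0 {1..<N}" using assms by auto
  then show ?thesis using assms(2) by simp
qed

text \<open>The estimates at a fixed time need only the eigenbasis, not the graph. Together
  \<open>lam0\<close>, \<open>lam1\<close> and \<open>V0\<close> say that the kernel of
  \<open>L\<close> consists of the consensus vectors.\<close>

locale saddle_dynamics =
  fixes N :: nat and L :: "nat \<Rightarrow> nat \<Rightarrow> real" and lam :: "nat \<Rightarrow> real" and V :: "nat \<Rightarrow> nat \<Rightarrow> real"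
    and \<rho> \<kappa> :: real
  assumes N2: "2 \<le> N"
    and L_sym: "\<And>i j. i < N \<Longrightarrow> j < N \<Longrightarrow> L i j = L j i"
    and basis: "ordered_eigenbasis N L lam V"
    and lam0: "lam 0 = 0" and lam1: "0 < lam 1"
    and V0: "\<And>i. i < N \<Longrightarrow> V 0 i = V 0 0"
    and const_pos: "0 < \<rho>" "0 < \<kappa>"
begin

abbreviation c where "c \<equiv> c1 (lam 1) \<rho> \<kappa>"

lemmas eigen = ordered_eigenbasisD[OF basis]

lemma parseval_coord:
  fixes w u :: "nat \<Rightarrow> 'b::real_inner"
  shows "(\<Sum>j<N. inner (coord N V w j) (coord N V u j)) = (\<Sum>i<N. inner (w i) (u i))"
  unfolding coord_def by (rule parseval) (rule eigen(2))

lemma lam_ge: "1 \<le> j \<Longrightarrow> j < N \<Longrightarrow> lam 1 \<le> lam j"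
  by (rule eigen(1))

lemma lam_nonneg: "j < N \<Longrightarrow> 0 \<le> lam j"
  using lam_ge[of j] lam1 lam0 by (cases "j = 0") auto

lemma lam_le: "j < N \<Longrightarrow> lam j \<le> lam (N - 1)"
  using eigen(1)[of j "N - 1"] N2 by auto

lemma c_bounds: "1 / lam 1 \<le> c" "(1 + 2 * \<kappa>\<^sup>2) / 2 \<le> c * \<rho>" "0 < c"
proof -
  show "1 / lam 1 \<le> c" by (simp add: c1_def)
  have "(1 + 2 * \<kappa>\<^sup>2) / (2 * \<rho>) \<le> c" by (simp add: c1_def)
  then show "(1 + 2 * \<kappa>\<^sup>2) / 2 \<le> c * \<rho>" using const_pos by (simp add: field_simps)
  have "0 < 1 / lam 1" using lam1 by simp
  also have "\<dots> \<le> c" by (simp add: c1_def)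
  finally show "0 < c" .
qed

lemma coord_L:
  fixes W :: "nat \<Rightarrow> 'b::real_vector"
  assumes "j < N"
  shows "coord N V (\<lambda>r. \<Sum>k<N. L r k *\<^sub>R W k) j = lam j *\<^sub>R coord N V W j"
  unfolding coord_def by (rule eigenvector_coordinates) (use L_sym eigen(3) assms in auto)

lemma coord_0:
  fixes P :: "nat \<Rightarrow> 'b::real_vector"
  assumes "(\<Sum>r<N. P r) = 0"
  shows "coord N V P 0 = 0"
proof -
  have "coord N V P 0 = (\<Sum>i<N. V 0 0 *\<^sub>R P i)"
    unfolding coord_def by (intro sum.cong refl, subst V0) auto
  then show ?thesis using assms by (simp flip: scaleR_sum_right)
qed

lemma sum_L_coord:
  fixes W :: "nat \<Rightarrow> 'b::real_inner"
  shows "(\<Sum>r<N. inner (W r) (\<Sum>k<N. L r k *\<^sub>R W k)) =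
    (\<Sum>j=1..<N. lam j * inner (coord N V W j) (coord N V W j))"
proof -
  have "(\<Sum>r<N. inner (W r) (\<Sum>k<N. L r k *\<^sub>R W k)) =
      (\<Sum>j<N. inner (coord N V W j) (coord N V (\<lambda>r. \<Sum>k<N. L r k *\<^sub>R W k) j))"
    by (rule parseval_coord[symmetric])
  also have "\<dots> = (\<Sum>j<N. lam j * inner (coord N V W j) (coord N V W j))"
    by (intro sum.cong refl) (simp add: coord_L)
  also have "\<dots> = (\<Sum>j=1..<N. lam j * inner (coord N V W j) (coord N V W j))"
    by (rule sum_from_1) (use N2 lam0 in auto)
  finally show ?thesis .
qed

text \<open>\<open>W\<close> stands for \<open>w - z\<close>, \<open>P\<close> for \<open>p\<close>
  plus the gradient at \<open>z\<close>, and \<open>G\<close> for the increment of the gradient, all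
  at one time. The zero sum of \<open>P\<close> removes its component in the kernel of
  \<open>L\<close>, where the Laplacian provides no control.\<close>

context
  fixes W P G :: "nat \<Rightarrow> 'b::real_inner"
  assumes P_sum: "(\<Sum>r<N. P r) = 0"
    and strong: "\<And>r. r < N \<Longrightarrow> \<rho> * inner (W r) (W r) \<le> inner (W r) (G r)"
    and lip: "\<And>r. r < N \<Longrightarrow> inner (G r) (G r) \<le> \<kappa>\<^sup>2 * inner (W r) (W r)"
begin

abbreviation "w2 \<equiv> \<Sum>r<N. inner (W r) (W r)"
abbreviation "p2 \<equiv> \<Sum>r<N. inner (P r) (P r)"
abbreviation "LW \<equiv> \<lambda>r. \<Sum>k<N. L r k *\<^sub>R W k"
abbreviation "wLw \<equiv> \<Sum>r<N. inner (W r) (LW r)"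
abbreviation "rhs \<equiv> \<lambda>r. LW r + G r + P r"

lemma w2_p2_nonneg: "0 \<le> w2" "0 \<le> p2"
  by (auto intro!: sum_nonneg)

text \<open>Only coordinates \<open>j \<ge> 1\<close> contribute, because the zeroth coordinate of
  \<open>P\<close> vanishes. For these \<open>c * lam j \<ge> 1\<close>, which is the purpose of the
  entry \<open>1 / l2\<close> in \<open>c1\<close>.\<close>

lemma cross_bound: "- (\<Sum>r<N. inner (W r) (P r)) \<le> c * wLw + p2 / 4"
proof -
  let ?w = "coord N V W" and ?p = "coord N V P"
  have P0: "?p 0 = 0" by (rule coord_0[OF P_sum])
  have N0: "0 < N" using N2 by simp
  have 1: "(\<Sum>r<N. inner (W r) (P r)) = (\<Sum>j=1..<N. inner (?w j) (?p j))"
    by (subst parseval_coord[symmetric], rule sum_from_1) (use N0 P0 in auto)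
  have 2: "p2 = (\<Sum>j=1..<N. inner (?p j) (?p j))"
    by (subst parseval_coord[symmetric], rule sum_from_1) (use N0 P0 in auto)
  have "- (\<Sum>j=1..<N. inner (?w j) (?p j)) \<le>
      (\<Sum>j=1..<N. inner (?w j) (?w j) + inner (?p j) (?p j) / 4)"
    unfolding sum_negf[symmetric] by (intro sum_mono inner_young)
  also have "\<dots> \<le> (\<Sum>j=1..<N. c * (lam j * inner (?w j) (?w j)) + inner (?p j) (?p j) / 4)"
  proof (intro sum_mono add_right_mono)
    fix j assume "j \<in> {1..<N}"
    then have "1 / lam 1 * lam 1 \<le> c * lam j"
      using c_bounds lam1 lam_ge[of j] by (intro mult_mono) auto
    then have "1 * inner (?w j) (?w j) \<le> c * lam j * inner (?w j) (?w j)"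
      using lam1 by (intro mult_right_mono) auto
    then show "inner (?w j) (?w j) \<le> c * (lam j * inner (?w j) (?w j))" by (simp add: mult.assoc)
  qed
  also have "\<dots> = c * wLw + p2 / 4"
    by (simp add: sum_L_coord 2 sum.distrib sum_distrib_left sum_divide_distrib)
  finally show ?thesis using 1 by simp
qed

text \<open>The weights \<open>1 / lam j\<close> are at most \<open>max 1 (1 / lam 1)\<close>, and
  half the square of \<open>W + P\<close> accounts for the summand 1 in \<open>c3\<close>.\<close>

lemma energy_le: "energy c N lam V W P \<le> c3 (lam 1) \<rho> \<kappa> * (w2 + p2)"
proof -
  let ?p = "coord N V P" and ?M = "max 1 (1 / lam 1)"
  have P0: "?p 0 = 0" by (rule coord_0[OF P_sum])
  have "(\<Sum>j=1..<N. inner (?p j) (?p j) / lam j) \<le> (\<Sum>j=1..<N. ?M * inner (?p j) (?p j))"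
  proof (intro sum_mono)
    fix j assume j: "j \<in> {1..<N}"
    then have "1 / lam j \<le> 1 / lam 1" using lam1 lam_ge[of j] by (intro divide_left_mono) auto
    then have "1 / lam j \<le> ?M" by simp
    then have "1 / lam j * inner (?p j) (?p j) \<le> ?M * inner (?p j) (?p j)"
      by (intro mult_right_mono) auto
    then show "inner (?p j) (?p j) / lam j \<le> ?M * inner (?p j) (?p j)" by simp
  qed
  also have "\<dots> = ?M * (\<Sum>j<N. inner (?p j) (?p j))"
    by (subst sum_from_1) (use N2 P0 in \<open>auto simp: sum_distrib_left\<close>)
  also have "\<dots> = ?M * p2" by (simp add: parseval_coord)
  finally have 1: "(\<Sum>j=1..<N. inner (?p j) (?p j) / lam j) \<le> ?M * p2" .
  have "(\<Sum>r<N. inner (W r + P r) (W r + P r)) \<le> (\<Sum>r<N. 2 * inner (W r) (W r) + 2 * inner (P r) (P r))"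
  proof (intro sum_mono)
    fix r
    have "0 \<le> inner (W r - P r) (W r - P r)" by (rule inner_ge_zero)
    then show "inner (W r + P r) (W r + P r) \<le> 2 * inner (W r) (W r) + 2 * inner (P r) (P r)"
      by (simp add: inner_add_left inner_add_right inner_diff_left inner_diff_right inner_commute)
  qed
  then have 2: "(\<Sum>r<N. inner (W r + P r) (W r + P r)) / 2 \<le> w2 + p2"
    by (simp add: sum.distrib flip: sum_distrib_left)
  have M: "1 * w2 \<le> ?M * w2" using w2_p2_nonneg by (intro mult_right_mono) auto
  have "energy c N lam V W P \<le> c / 2 * (?M * w2 + ?M * p2) + (w2 + p2)"
    unfolding energy_def using 1 2 M c_bounds(3) by (intro add_mono mult_left_mono) auto
  also have "\<dots> = (c * ?M / 2 + 1) * (w2 + p2)" by (simp add: algebra_simps)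
  also have "\<dots> \<le> c3 (lam 1) \<rho> \<kappa> * (w2 + p2)"
  proof (rule mult_right_mono)
    have "0 \<le> c * ?M" using c_bounds(3) by (intro mult_nonneg_nonneg) auto
    then show "c * ?M / 2 + 1 \<le> c3 (lam 1) \<rho> \<kappa>" unfolding c3_def by simp
  qed (use w2_p2_nonneg in auto)
  finally show ?thesis .
qed

lemma energy_ge: "c / 2 * w2 \<le> energy c N lam V W P" "p2 \<le> 4 * energy c N lam V W P + 2 * w2"
proof -
  have a: "0 \<le> (\<Sum>j=1..<N. inner (coord N V P j) (coord N V P j) / lam j)"
    by (intro sum_nonneg divide_nonneg_nonneg) (auto simp: lam_nonneg)
  have b: "0 \<le> (\<Sum>r<N. inner (W r + P r) (W r + P r))" by (intro sum_nonneg) auto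
  show "c / 2 * w2 \<le> energy c N lam V W P"
    unfolding energy_def using a b c_bounds(3) by (simp add: algebra_simps)
  have "p2 \<le> (\<Sum>r<N. 2 * inner (W r + P r) (W r + P r) + 2 * inner (W r) (W r))"
  proof (intro sum_mono)
    fix r
    have "0 \<le> inner (2 *\<^sub>R W r + P r) (2 *\<^sub>R W r + P r)" by (rule inner_ge_zero)
    then show "inner (P r) (P r) \<le> 2 * inner (W r + P r) (W r + P r) + 2 * inner (W r) (W r)"
      by (simp add: inner_add_left inner_add_right inner_commute)
  qed
  also have "\<dots> = 4 * ((\<Sum>r<N. inner (W r + P r) (W r + P r)) / 2) + 2 * w2"
    by (simp add: sum.distrib flip: sum_distrib_left)
  also have "\<dots> \<le> 4 * energy c N lam V W P + 2 * w2"
    unfolding energy_def using a w2_p2_nonneg c_bounds(3) by simp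
  finally show "p2 \<le> 4 * energy c N lam V W P + 2 * w2" .
qed

lemma energy_nonneg: "0 \<le> energy c N lam V W P"
  using energy_ge(1) w2_p2_nonneg c_bounds(3)
  by (meson divide_nonneg_nonneg less_imp_le mult_nonneg_nonneg order_trans zero_le_numeral)

text \<open>The right-hand side is quadratic decay \<open>- (w2 + p2) / 2\<close> converted by
  \<open>energy_le\<close>: dividing by \<open>c3\<close> gives the rate
  \<open>1 / (2 c3) = 2 c_star\<close>.\<close>

lemma energy_rate_le:
  "energy_rate c N lam V W P (\<lambda>r. - rhs r) LW \<le> - 2 * c_star (lam 1) \<rho> \<kappa> * energy c N lam V W P"
proof -
  let ?w = "coord N V W" and ?p = "coord N V P"
  have P0: "?p 0 = 0" by (rule coord_0[OF P_sum])
  have "(\<Sum>j=1..<N. inner (?p j) (coord N V LW j) / lam j) = (\<Sum>j=1..<N. inner (?p j) (?w j))"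
  proof (intro sum.cong refl)
    fix j assume "j \<in> {1..<N}"
    then show "inner (?p j) (coord N V LW j) / lam j = inner (?p j) (?w j)"
      using coord_L[of j W] lam_ge[of j] lam1 by auto
  qed
  also have "\<dots> = (\<Sum>j<N. inner (?p j) (?w j))"
    by (rule sum_from_1[symmetric]) (use N2 P0 in auto)
  also have "\<dots> = (\<Sum>r<N. inner (P r) (W r))" by (rule parseval_coord)
  finally have 1: "(\<Sum>j=1..<N. inner (?p j) (coord N V LW j) / lam j) = (\<Sum>r<N. inner (P r) (W r))" .
  have 2: "(\<Sum>r<N. inner (W r) (- rhs r)) =
      - wLw - (\<Sum>r<N. inner (W r) (G r)) - (\<Sum>r<N. inner (P r) (W r))"
    by (simp add: inner_add_right inner_diff_right sum.distrib sum_subtractf sum_negf inner_commute[of "P _"])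
  have 3: "(\<Sum>r<N. inner (W r + P r) (- rhs r + LW r)) =
      - (\<Sum>r<N. inner (W r) (G r)) - (\<Sum>r<N. inner (W r) (P r)) + (\<Sum>r<N. - inner (G r) (P r)) - p2"
  proof -
    have "(\<Sum>r<N. inner (W r + P r) (- rhs r + LW r)) =
      (\<Sum>r<N. - inner (W r) (G r) - inner (W r) (P r) + - inner (G r) (P r) - inner (P r) (P r))"
      by (intro sum.cong refl) (simp add: inner_add_left inner_add_right inner_diff_right
          inner_commute[of "P _" "G _"] inner_commute[of "P _" "W _"])
    then show ?thesis by (simp only: sum.distrib sum_subtractf sum_negf)
  qed
  have 4: "(\<Sum>r<N. - inner (G r) (P r)) \<le> \<kappa>\<^sup>2 * w2 + p2 / 4"
  proof -
    have "(\<Sum>r<N. - inner (G r) (P r)) \<le> (\<Sum>r<N. \<kappa>\<^sup>2 * inner (W r) (W r) + inner (P r) (P r) / 4)"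
    proof (intro sum_mono)
      fix r assume "r \<in> {..<N}"
      then show "- inner (G r) (P r) \<le> \<kappa>\<^sup>2 * inner (W r) (W r) + inner (P r) (P r) / 4"
        using inner_young[of "G r" "P r"] lip[of r] by simp
    qed
    then show ?thesis by (simp add: sum.distrib sum_distrib_left sum_divide_distrib)
  qed
  have 5: "\<rho> * w2 \<le> (\<Sum>r<N. inner (W r) (G r))"
    unfolding sum_distrib_left by (intro sum_mono) (use strong in auto)
  have 6: "0 \<le> (\<Sum>r<N. inner (W r) (G r))"
    using 5 w2_p2_nonneg(1) const_pos by (meson less_imp_le mult_nonneg_nonneg order_trans)
  have 7: "c * (\<rho> * w2) \<le> c * (\<Sum>r<N. inner (W r) (G r))"
    using 5 c_bounds(3) by (intro mult_left_mono) auto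
  have 8: "(1 + 2 * \<kappa>\<^sup>2) / 2 * w2 \<le> c * \<rho> * w2"
    using c_bounds(2) w2_p2_nonneg by (intro mult_right_mono) auto
  have "energy_rate c N lam V W P (\<lambda>r. - rhs r) LW =
      - (c * wLw) - c * (\<Sum>r<N. inner (W r) (G r)) - (\<Sum>r<N. inner (W r) (G r))
       - (\<Sum>r<N. inner (W r) (P r)) + (\<Sum>r<N. - inner (G r) (P r)) - p2"
    unfolding energy_rate_def 1 2 3 by (simp add: algebra_simps)
  \<comment> \<open>The \<open>wLw\<close> terms cancel through \<open>cross_bound\<close>. The
    balance for \<open>p2\<close> is \<open>- 1 + 1/4 + 1/4\<close>. For \<open>w2\<close> it is
    \<open>\<kappa>^2 - c \<rho>\<close>, at most \<open>- 1/2\<close> by the second entry of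
    \<open>c1\<close>.\<close>
  also have "\<dots> \<le> - (w2 + p2) / 2"
    using cross_bound 4 6 7 8 by (simp add: algebra_simps add_divide_distrib)
  finally have 9: "energy_rate c N lam V W P (\<lambda>r. - rhs r) LW \<le> - (w2 + p2) / 2" .
  have c3: "0 < c3 (lam 1) \<rho> \<kappa>"
    unfolding c3_def using c_bounds(3) by (intro add_nonneg_pos mult_nonneg_nonneg) auto
  have "energy c N lam V W P / c3 (lam 1) \<rho> \<kappa> \<le> w2 + p2"
    using energy_le c3 by (simp add: divide_le_eq mult.commute)
  with 9 show ?thesis by (simp add: c_star_def)
qed

text \<open>Up to the factor \<open>\<alpha>(\<mu>)\<close> this controls the velocity of the
  reference, the only quantity through which the generator disturbs the sliding variable. The number
  \<open>lam (N - 1)\<close> serves as operator norm of \<open>L\<close>.\<close>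

lemma rhs_bound:
  assumes r: "r < N"
  shows "inner (rhs r) (rhs r) \<le> (3 * ((lam (N - 1))\<^sup>2 + \<kappa>\<^sup>2 + 2) * (2 / c) + 12) * energy c N lam V W P"
proof -
  have le1: "inner (X r) (X r) \<le> (\<Sum>r<N. inner (X r) (X r))" for X :: "nat \<Rightarrow> 'b"
    by (rule member_le_sum) (use r in auto)
  have 3: "inner (x + y + z) (x + y + z) \<le> 3 * (inner x x + inner y y + inner z z)" for x y z :: 'b
  proof -
    have "0 \<le> inner (x - y) (x - y) + inner (y - z) (y - z) + inner (x - z) (x - z)"
      by (intro add_nonneg_nonneg inner_ge_zero)
    then show ?thesis
      by (simp add: inner_add_left inner_add_right inner_diff_left inner_diff_right inner_commute algebra_simps)
  qed
  have "(\<Sum>r<N. inner (LW r) (LW r)) = (\<Sum>j<N. (lam j)\<^sup>2 * inner (coord N V W j) (coord N V W j))"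
    by (subst parseval_coord[symmetric]) (auto simp: coord_L power2_eq_square intro!: sum.cong)
  also have "\<dots> \<le> (\<Sum>j<N. (lam (N - 1))\<^sup>2 * inner (coord N V W j) (coord N V W j))"
    by (intro sum_mono mult_right_mono power_mono) (auto simp: lam_le[simplified] lam_nonneg)
  also have "\<dots> = (lam (N - 1))\<^sup>2 * w2" by (simp add: parseval_coord flip: sum_distrib_left)
  finally have "inner (LW r) (LW r) \<le> (lam (N - 1))\<^sup>2 * w2" using le1[of LW] by linarith
  moreover have "inner (G r) (G r) \<le> \<kappa>\<^sup>2 * w2"
    using lip[OF r] mult_left_mono[OF le1[of W], of "\<kappa>\<^sup>2"] by simp
  moreover have "inner (P r) (P r) \<le> 4 * energy c N lam V W P + 2 * w2"
    using le1[of P] energy_ge(2) by linarith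
  ultimately have "inner (rhs r) (rhs r) \<le> 3 * ((lam (N - 1))\<^sup>2 + \<kappa>\<^sup>2 + 2) * w2 + 12 * energy c N lam V W P"
    using 3[of "LW r" "G r" "P r"] by (simp add: algebra_simps)
  also have "3 * ((lam (N - 1))\<^sup>2 + \<kappa>\<^sup>2 + 2) * w2 \<le>
      3 * ((lam (N - 1))\<^sup>2 + \<kappa>\<^sup>2 + 2) * (2 / c * energy c N lam V W P)"
    using energy_ge(1) c_bounds(3) by (intro mult_left_mono) (auto simp: field_simps)
  finally show ?thesis by (simp add: algebra_simps add_divide_distrib)
qed

end

end

section \<open>Gradients and first-order optimality\<close>

lemma gradient_derivative:
  fixes f :: "'b::euclidean_space \<Rightarrow> real"
  assumes "f differentiable (at x)"
  shows "(f has_derivative (\<lambda>h. inner h (gradient f x))) (at x)"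
proof -
  obtain f' where f': "(f has_derivative f') (at x)"
    using assms by (auto simp: differentiable_def)
  then have lin: "linear f'" by (rule has_derivative_linear)
  \<comment> \<open>Riesz vector of the derivative, assembled from its values on the basis. It shows
    existence; uniqueness, needed for the definite description \<open>gradient\<close>, is inherited
    from the derivative.\<close>
  define D where "D = (\<Sum>b\<in>Basis. f' b *\<^sub>R b)"
  have "f' h = inner h D" for h
  proof -
    have "f' h = f' (\<Sum>b\<in>Basis. inner h b *\<^sub>R b)" by (simp add: euclidean_representation)
    also have "\<dots> = (\<Sum>b\<in>Basis. inner h b * f' b)"
      using lin by (simp add: linear_sum linear_cmul)
    also have "\<dots> = inner h D" by (simp add: D_def inner_sum_right mult.commute)
    finally show ?thesis .
  qed
  then have "f' = (\<lambda>h. inner h D)" by (rule ext)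
  with f' have gd: "GDERIV f x :> D" by (simp add: gderiv_def)
  have "gradient f x = D"
    unfolding gradient_def
  proof (rule the_equality)
    show "GDERIV f x :> D" by (rule gd)
  next
    fix E assume "GDERIV f x :> E"
    then have "(\<lambda>h. inner h E) = (\<lambda>h. inner h D)"
      using gd unfolding gderiv_def by (rule has_derivative_unique)
    then have "inner h (E - D) = 0" for h by (simp add: inner_diff_right fun_eq_iff)
    from this[of "E - D"] show "E = D" by simp
  qed
  then show ?thesis using gd by (simp add: gderiv_def)
qed

text \<open>Consensus profiles are copies of a single point, so \<open>z\<close> is a global
  minimiser of the sum of the \<open>f i\<close>, and its derivative vanishes there.\<close>

lemma optimum_sum_gradient:
  fixes f :: "nat \<Rightarrow> real^'n \<Rightarrow> real"
  assumes diff: "\<And>i. i \<in> {1..N} \<Longrightarrow> f i differentiable_on UNIV"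
    and opt: "replicate_profile N z \<in> optimum_set N f"
  shows "(\<Sum>i=1..N. gradient (f i) z) = 0"
proof -
  let ?g = "\<Sum>i=1..N. gradient (f i) z"
  have "((\<lambda>\<xi>. \<Sum>i=1..N. f i \<xi>) has_derivative (\<lambda>h. \<Sum>i=1..N. inner h (gradient (f i) z))) (at z)"
    by (intro has_derivative_sum gradient_derivative) (use diff in \<open>auto simp: differentiable_on_def\<close>)
  moreover have "\<forall>\<xi>\<in>UNIV. (\<Sum>i=1..N. f i z) \<le> (\<Sum>i=1..N. f i \<xi>)"
  proof
    fix \<xi> :: "real^'n"
    have "replicate_profile N \<xi> \<in> consensus_profiles N"
      by (auto simp: consensus_profiles_def stacked_def replicate_profile_def)
    then have "total_cost N f (replicate_profile N z) \<le> total_cost N f (replicate_profile N \<xi>)"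
      using opt by (simp add: optimum_set_def)
    then show "(\<Sum>i=1..N. f i z) \<le> (\<Sum>i=1..N. f i \<xi>)"
      by (simp add: total_cost_def replicate_profile_def)
  qed
  ultimately have "(\<lambda>h. \<Sum>i=1..N. inner h (gradient (f i) z)) = (\<lambda>h. 0)"
    by (intro differential_zero_maxmin[of z UNIV "\<lambda>\<xi>. \<Sum>i=1..N. f i \<xi>"]) auto
  then have "inner ?g ?g = 0" by (simp add: inner_sum_right fun_eq_iff)
  then show ?thesis by simp
qed

section \<open>The energy along trajectories of the generator\<close>

lemma has_real_derivative_inner_self:
  fixes X :: "real \<Rightarrow> 'b::real_inner"
  assumes "(X has_vector_derivative X') (at t within I)"
  shows "((\<lambda>t. inner (X t) (X t)) has_real_derivative 2 * inner (X t) X') (at t within I)"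
  using bounded_bilinear.has_vector_derivative[OF bounded_bilinear_inner assms assms]
  by (simp add: has_real_derivative_iff_has_vector_derivative inner_commute[of X'])

lemma has_vector_derivative_scaleR_const:
  fixes X :: "real \<Rightarrow> 'b::real_normed_vector"
  assumes "(X has_vector_derivative X') (at t within I)"
  shows "((\<lambda>t. c *\<^sub>R X t) has_vector_derivative c *\<^sub>R X') (at t within I)"
  using bounded_linear.has_vector_derivative[OF bounded_linear_scaleR_right assms] .

lemma energy_has_derivative:
  fixes W P :: "real \<Rightarrow> nat \<Rightarrow> 'b::real_inner"
  assumes W: "\<And>r. r < N \<Longrightarrow> ((\<lambda>t. W t r) has_vector_derivative W' r) (at t within I)"
    and P: "\<And>r. r < N \<Longrightarrow> ((\<lambda>t. P t r) has_vector_derivative P' r) (at t within I)"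
  shows "((\<lambda>t. energy c N lam V (W t) (P t)) has_real_derivative
    energy_rate c N lam V (W t) (P t) W' P') (at t within I)"
proof -
  have co: "((\<lambda>t. coord N V (P t) j) has_vector_derivative coord N V P' j) (at t within I)" for j
    unfolding coord_def by (intro has_vector_derivative_sum has_vector_derivative_scaleR_const P) auto
  have WP: "((\<lambda>t. W t r + P t r) has_vector_derivative W' r + P' r) (at t within I)" if "r < N" for r
    by (intro has_vector_derivative_add W P that)
  have "((\<lambda>t. energy c N lam V (W t) (P t)) has_real_derivative
     c / 2 * ((\<Sum>r<N. 2 * inner (W t r) (W' r)) +
        (\<Sum>j=1..<N. 2 * inner (coord N V (P t) j) (coord N V P' j) / lam j))
       + (\<Sum>r<N. 2 * inner (W t r + P t r) (W' r + P' r)) / 2) (at t within I)"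
    unfolding energy_def
    by (intro DERIV_add DERIV_cmult DERIV_cdivide DERIV_sum
        has_real_derivative_inner_self[where X="\<lambda>t. W t _"] W
        has_real_derivative_inner_self[where X="\<lambda>t. coord N V (P t) _"] co
        has_real_derivative_inner_self[where X="\<lambda>t. W t _ + P t _"] WP) auto
  then show ?thesis
  proof (rule DERIV_cong)
    let ?A = "\<lambda>r. inner (W t r) (W' r)" and ?U = "\<lambda>r. inner (W t r + P t r) (W' r + P' r)"
    let ?B = "\<lambda>j. inner (coord N V (P t) j) (coord N V P' j) / lam j"
    define A B U where "A = sum ?A {..<N}" and "B = sum ?B {1..<N}" and "U = sum ?U {..<N}"
    have "(\<Sum>r<N. 2 * ?A r) = 2 * A" "(\<Sum>r<N. 2 * ?U r) = 2 * U"
      "(\<Sum>j=1..<N. 2 * inner (coord N V (P t) j) (coord N V P' j) / lam j) = 2 * B"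
      by (simp_all only: A_def B_def U_def sum_distrib_left times_divide_eq_right)
    then show "c / 2 * ((\<Sum>r<N. 2 * ?A r) +
        (\<Sum>j=1..<N. 2 * inner (coord N V (P t) j) (coord N V P' j) / lam j)) + (\<Sum>r<N. 2 * ?U r) / 2 =
        energy_rate c N lam V (W t) (P t) W' P'"
      unfolding energy_rate_def A_def[symmetric] B_def[symmetric] U_def[symmetric] by (simp add: field_simps)
  qed
qed

text \<open>The rate is linear in the velocities, so the gain common to both generator equations
  factors out and acts as a change of time scale.\<close>

lemma energy_rate_scale:
  "energy_rate c N lam V W P (\<lambda>r. s *\<^sub>R W' r) (\<lambda>r. s *\<^sub>R P' r) = s * energy_rate c N lam V W P W' P'"
proof -
  have "coord N V (\<lambda>r. s *\<^sub>R P' r) j = s *\<^sub>R coord N V P' j" for j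
    by (simp add: coord_def scaleR_sum_right mult.commute)
  then show ?thesis
    unfolding energy_rate_def
    by (simp add: algebra_simps sum_distrib_left flip: scaleR_add_right)
qed

lemma sum_neighbours_antisymmetric:
  fixes w :: "nat \<Rightarrow> 'b::real_vector"
  assumes G: "connected_weighted_graph N a"
  shows "(\<Sum>r<N. \<Sum>j\<in>neighbours N a (Suc r). a (Suc r) j *\<^sub>R (w (Suc r) - w j)) = 0"
proof -
  let ?s = "\<Sum>r<N. \<Sum>c<N. a (Suc r) (Suc c) *\<^sub>R (w (Suc r) - w (Suc c))"
  have "?s = (\<Sum>c<N. \<Sum>r<N. a (Suc r) (Suc c) *\<^sub>R (w (Suc r) - w (Suc c)))" by (rule sum.swap)
  also have "\<dots> = (\<Sum>r<N. \<Sum>c<N. - (a (Suc r) (Suc c) *\<^sub>R (w (Suc r) - w (Suc c))))"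
    by (intro sum.cong refl) (simp add: symmetric_graph_index(1)[OF G] scaleR_diff_right)
  also have "\<dots> = - ?s" by (simp add: sum_negf)
  finally have "?s + ?s = 0" by (simp only: eq_neg_iff_add_eq_0)
  then have "2 *\<^sub>R ?s = 0" by (simp only: scaleR_2)
  then show ?thesis by (simp add: neighbours_sum[OF G])
qed

lemma generator_energy:
  fixes f :: "nat \<Rightarrow> real^'n \<Rightarrow> real" and w p :: "nat \<Rightarrow> real \<Rightarrow> real^'n"
  assumes N: "2 \<le> N"
    and graph: "connected_weighted_graph N a"
    and const_pos: "0 < \<rho>" "0 < \<kappa>"
    and f_strong: "\<And>i \<xi> \<eta>. i \<in> {1..N} \<Longrightarrow>
      inner (gradient (f i) \<xi> - gradient (f i) \<eta>) (\<xi> - \<eta>) \<ge> \<rho> * (norm (\<xi> - \<eta>))\<^sup>2"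
    and f_lip: "\<And>i \<xi> \<eta>. i \<in> {1..N} \<Longrightarrow>
      norm (gradient (f i) \<xi> - gradient (f i) \<eta>) \<le> \<kappa> * norm (\<xi> - \<eta>)"
    and opt: "(\<Sum>i=1..N. gradient (f i) z) = 0"
    and b: "t0 < b"
    and p_init: "(\<Sum>i=1..N. p i t0) = 0"
    and generator: "generator_trajectory N a f \<alpha> T t0 {t0..<b} w p"
    and nonneg: "\<And>t. t \<in> {t0..<b} \<Longrightarrow> 0 \<le> \<alpha> (\<mu> T t0 t)"
  obtains E E' w' C where
    "0 < c_star (lambda2 N a) \<rho> \<kappa>" "0 \<le> C"
    "\<And>t. t \<in> {t0..<b} \<Longrightarrow> (E has_real_derivative E' t) (at t within {t0..<b})"
    "\<And>t. t \<in> {t0..<b} \<Longrightarrow> E' t \<le> - 2 * c_star (lambda2 N a) \<rho> \<kappa> * \<alpha> (\<mu> T t0 t) * E t"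
    "\<And>t. t \<in> {t0..<b} \<Longrightarrow> 0 \<le> E t"
    "\<And>i t. i \<in> {1..N} \<Longrightarrow> t \<in> {t0..<b} \<Longrightarrow> (norm (w i t - z))\<^sup>2 \<le> C * E t"
    "\<And>i t. i \<in> {1..N} \<Longrightarrow> t \<in> {t0..<b} \<Longrightarrow> (w i has_vector_derivative w' i t) (at t within {t0..<b})"
    "\<And>i t. i \<in> {1..N} \<Longrightarrow> t \<in> {t0..<b} \<Longrightarrow> (norm (w' i t))\<^sup>2 \<le> C * (\<alpha> (\<mu> T t0 t))\<^sup>2 * E t"
proof -
  let ?I = "{t0..<b}" and ?cs = "c_star (lambda2 N a) \<rho> \<kappa>" and ?L = "\<lambda>i j. laplacian N a $$ (i, j)"
  let ?g = "\<lambda>t. \<alpha> (\<mu> T t0 t)"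
  obtain lam V where ob: "ordered_eigenbasis N ?L lam V"
    and l2: "lam 1 = lambda2 N a" and lam: "lam 0 = 0" "0 < lam 1"
    and V0: "\<forall>i<N. V 0 i = V 0 0"
    by (rule laplacian_spectrum[OF graph N], rule that, assumption, assumption, assumption, assumption, blast)
  interpret saddle_dynamics N ?L lam V \<rho> \<kappa>
    by unfold_locales (use N ob lam V0 const_pos laplacian_symmetric[OF graph] in blast)+
  define W where "W t r = w (Suc r) t - z" for t r
  \<comment> \<open>The equilibrium is \<open>w i = z\<close>,
    \<open>p i = - gradient (f i) z\<close>; \<open>W\<close> and \<open>P\<close> are the
    deviations from it.\<close>
  define P where "P t r = p (Suc r) t + gradient (f (Suc r)) z" for t r
  define G where "G t r = gradient (f (Suc r)) (w (Suc r) t) - gradient (f (Suc r)) z" for t r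
  define R where "R t r = (\<Sum>k<N. ?L r k *\<^sub>R W t k) + G t r + P t r" for t r
  have LW: "(\<Sum>k<N. ?L r k *\<^sub>R W t k) =
      (\<Sum>j\<in>neighbours N a (Suc r). a (Suc r) j *\<^sub>R (w (Suc r) t - w j t))" if "r < N" for r t
    using laplacian_apply[OF graph that, of "\<lambda>k. w k t - z"] by (simp add: W_def)
  have dw: "(w (Suc r) has_vector_derivative ?g t *\<^sub>R (- R t r)) (at t within ?I)"
    if "r < N" "t \<in> ?I" for r t
  proof -
    have "R t r = (\<Sum>j\<in>neighbours N a (Suc r). a (Suc r) j *\<^sub>R (w (Suc r) t - w j t))
        + gradient (f (Suc r)) (w (Suc r) t) + p (Suc r) t"
      unfolding R_def LW[OF that(1)] by (simp add: G_def P_def)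
    then have "(w (Suc r) has_vector_derivative - (?g t *\<^sub>R R t r)) (at t within ?I)"
      using generator that unfolding generator_trajectory_def by simp
    then show ?thesis by (simp only: scaleR_minus_right)
  qed
  have dp: "(p (Suc r) has_vector_derivative ?g t *\<^sub>R (\<Sum>k<N. ?L r k *\<^sub>R W t k)) (at t within ?I)"
    if "r < N" "t \<in> ?I" for r t
    unfolding LW[OF that(1)] using generator that unfolding generator_trajectory_def by auto
  have dW: "((\<lambda>t. W t r) has_vector_derivative ?g t *\<^sub>R (- R t r)) (at t within ?I)"
    if "r < N" "t \<in> ?I" for r t
    unfolding W_def using has_vector_derivative_diff[OF dw[OF that] has_vector_derivative_const] by simp
  have dP: "((\<lambda>t. P t r) has_vector_derivative ?g t *\<^sub>R (\<Sum>k<N. ?L r k *\<^sub>R W t k)) (at t within ?I)"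
    if "r < N" "t \<in> ?I" for r t
    unfolding P_def using has_vector_derivative_add[OF dp[OF that] has_vector_derivative_const] by simp
  have P_sum: "(\<Sum>r<N. P t r) = 0" if t: "t \<in> ?I" for t
  proof -
    \<comment> \<open>Conservation law: the coupling terms cancel in the sum over all agents. The
      conserved value is zero by the initial condition on \<open>p\<close> and by optimality of
      \<open>z\<close>.\<close>
    have "\<exists>c. \<forall>t\<in>?I. (\<Sum>r<N. P t r) = c"
    proof (rule has_derivative_zero_constant)
      fix s assume s: "s \<in> ?I"
      have "((\<lambda>t. \<Sum>r<N. P t r) has_vector_derivative (\<Sum>r<N. ?g s *\<^sub>R (\<Sum>k<N. ?L r k *\<^sub>R W s k)))
          (at s within ?I)"
        by (intro has_vector_derivative_sum dP s) auto
      also have "(\<Sum>r<N. ?g s *\<^sub>R (\<Sum>k<N. ?L r k *\<^sub>R W s k)) = 0"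
      proof -
        have "(\<Sum>r<N. \<Sum>k<N. ?L r k *\<^sub>R W s k) = 0"
          using sum_neighbours_antisymmetric[OF graph, of "\<lambda>j. w j s"] by (simp add: LW)
        then show ?thesis by (simp flip: scaleR_sum_right)
      qed
      finally show "((\<lambda>t. \<Sum>r<N. P t r) has_derivative (\<lambda>h. 0)) (at s within ?I)"
        by (simp add: has_vector_derivative_def)
    qed simp
    moreover have "(\<Sum>r<N. P t0 r) = 0"
      using p_init opt by (simp add: P_def sum.distrib sum.atLeast1_atMost_eq)
    ultimately show ?thesis using t b by (metis atLeastLessThan_iff order_refl)
  qed
  have strong: "\<rho> * inner (W t r) (W t r) \<le> inner (W t r) (G t r)" if "r < N" for t r
    using f_strong[of "Suc r" "w (Suc r) t" z] that
    by (simp add: W_def G_def power2_norm_eq_inner inner_commute)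
  have lip: "inner (G t r) (G t r) \<le> \<kappa>\<^sup>2 * inner (W t r) (W t r)" if "r < N" for t r
  proof -
    have "(norm (G t r))\<^sup>2 \<le> (\<kappa> * norm (W t r))\<^sup>2"
      using f_lip[of "Suc r" "w (Suc r) t" z] that by (intro power_mono) (auto simp: W_def G_def)
    then show ?thesis by (simp add: power2_norm_eq_inner power_mult_distrib)
  qed
  define E where "E t = energy (c1 (lam 1) \<rho> \<kappa>) N lam V (W t) (P t)" for t
  define E' where "E' t = ?g t * energy_rate (c1 (lam 1) \<rho> \<kappa>) N lam V (W t) (P t)
      (\<lambda>r. - R t r) (\<lambda>r. \<Sum>k<N. ?L r k *\<^sub>R W t k)" for t
  define C0 where "C0 = 3 * ((lam (N - 1))\<^sup>2 + \<kappa>\<^sup>2 + 2) * (2 / c1 (lam 1) \<rho> \<kappa>) + 12"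
  \<comment> \<open>One constant for both bounds: \<open>2 / c1\<close> is enough for the distance
    to \<open>z\<close> and \<open>C0\<close> for the velocity, and both are nonnegative.\<close>
  define C where "C = C0 + 2 / c1 (lam 1) \<rho> \<kappa>"
  have cpos: "0 < c1 (lam 1) \<rho> \<kappa>" by (rule c_bounds(3))
  have C0: "0 \<le> C0" unfolding C0_def using cpos by (intro add_nonneg_nonneg mult_nonneg_nonneg) auto
  have E0: "0 \<le> E t" if "t \<in> ?I" for t
    unfolding E_def by (rule energy_nonneg[OF P_sum[OF that] strong lip])
  define w' where "w' i t = ?g t *\<^sub>R (- R t (i - 1))" for i t
  show ?thesis
  proof (rule that[of C E E' w'])
    show "0 < ?cs"
      unfolding l2[symmetric] c_star_def c3_def using cpos
      by (intro divide_pos_pos mult_pos_pos add_nonneg_pos mult_nonneg_nonneg) auto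
    show "0 \<le> C" using C0 cpos by (simp add: C_def)
    show "(E has_real_derivative E' t) (at t within ?I)" if "t \<in> ?I" for t
      unfolding E_def E'_def energy_rate_scale[symmetric]
      by (rule energy_has_derivative) (use dW dP that in auto)
    show "E' t \<le> - 2 * ?cs * ?g t * E t" if t: "t \<in> ?I" for t
    proof -
      have "energy_rate (c1 (lam 1) \<rho> \<kappa>) N lam V (W t) (P t) (\<lambda>r. - R t r) (\<lambda>r. \<Sum>k<N. ?L r k *\<^sub>R W t k)
          \<le> - 2 * ?cs * E t"
        unfolding E_def R_def l2[symmetric] by (rule energy_rate_le[OF P_sum[OF t] strong lip])
      from mult_left_mono[OF this nonneg[OF t]] show ?thesis unfolding E'_def by (simp add: mult_ac)
    qed
    show "0 \<le> E t" if "t \<in> ?I" for t by (rule E0[OF that])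
    fix i t assume it: "i \<in> {1..N}" "t \<in> ?I"
    then obtain r where r: "i = Suc r" "r < N" by (cases i) auto
    have "(norm (w i t - z))\<^sup>2 = inner (W t r) (W t r)" by (simp add: r W_def power2_norm_eq_inner)
    also have "\<dots> \<le> (\<Sum>r<N. inner (W t r) (W t r))" by (rule member_le_sum) (use r in auto)
    also have "\<dots> \<le> 2 / c1 (lam 1) \<rho> \<kappa> * E t"
    proof -
      have "c1 (lam 1) \<rho> \<kappa> / 2 * (\<Sum>r<N. inner (W t r) (W t r)) \<le> E t"
        unfolding E_def by (rule energy_ge(1)[OF P_sum[OF it(2)] strong lip])
      then show ?thesis using cpos by (simp add: field_simps)
    qed
    also have "\<dots> \<le> C * E t" unfolding C_def using C0 E0[OF it(2)] by (intro mult_right_mono) auto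
    finally show "(norm (w i t - z))\<^sup>2 \<le> C * E t" .
    show "(w i has_vector_derivative w' i t) (at t within ?I)"
      using dw[OF r(2) it(2)] by (simp add: r w'_def)
    have "inner (R t r) (R t r) \<le> C0 * E t"
      unfolding R_def C0_def E_def by (rule rhs_bound[OF P_sum[OF it(2)] strong lip r(2)])
    also have "\<dots> \<le> C * E t" unfolding C_def using cpos E0[OF it(2)] by (intro mult_right_mono) auto
    finally have "(?g t)\<^sup>2 * inner (R t r) (R t r) \<le> (?g t)\<^sup>2 * (C * E t)" by (intro mult_left_mono) auto
    then show "(norm (w' i t))\<^sup>2 \<le> C * (?g t)\<^sup>2 * E t"
      by (simp add: w'_def r power_mult_distrib power2_norm_eq_inner mult_ac)
  qed
qed

section \<open>Time-varying gains and the sliding variable\<close>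

lemma mu_ge:
  assumes "0 < T" "t0 \<le> t" "t < T + t0"
  shows "1 / T \<le> \<mu> T t0 t" "0 < \<mu> T t0 t"
  using assms unfolding \<mu>_def by (auto intro!: divide_left_mono)

lemma mu_has_derivative:
  assumes "t < T + t0"
  shows "(\<mu> T t0 has_real_derivative (\<mu> T t0 t)\<^sup>2) (at t within S)"
  unfolding \<mu>_def using assms
  by (auto intro!: derivative_eq_intros simp: power2_eq_square divide_simps)

lemma filterlim_mu: "filterlim (\<mu> T t0) at_top (at_left (T + t0))"
proof -
  have "((\<lambda>t. T + t0 - t) \<longlongrightarrow> T + t0 - (T + t0)) (at_left (T + t0))"
    by (intro tendsto_intros)
  moreover have "eventually (\<lambda>t. T + t0 - t > 0) (at_left (T + t0))"
    by (auto simp: eventually_at_left_field intro!: exI[of _ "T + t0 - 1"])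
  ultimately have "filterlim (\<lambda>t. T + t0 - t) (at_right 0) (at_left (T + t0))"
    by (intro tendsto_imp_filterlim_at_right) simp_all
  then have "filterlim (\<lambda>t. inverse (T + t0 - t)) at_top (at_left (T + t0))"
    by (rule filterlim_compose[OF filterlim_inverse_at_top_right])
  then show ?thesis by (simp add: \<mu>_def[abs_def] inverse_eq_divide)
qed

section \<open>Gains of class K-infinity along the time scale\<close>

lemma class_K_inf_pos: "class_K_inf \<alpha> \<Longrightarrow> 0 < s \<Longrightarrow> 0 < \<alpha> s"
  unfolding class_K_inf_def by (metis atLeast_iff less_imp_le order_refl strict_mono_onD)

lemma class_K_inf_nonneg: "class_K_inf \<alpha> \<Longrightarrow> 0 \<le> s \<Longrightarrow> 0 \<le> \<alpha> s"
  using class_K_inf_pos[of \<alpha> s] by (cases "s = 0") (auto simp: class_K_inf_def)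

lemma class_K_inf_mono: "class_K_inf \<alpha> \<Longrightarrow> 0 \<le> s \<Longrightarrow> s \<le> r \<Longrightarrow> \<alpha> s \<le> \<alpha> r"
  unfolding class_K_inf_def by (meson atLeast_iff order_trans strict_mono_on_leD)

lemma class_K_inf_at_top:
  assumes "class_K_inf \<alpha>"
  shows "filterlim \<alpha> at_top at_top"
  unfolding filterlim_at_top
proof
  fix Z :: real
  have "\<exists>x\<in>\<alpha> ` {0..}. \<not> x \<le> Z"
    using assms unfolding class_K_inf_def bdd_above_def by blast
  then obtain s where s: "0 \<le> s" "Z \<le> \<alpha> s" by auto
  then have "Z \<le> \<alpha> r" if "s \<le> r" for r
    using class_K_inf_mono[OF assms s(1) that] by linarith
  then show "eventually (\<lambda>r. Z \<le> \<alpha> r) at_top"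
    by (rule eventually_at_top_linorderI)
qed

lemma class_K_inf_deriv:
  assumes K: "class_K_inf \<alpha>" and d: "\<alpha> differentiable_on {0..}" and s: "0 < s"
  shows "(\<alpha> has_real_derivative deriv \<alpha> s) (at s)" "0 \<le> deriv \<alpha> s"
proof -
  have "\<alpha> differentiable (at s within {0..})" using d s by (auto simp: differentiable_on_def)
  moreover have "at s within {0..} = at s" using s by (intro at_within_interior) simp
  ultimately have "\<alpha> differentiable (at s)" by simp
  then obtain D where D: "(\<alpha> has_real_derivative D) (at s)"
    by (auto simp: real_differentiable_def)
  then show 1: "(\<alpha> has_real_derivative deriv \<alpha> s) (at s)" by (simp add: DERIV_imp_deriv)
  have "mono_on {0..} \<alpha>"
    using class_K_inf_mono[OF K] by (auto simp: mono_on_def)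
  then show "0 \<le> deriv \<alpha> s"
    by (rule mono_on_imp_deriv_nonneg[OF _ 1]) (use s in simp)
qed

text \<open>Since the time derivative of \<open>\<mu>\<close> is its square,
  \<open>\<delta> \<alpha>\<close> at \<open>\<mu>(t)\<close> is the logarithmic time derivative of
  the gain. Growth conditions are used in this form from here on, because the rates of products
  simply add up.\<close>

lemma gain_derivative:
  assumes "class_K_inf \<alpha>" "\<alpha> differentiable_on {0..}" "0 < T" "t0 \<le> t" "t < T + t0"
  shows "((\<lambda>t. \<alpha> (\<mu> T t0 t)) has_real_derivative \<delta> \<alpha> (\<mu> T t0 t) * \<alpha> (\<mu> T t0 t)) (at t within S)"
    "0 \<le> \<delta> \<alpha> (\<mu> T t0 t)"
proof -
  have pos: "0 < \<mu> T t0 t" by (rule mu_ge[OF assms(3-5)])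
  have apos: "0 < \<alpha> (\<mu> T t0 t)" by (rule class_K_inf_pos[OF assms(1) pos])
  have eq: "\<delta> \<alpha> (\<mu> T t0 t) * \<alpha> (\<mu> T t0 t) = deriv \<alpha> (\<mu> T t0 t) * (\<mu> T t0 t)\<^sup>2"
    using apos by (simp add: \<delta>_def)
  show "((\<lambda>t. \<alpha> (\<mu> T t0 t)) has_real_derivative \<delta> \<alpha> (\<mu> T t0 t) * \<alpha> (\<mu> T t0 t)) (at t within S)"
    unfolding eq
    by (rule DERIV_chain2[OF class_K_inf_deriv(1)[OF assms(1,2) pos] mu_has_derivative[OF assms(5)]])
  show "0 \<le> \<delta> \<alpha> (\<mu> T t0 t)"
    using class_K_inf_deriv(2)[OF assms(1,2) pos] apos by (simp add: \<delta>_def)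
qed

lemma power_gain_derivative:
  assumes "(a has_real_derivative dl * a t) (at t within S)"
  shows "((\<lambda>t. a t ^ n) has_real_derivative (real n * dl) * a t ^ n) (at t within S)"
proof -
  have "((\<lambda>t. a t ^ n) has_real_derivative real n * (a t ^ (n - Suc 0) * (dl * a t))) (at t within S)"
    using DERIV_power[OF assms, of n] by (simp add: mult_ac)
  moreover have "real n * (a t ^ (n - Suc 0) * (dl * a t)) = (real n * dl) * a t ^ n"
    by (cases n) auto
  ultimately show ?thesis by simp
qed

text \<open>The weights grow at the rates \<open>2 dg \<le> cs g\<close> and
  \<open>2 n da \<le> cs g / 2\<close>, together less than the decay \<open>2 cs g\<close> of
  \<open>E\<close>. The case \<open>n = 0\<close> serves the distance of \<open>w\<close> to
  \<open>z\<close>, the case \<open>n = m - 1\<close> the velocity \<open>w'\<close>.\<close>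

lemma weighted_energy_nonincreasing:
  assumes E: "\<And>t. t \<in> {t0..<b} \<Longrightarrow> (E has_real_derivative E' t) (at t within {t0..<b})"
      "\<And>t. t \<in> {t0..<b} \<Longrightarrow> E' t \<le> - 2 * cs * g t * E t"
      "\<And>t. t \<in> {t0..<b} \<Longrightarrow> 0 \<le> E t"
    and g: "\<And>t. t \<in> {t0..<b} \<Longrightarrow> (g has_real_derivative dg t * g t) (at t within {t0..<b})"
      "\<And>t. t \<in> {t0..<b} \<Longrightarrow> dg t \<le> cs / 2 * g t" "\<And>t. t \<in> {t0..<b} \<Longrightarrow> 0 < g t"
    and a: "\<And>t. t \<in> {t0..<b} \<Longrightarrow> (a has_real_derivative da t * a t) (at t within {t0..<b})"
      "\<And>t. t \<in> {t0..<b} \<Longrightarrow> real n * da t \<le> cs / 4 * g t"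
    and cs: "0 < cs" and t: "t \<in> {t0..<b}"
  shows "E t * (g t)\<^sup>2 * (a t ^ n)\<^sup>2 \<le> E t0 * (g t0)\<^sup>2 * (a t0 ^ n)\<^sup>2"
proof -
  let ?I = "{t0..<b}"
  let ?X = "\<lambda>t. E t * (g t)\<^sup>2 * (a t ^ n)\<^sup>2"
  let ?X' = "\<lambda>t. (E' t + E t * (2 * dg t + 2 * (real n * da t))) * ((g t)\<^sup>2 * (a t ^ n)\<^sup>2)"
  show ?thesis
  proof (rule nonincreasing_if_deriv_nonpos[where V="?X" and V'="?X'" and r=t and s=t0])
    fix s assume s: "s \<in> ?I"
    have "((\<lambda>t. E t * (g t)\<^sup>2 * (a t ^ n)\<^sup>2) has_real_derivative
        (E s * (g s)\<^sup>2) * (real 2 * (real n * da s) * (a s ^ n)\<^sup>2)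
        + (E s * (real 2 * dg s * (g s)\<^sup>2) + E' s * (g s)\<^sup>2) * (a s ^ n)\<^sup>2) (at s within ?I)"
      by (rule DERIV_mult'[OF DERIV_mult'[OF E(1)[OF s] power_gain_derivative[OF g(1)[OF s]]]
            power_gain_derivative[where a="\<lambda>t. a t ^ n", OF power_gain_derivative[OF a(1)[OF s]]]])
    then show "(?X has_real_derivative ?X' s) (at s within ?I)"
      by (rule DERIV_cong) (simp add: algebra_simps)
  next
    fix s assume "t0 < s" "s < t"
    then have s: "s \<in> ?I" using t by auto
    have "dg s \<le> (cs * g s) / 2" "real n * da s \<le> (cs * g s) / 4"
      using g(2)[OF s] a(2)[OF s] by simp_all
    then have "2 * dg s + 2 * (real n * da s) \<le> 2 * (cs * g s)"
      using mult_pos_pos[OF cs g(3)[OF s]] by linarith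
    then have "E s * (2 * dg s + 2 * (real n * da s)) \<le> E s * (2 * (cs * g s))"
      by (intro mult_left_mono E(3)[OF s])
    then have "E' s + E s * (2 * dg s + 2 * (real n * da s)) \<le> 0"
      using E(2)[OF s] by (simp add: algebra_simps)
    then show "?X' s \<le> 0" by (intro mult_nonpos_nonneg) auto
  qed (use t in auto)
qed

text \<open>Each part of the damping has its own task: \<open>\<psi>^2\<close> absorbs
  \<open>H \<psi>\<close>, the 1 absorbs \<open>R\<close>, and \<open>v\<close> pays the constants
  \<open>H^2 / 4\<close> and \<open>R^2 / 4\<close> left by completing squares once \<open>e\<close>
  is large. The factor \<open>\<beta>\<close> is common to damping and forcing and only rescales
  time, so it may be unbounded.\<close>

lemma sliding_variable_bound:
  fixes e :: "real \<Rightarrow> 'b::real_inner"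
  assumes d: "\<And>t. t \<in> {t0..<b} \<Longrightarrow>
      (e has_vector_derivative - ((\<beta> t * (v + (\<psi> t)\<^sup>2 + 1)) *\<^sub>R e t) + r t) (at t within {t0..<b})"
    and r: "\<And>t. t \<in> {t0..<b} \<Longrightarrow> norm (r t) \<le> \<beta> t * (H * \<psi> t + R)"
    and \<beta>: "\<And>t. t \<in> {t0..<b} \<Longrightarrow> 0 \<le> \<beta> t"
    and v: "0 < v" and t: "t \<in> {t0..<b}"
  shows "inner (e t) (e t) \<le> max (inner (e t0) (e t0)) ((H\<^sup>2 + R\<^sup>2) / (4 * v))"
proof -
  let ?e' = "\<lambda>t. - ((\<beta> t * (v + (\<psi> t)\<^sup>2 + 1)) *\<^sub>R e t) + r t"
  show ?thesis
  proof (rule barrier_bound[where V="\<lambda>t. inner (e t) (e t)" and V'="\<lambda>t. 2 * inner (e t) (?e' t)", OF _ _ t])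
    show "((\<lambda>t. inner (e t) (e t)) has_real_derivative 2 * inner (e t) (?e' t)) (at t within {t0..<b})"
      if "t \<in> {t0..<b}" for t
      by (rule has_real_derivative_inner_self[OF d[OF that]])
    fix t assume t: "t \<in> {t0..<b}" and gt: "(H\<^sup>2 + R\<^sup>2) / (4 * v) < inner (e t) (e t)"
    let ?n = "norm (e t)"
    have n2: "inner (e t) (e t) = ?n\<^sup>2" by (simp add: power2_norm_eq_inner)
    have 1: "(H\<^sup>2 + R\<^sup>2) / 4 \<le> v * ?n\<^sup>2" using gt v unfolding n2 by (simp add: field_simps)
    have 2: "H * \<psi> t * ?n \<le> (\<psi> t)\<^sup>2 * ?n\<^sup>2 + H\<^sup>2 / 4"
      using zero_le_power2[of "\<psi> t * ?n - H / 2"] by (simp add: power2_eq_square algebra_simps)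
    have 3: "R * ?n \<le> ?n\<^sup>2 + R\<^sup>2 / 4"
      using zero_le_power2[of "?n - R / 2"] by (simp add: power2_eq_square algebra_simps)
    have "inner (e t) (r t) \<le> ?n * norm (r t)" by (rule norm_cauchy_schwarz)
    also have "\<dots> \<le> ?n * (\<beta> t * (H * \<psi> t + R))" by (intro mult_left_mono r t) auto
    also have "\<dots> = \<beta> t * (H * \<psi> t * ?n + R * ?n)" by (simp add: algebra_simps)
    also have "\<dots> \<le> \<beta> t * ((v + (\<psi> t)\<^sup>2 + 1) * ?n\<^sup>2)"
    proof (intro mult_left_mono \<beta>[OF t])
      have "H * \<psi> t * ?n + R * ?n \<le> (\<psi> t)\<^sup>2 * ?n\<^sup>2 + ?n\<^sup>2 + (H\<^sup>2 + R\<^sup>2) / 4"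
        using 2 3 by (simp add: add_divide_distrib)
      also have "\<dots> \<le> (v + (\<psi> t)\<^sup>2 + 1) * ?n\<^sup>2" using 1 by (simp add: algebra_simps)
      finally show "H * \<psi> t * ?n + R * ?n \<le> (v + (\<psi> t)\<^sup>2 + 1) * ?n\<^sup>2" .
    qed
    finally show "2 * inner (e t) (?e' t) \<le> 0"
      by (simp add: inner_add_right inner_diff_right n2 mult_ac)
  qed
qed

section \<open>The tracking error\<close>

text \<open>Any enumeration will do, since the Kronecker factor acting on the coordinates of R^n is
  the identity.\<close>

definition coord_enum :: "nat \<Rightarrow> 'n::finite" where
  "coord_enum = (SOME e. bij_betw e {..<CARD('n)} UNIV)"

lemma coord_enum_bij: "bij_betw (coord_enum :: nat \<Rightarrow> 'n::finite) {..<CARD('n)} UNIV"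
proof -
  have "\<exists>e. bij_betw e {..<CARD('n)} (UNIV :: 'n set)"
    by (metis atLeast0LessThan ex_bij_betw_nat_finite finite_class.finite_UNIV)
  then show ?thesis unfolding coord_enum_def by (rule someI_ex)
qed

text \<open>The blocks \<open>E 1, E 2, ...\<close> laid out consecutively, in the index order of \<^const>\<open>kronecker\<close>.\<close>

definition flat :: "(nat \<Rightarrow> real^'n) \<Rightarrow> nat \<Rightarrow> real" where
  "flat E i = E (Suc (i div CARD('n))) $ coord_enum (i mod CARD('n))"

lemma sum_div_mod:
  fixes g :: "nat \<Rightarrow> nat \<Rightarrow> 'b::comm_monoid_add"
  assumes "0 < n"
  shows "(\<Sum>i<l * n. g (i div n) (i mod n)) = (\<Sum>q<l. \<Sum>c<n. g q c)"
proof -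
  have "(\<Sum>i<l * n. g (i div n) (i mod n)) = (\<Sum>q<l. \<Sum>i\<in>{q * n..<q * n + n}. g (i div n) (i mod n))"
    by (rule sum.nat_group[symmetric])
  also have "\<dots> = (\<Sum>q<l. \<Sum>c<n. g q c)"
  proof (rule sum.cong[OF refl])
    fix q
    show "(\<Sum>i\<in>{q * n..<q * n + n}. g (i div n) (i mod n)) = (\<Sum>c<n. g q c)"
      unfolding sum.atLeastLessThan_shift_0[of _ "q * n"]
      by (simp add: atLeast0LessThan)
  qed
  finally show ?thesis .
qed

lemma dot_flat:
  fixes E F :: "nat \<Rightarrow> real^'n"
  shows "dot (l * CARD('n)) (flat E) (flat F) = (\<Sum>q=1..l. inner (E q) (F q))"
proof -
  have "dot (l * CARD('n)) (flat E) (flat F) =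
      (\<Sum>q<l. \<Sum>c<CARD('n). E (Suc q) $ coord_enum c * F (Suc q) $ coord_enum c)"
    unfolding dot_def flat_def
    by (rule sum_div_mod[where g="\<lambda>q c. E (Suc q) $ coord_enum c * F (Suc q) $ coord_enum c"]) simp
  also have "\<dots> = (\<Sum>q<l. inner (E (Suc q)) (F (Suc q)))"
    unfolding inner_vec_def
    by (intro sum.cong refl, subst sum.reindex_bij_betw[OF coord_enum_bij]) simp
  also have "\<dots> = (\<Sum>q=1..l. inner (E q) (F q))" by (simp add: sum.atLeast1_atMost_eq)
  finally show ?thesis .
qed

text \<open>The action of the companion matrix, tensored with the identity, on the blocks
  \<open>1..m - 1\<close>; block \<open>m - 1\<close> is the last row.\<close>

definition companion_map :: "nat \<Rightarrow> (nat \<Rightarrow> real) \<Rightarrow> (nat \<Rightarrow> 'b::real_vector) \<Rightarrow> nat \<Rightarrow> 'b" where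
  "companion_map m k E q = (if q < m - 1 then E (Suc q) else - (\<Sum>c=1..m - 1. k c *\<^sub>R E c))"

lemma kronecker_companion_flat:
  fixes E :: "nat \<Rightarrow> real^'n"
  assumes i: "i < (m - 1) * CARD('n)"
  shows "(\<Sum>j<(m - 1) * CARD('n). kronecker (companion m k) (1\<^sub>m CARD('n)) $$ (i, j) * flat E j) =
    flat (companion_map m k E) i"
proof -
  let ?n = "CARD('n)" and ?r = "i div CARD('n)" and ?s = "i mod CARD('n)"
  let ?c = "\<lambda>q. companion m k $$ (?r, q)"
  have r: "?r < m - 1" using i by (simp add: less_mult_imp_div_less)
  have s: "?s < ?n" by simp
  have "(\<Sum>j<(m - 1) * ?n. kronecker (companion m k) (1\<^sub>m ?n) $$ (i, j) * flat E j) =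
      (\<Sum>j<(m - 1) * ?n. (\<lambda>q c. ?c q * (if ?s = c then 1 else 0) * (E (Suc q) $ coord_enum c)) (j div ?n) (j mod ?n))"
    by (intro sum.cong refl) (use i s in \<open>auto simp: kronecker_def companion_def flat_def\<close>)
  also have "\<dots> = (\<Sum>q<m - 1. \<Sum>c<?n. ?c q * (if ?s = c then 1 else 0) * (E (Suc q) $ coord_enum c))"
    by (rule sum_div_mod) simp
  also have "\<dots> = (\<Sum>q<m - 1. \<Sum>c<?n. if ?s = c then ?c q * (E (Suc q) $ coord_enum c) else 0)"
    by (intro sum.cong refl) simp
  also have "\<dots> = (\<Sum>q<m - 1. ?c q * (E (Suc q) $ coord_enum ?s))"
    by (intro sum.cong refl) (simp add: sum.delta)
  also have "\<dots> = flat (companion_map m k E) i"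
  proof (cases "?r < m - 2")
    case True
    have "(\<Sum>q<m - 1. ?c q * (E (Suc q) $ coord_enum ?s)) =
        (\<Sum>q<m - 1. if q = Suc ?r then E (Suc q) $ coord_enum ?s else 0)"
      by (intro sum.cong refl) (use True r in \<open>auto simp: companion_def\<close>)
    also have "\<dots> = E (Suc (Suc ?r)) $ coord_enum ?s" using True by (simp add: sum.delta)
    finally show ?thesis using True by (auto simp: flat_def companion_map_def)
  next
    case False
    have "(\<Sum>q<m - 1. ?c q * (E (Suc q) $ coord_enum ?s)) =
        (\<Sum>q<m - 1. - (k (Suc q) * (E (Suc q) $ coord_enum ?s)))"
      by (intro sum.cong refl) (use False r in \<open>auto simp: companion_def\<close>)
    also have "\<dots> = - (\<Sum>q=1..m - 1. k q * (E q $ coord_enum ?s))"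
      by (simp add: sum_negf sum.atLeast1_atMost_eq)
    finally show ?thesis using False r by (auto simp: flat_def companion_map_def)
  qed
  finally show ?thesis .
qed

text \<open>The Lyapunov equation evaluated at the vector \<open>flat E\<close>: the two summands on
  its left give \<open>bil\<close> with the arguments in either order, and these agree by symmetry
  of \<open>P\<close>.\<close>

lemma lyapunov_identity:
  fixes E :: "nat \<Rightarrow> real^'n" and P Q :: "real mat"
  assumes n_def: "n = (m - 1) * CARD('n)"
    and P: "P \<in> carrier_mat n n" and Psym: "\<And>i j. i < n \<Longrightarrow> j < n \<Longrightarrow> P $$ (i, j) = P $$ (j, i)"
    and Q: "Q \<in> carrier_mat n n"
    and lyapunov: "P * kronecker (companion m k) (1\<^sub>m CARD('n))
        + kronecker (transpose_mat (companion m k)) (1\<^sub>m CARD('n)) * P = - Q"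
  shows "2 * bil n (\<lambda>i j. P $$ (i, j)) (flat E) (flat (companion_map m k E)) =
    - bil n (\<lambda>i j. Q $$ (i, j)) (flat E) (flat E)"
proof -
  let ?K = "kronecker (companion m k) (1\<^sub>m CARD('n))"
  let ?K' = "kronecker (transpose_mat (companion m k)) (1\<^sub>m CARD('n))"
  let ?e = "flat E" and ?f = "flat (companion_map m k E)"
  let ?P = "\<lambda>i j. P $$ (i, j)"
  have K: "?K \<in> carrier_mat n n" "?K' \<in> carrier_mat n n"
    by (simp_all add: kronecker_def companion_def n_def)
  have K': "?K' $$ (i, j) = ?K $$ (j, i)" if "i < n" "j < n" for i j
    using that less_mult_imp_div_less[of i "m - 1" "CARD('n)"] less_mult_imp_div_less[of j "m - 1" "CARD('n)"]
    by (auto simp: kronecker_def n_def companion_def)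
  have fl: "(\<Sum>j<n. ?K $$ (i, j) * ?e j) = ?f i" if "i < n" for i
    using kronecker_companion_flat[of i m k E] that by (simp add: n_def)
  have q: "- Q $$ (i, j) = (\<Sum>l<n. P $$ (i, l) * ?K $$ (l, j)) + (\<Sum>l<n. ?K $$ (l, i) * P $$ (l, j))"
    if ij: "i < n" "j < n" for i j
  proof -
    have "- Q $$ (i, j) = (- Q) $$ (i, j)" using Q ij by simp
    also have "\<dots> = (P * ?K + ?K' * P) $$ (i, j)" by (simp only: lyapunov)
    also have "\<dots> = (\<Sum>l<n. P $$ (i, l) * ?K $$ (l, j)) + (\<Sum>l<n. ?K' $$ (i, l) * P $$ (l, j))"
      using P K ij by (simp add: scalar_prod_def atLeast0LessThan)
    also have "(\<Sum>l<n. ?K' $$ (i, l) * P $$ (l, j)) = (\<Sum>l<n. ?K $$ (l, i) * P $$ (l, j))"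
      by (intro sum.cong refl) (simp add: K' ij)
    finally show ?thesis .
  qed
  have "- bil n (\<lambda>i j. Q $$ (i, j)) ?e ?e =
      (\<Sum>i<n. \<Sum>j<n. ((\<Sum>l<n. P $$ (i, l) * ?K $$ (l, j)) + (\<Sum>l<n. ?K $$ (l, i) * P $$ (l, j))) * ?e i * ?e j)"
    unfolding bil_def sum_negf[symmetric] by (intro sum.cong refl) (simp add: q[symmetric])
  also have "\<dots> = (\<Sum>i<n. \<Sum>j<n. \<Sum>l<n. P $$ (i, l) * ?K $$ (l, j) * ?e i * ?e j)
      + (\<Sum>i<n. \<Sum>j<n. \<Sum>l<n. ?K $$ (l, i) * P $$ (l, j) * ?e i * ?e j)"
    by (simp only: distrib_right sum.distrib sum_distrib_right)
  also have "(\<Sum>i<n. \<Sum>j<n. \<Sum>l<n. P $$ (i, l) * ?K $$ (l, j) * ?e i * ?e j) = bil n ?P ?e ?f"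
  proof -
    have "(\<Sum>i<n. \<Sum>j<n. \<Sum>l<n. P $$ (i, l) * ?K $$ (l, j) * ?e i * ?e j) =
        (\<Sum>i<n. \<Sum>l<n. \<Sum>j<n. P $$ (i, l) * ?K $$ (l, j) * ?e i * ?e j)"
      by (intro sum.cong refl sum.swap)
    also have "\<dots> = (\<Sum>i<n. \<Sum>l<n. P $$ (i, l) * ?e i * (\<Sum>j<n. ?K $$ (l, j) * ?e j))"
      by (simp add: sum_distrib_left mult_ac)
    also have "\<dots> = bil n ?P ?e ?f"
      unfolding bil_def by (intro sum.cong refl) (simp add: fl)
    finally show ?thesis .
  qed
  also have "(\<Sum>i<n. \<Sum>j<n. \<Sum>l<n. ?K $$ (l, i) * P $$ (l, j) * ?e i * ?e j) = bil n ?P ?f ?e"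
  proof -
    have "(\<Sum>i<n. \<Sum>j<n. \<Sum>l<n. ?K $$ (l, i) * P $$ (l, j) * ?e i * ?e j) =
        (\<Sum>i<n. \<Sum>l<n. \<Sum>j<n. ?K $$ (l, i) * P $$ (l, j) * ?e i * ?e j)"
      by (intro sum.cong refl sum.swap)
    also have "\<dots> = (\<Sum>l<n. \<Sum>i<n. \<Sum>j<n. ?K $$ (l, i) * P $$ (l, j) * ?e i * ?e j)"
      by (rule sum.swap)
    also have "\<dots> = (\<Sum>l<n. \<Sum>j<n. \<Sum>i<n. ?K $$ (l, i) * P $$ (l, j) * ?e i * ?e j)"
      by (intro sum.cong refl sum.swap)
    also have "\<dots> = (\<Sum>l<n. \<Sum>j<n. P $$ (l, j) * (\<Sum>i<n. ?K $$ (l, i) * ?e i) * ?e j)"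
      by (simp add: sum_distrib_left sum_distrib_right mult_ac)
    also have "\<dots> = bil n ?P ?f ?e"
      unfolding bil_def by (intro sum.cong refl) (simp add: fl)
    finally show ?thesis .
  qed
  also have "bil n ?P ?f ?e = bil n ?P ?e ?f" by (rule bil_commute[OF Psym])
  finally show ?thesis by simp
qed

lemma pos_def_carrier:
  assumes "pos_def n A"
  shows "A \<in> carrier_mat n n" "i < n \<Longrightarrow> j < n \<Longrightarrow> A $$ (i, j) = A $$ (j, i)"
proof -
  show A: "A \<in> carrier_mat n n" using assms by (simp add: pos_def_def)
  have "transpose_mat A = A" using assms by (simp add: pos_def_def)
  then show "i < n \<Longrightarrow> j < n \<Longrightarrow> A $$ (i, j) = A $$ (j, i)"
    using A by (metis carrier_matD index_transpose_mat(1))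
qed

text \<open>If \<open>k 1\<close> were zero, the companion matrix would annihilate a unit vector in
  the first block. The Lyapunov equation would then make the form of \<open>Q\<close> vanish there,
  against positive definiteness. The sliding variable divides by \<open>k 1\<close>, so this fact is
  indispensable.\<close>

lemma lyapunov_gain_nonzero:
  fixes P Q :: "real mat"
  assumes m: "2 \<le> m"
    and PQ: "pos_def ((m - 1) * CARD('n::finite)) P" "pos_def ((m - 1) * CARD('n)) Q"
    and lyapunov: "P * kronecker (companion m k) (1\<^sub>m CARD('n))
        + kronecker (transpose_mat (companion m k)) (1\<^sub>m CARD('n)) * P = - Q"
  shows "k 1 \<noteq> 0"
proof
  assume k: "k 1 = 0"
  let ?n = "(m - 1) * CARD('n)"
  define E :: "nat \<Rightarrow> real^'n" where "E q = (if q = 1 then axis undefined 1 else 0)" for q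
  have "companion_map m k E (Suc q) = 0" for q
  proof -
    have "(\<Sum>c=1..m - 1. k c *\<^sub>R E c) = 0"
      by (intro sum.neutral) (auto simp: E_def k[simplified])
    then show ?thesis by (auto simp: companion_map_def E_def)
  qed
  then have fl0: "flat (companion_map m k E) = (\<lambda>_. 0)" by (auto simp: flat_def)
  have "bil ?n (\<lambda>i j. Q $$ (i, j)) (flat E) (flat E) = 0"
  proof -
    have "2 * bil ?n (\<lambda>i j. P $$ (i, j)) (flat E) (flat (companion_map m k E)) =
        - bil ?n (\<lambda>i j. Q $$ (i, j)) (flat E) (flat E)"
      by (rule lyapunov_identity[OF refl pos_def_carrier[OF PQ(1)] pos_def_carrier(1)[OF PQ(2)] lyapunov])
    then show ?thesis using fl0 by (simp add: bil_def)
  qed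
  moreover have n: "0 < ?n" using m by simp
  have "lambda_min Q * dot ?n (flat E) (flat E) \<le> bil ?n (\<lambda>i j. Q $$ (i, j)) (flat E) (flat E)"
    by (rule pos_def_rayleigh[OF PQ(2) n])
  moreover have "0 < lambda_min Q" by (rule pos_def_rayleigh[OF PQ(2) n])
  moreover have "dot ?n (flat E) (flat E) = 1"
  proof -
    have "dot ?n (flat E) (flat E) = (\<Sum>q=1..m - 1. if q = 1 then 1 else 0)"
      unfolding dot_flat by (intro sum.cong refl) (auto simp: E_def inner_axis_axis)
    also have "\<dots> = 1" using m by (subst sum.delta) auto
    finally show ?thesis .
  qed
  ultimately show False by simp
qed

lemma bil_has_derivative:
  assumes sym: "\<And>i j. i < n \<Longrightarrow> j < n \<Longrightarrow> A i j = A j i"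
    and d: "\<And>i. i < n \<Longrightarrow> ((\<lambda>t. e t i) has_real_derivative e' i) (at t within I)"
  shows "((\<lambda>t. bil n A (e t) (e t)) has_real_derivative 2 * bil n A (e t) e') (at t within I)"
proof -
  have "((\<lambda>t. bil n A (e t) (e t)) has_real_derivative
      (\<Sum>i<n. \<Sum>j<n. A i j * e t i * e' j + A i j * e' i * e t j)) (at t within I)"
    unfolding bil_def by (intro DERIV_sum DERIV_mult' DERIV_cmult d) auto
  also have "(\<Sum>i<n. \<Sum>j<n. A i j * e t i * e' j + A i j * e' i * e t j) = bil n A (e t) e' + bil n A e' (e t)"
    by (simp add: bil_def sum.distrib)
  also have "bil n A e' (e t) = bil n A (e t) e'" by (rule bil_commute[OF sym])
  finally show ?thesis by simp
qed

lemma flat_has_derivative: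
  fixes E :: "nat \<Rightarrow> real \<Rightarrow> real^'n"
  assumes "\<And>q. q \<in> {1..l} \<Longrightarrow> (E q has_vector_derivative E' q) (at t within I)"
    and i: "i < l * CARD('n)"
  shows "((\<lambda>t. flat (\<lambda>q. E q t) i) has_real_derivative flat E' i) (at t within I)"
proof -
  have "Suc (i div CARD('n)) \<in> {1..l}" using i by (simp add: less_mult_imp_div_less Suc_le_eq)
  from bounded_linear.has_vector_derivative[OF bounded_linear_vec_nth assms(1)[OF this]]
  show ?thesis unfolding flat_def by (simp add: has_real_derivative_iff_has_vector_derivative)
qed

text \<open>\<open>E\<close> follows the companion system sped up by \<open>a\<close>, with a drift
  from differentiating the scalings and a forcing \<open>G\<close>. After weighting with
  \<open>a^m\<close> the forcing is of order \<open>a\<close>, just like the decay, so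
  \<open>a\<close> factors out of the differential inequality and the barrier argument applies
  although \<open>a\<close> may be unbounded.\<close>

lemma chain_error_bound:
  fixes E G :: "nat \<Rightarrow> real \<Rightarrow> real^'n" and P Q :: "real mat"
  assumes m: "2 \<le> m"
    and PQ: "pos_def ((m - 1) * CARD('n)) P" "pos_def ((m - 1) * CARD('n)) Q"
    and lyapunov: "P * kronecker (companion m k) (1\<^sub>m CARD('n))
        + kronecker (transpose_mat (companion m k)) (1\<^sub>m CARD('n)) * P = - Q"
    and v1: "v1 = lambda_min Q / lambda_max P"
    and v2: "v2 = 2 * real m * lambda_max P / lambda_min P"
    and d: "\<And>q t. q \<in> {1..m - 1} \<Longrightarrow> t \<in> {t0..<b} \<Longrightarrow>
      (E q has_vector_derivative a t *\<^sub>R companion_map m k (\<lambda>q. E q t) q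
         - (real (q - 1) * dl t) *\<^sub>R E q t + G q t) (at t within {t0..<b})"
    and a: "\<And>t. t \<in> {t0..<b} \<Longrightarrow> (a has_real_derivative dl t * a t) (at t within {t0..<b})"
      "\<And>t. t \<in> {t0..<b} \<Longrightarrow> 0 < a t"
    and dl: "\<And>t. t \<in> {t0..<b} \<Longrightarrow> 0 \<le> dl t" "\<And>t. t \<in> {t0..<b} \<Longrightarrow> dl t \<le> v1 / (2 * v2) * a t"
    and G: "\<And>q t. q \<in> {1..m - 1} \<Longrightarrow> t \<in> {t0..<b} \<Longrightarrow> a t ^ m * norm (G q t) \<le> K * a t"
  shows "\<exists>M. \<forall>q\<in>{1..m - 1}. \<forall>t\<in>{t0..<b}. a t ^ m * norm (E q t) \<le> M"
proof -
  let ?I = "{t0..<b}"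
  define n where "n = (m - 1) * CARD('n)"
  define Pf where "Pf i j = P $$ (i, j)" for i j
  define Qf where "Qf i j = Q $$ (i, j)" for i j
  have n: "0 < n" using m by (simp add: n_def)
  note PQ' = PQ[folded n_def]
  have Pf: "(\<lambda>i j. P $$ (i, j)) = Pf" "(\<lambda>i j. Q $$ (i, j)) = Qf" by (simp_all add: Pf_def Qf_def fun_eq_iff)
  have Psym: "Pf i j = Pf j i" if "i < n" "j < n" for i j
    unfolding Pf_def by (rule pos_def_carrier(2)[OF PQ'(1) that])
  define Lp lp lq where "Lp = lambda_max P" and "lp = lambda_min P" and "lq = lambda_min Q"
  have lp: "0 < lp" "lp \<le> Lp" and lq: "0 < lq"
    unfolding Lp_def lp_def lq_def by (rule pos_def_rayleigh[OF PQ'(1) n] pos_def_rayleigh[OF PQ'(2) n])+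
  have Lp: "0 < Lp" using lp by simp
  have rP: "lp * dot n y y \<le> bil n Pf y y" "bil n Pf y y \<le> Lp * dot n y y" for y
    using pos_def_rayleigh(3,4)[OF PQ'(1) n, of y] by (simp_all add: Pf Lp_def lp_def)
  have rQ: "lq * dot n y y \<le> bil n Qf y y" for y
    using pos_def_rayleigh(3)[OF PQ'(2) n, of y] by (simp add: Pf lq_def)
  have psd: "0 \<le> bil n Pf y y" for y
    using rP(1)[of y] lp dot_self_nonneg[of n y] by (meson less_imp_le mult_nonneg_nonneg order_trans)
  define e where "e t = flat (\<lambda>q. E q t)" for t
  define g where "g t = flat (\<lambda>q. G q t)" for t
  define de where "de t = flat (\<lambda>q. real (q - 1) *\<^sub>R E q t)" for t
  define ce where "ce t = flat (companion_map m k (\<lambda>q. E q t))" for t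
  define e' where "e' t i = a t * ce t i + ((- dl t) * de t i + g t i)" for t i
  have de: "((\<lambda>t. e t i) has_real_derivative e' t i) (at t within ?I)" if "t \<in> ?I" "i < n" for t i
  proof -
    have "((\<lambda>t. flat (\<lambda>q. E q t) i) has_real_derivative
      flat (\<lambda>q. a t *\<^sub>R companion_map m k (\<lambda>q. E q t) q
         - (real (q - 1) * dl t) *\<^sub>R E q t + G q t) i) (at t within ?I)"
      by (rule flat_has_derivative[of "m - 1"]) (use d that in \<open>auto simp: n_def\<close>)
    then show ?thesis
      by (simp add: e_def e'_def ce_def de_def g_def flat_def algebra_simps)
  qed
  define V where "V t = bil n Pf (e t) (e t)" for t
  define V' where "V' t = 2 * bil n Pf (e t) (e' t)" for t
  have dV: "(V has_real_derivative V' t) (at t within ?I)" if "t \<in> ?I" for t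
    unfolding V_def V'_def by (rule bil_has_derivative[OF Psym de[OF that]])
  define D where "D t = dot n (e t) (e t)" for t
  have D0: "0 \<le> D t" for t unfolding D_def by (rule dot_self_nonneg)
  have VD: "lp * D t \<le> V t" "V t \<le> Lp * D t" for t
    using rP[of "e t"] by (auto simp: V_def D_def)
  have V0: "0 \<le> V t" for t unfolding V_def by (rule psd)
  have v1pos: "0 < v1" using lq Lp by (simp add: v1 lq_def Lp_def)
  \<comment> \<open>Divided by \<open>a V\<close>, the rates are \<open>- v1\<close> from the
    companion matrix, at most \<open>v1 / 2 - v1 / (2 m)\<close> from the drift and at most
    \<open>v1 / 2\<close> from the weight \<open>a^(2m)\<close>. The surplus is
    \<open>2 \<epsilon>\<close>; one \<open>\<epsilon>\<close> is spent on the forcing, the other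
    remains.\<close>
  define \<epsilon> where "\<epsilon> = v1 / (4 * real m)"
  have eps: "0 < \<epsilon>" using v1pos m by (simp add: \<epsilon>_def)
  have b1: "2 * bil n Pf (e t) (ce t) \<le> - (v1 * V t)" for t
  proof -
    have "2 * bil n (\<lambda>i j. P $$ (i, j)) (e t) (ce t) = - bil n (\<lambda>i j. Q $$ (i, j)) (e t) (e t)"
      unfolding e_def ce_def
      by (rule lyapunov_identity[OF n_def pos_def_carrier[OF PQ'(1)] pos_def_carrier(1)[OF PQ'(2)] lyapunov])
    then have "2 * bil n Pf (e t) (ce t) \<le> - (lq * D t)"
      using rQ[of "e t"] by (simp add: Pf D_def)
    moreover have "v1 * V t \<le> lq * D t"
      using VD(2)[of t] lq Lp unfolding v1 by (simp add: field_simps flip: lq_def Lp_def)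
    ultimately show ?thesis by linarith
  qed
  have m1: "0 < real (m - 1)" using m by simp
  \<comment> \<open>Block \<open>q\<close> drifts with the factor \<open>q - 1\<close>, at most
    \<open>m - 1\<close>. Young's inequality with parameter \<open>m - 1\<close> balances the two
    resulting terms. The ratio \<open>Lp / lp\<close> explains the eigenvalue quotient in
    \<open>v2\<close>.\<close>
  have b2: "- (2 * bil n Pf (e t) (de t)) \<le> 2 * real (m - 1) * (Lp / lp) * V t" for t
  proof -
    have "dot n (de t) (de t) \<le> (real (m - 1))\<^sup>2 * D t"
      unfolding D_def de_def e_def n_def dot_flat sum_distrib_left
    proof (intro sum_mono)
      fix q assume "q \<in> {1..m - 1}"
      then have "(real (q - 1))\<^sup>2 \<le> (real (m - 1))\<^sup>2" by (intro power_mono) auto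
      then have "(real (q - 1))\<^sup>2 * inner (E q t) (E q t) \<le> (real (m - 1))\<^sup>2 * inner (E q t) (E q t)"
        by (intro mult_right_mono) auto
      then show "inner (real (q - 1) *\<^sub>R E q t) (real (q - 1) *\<^sub>R E q t) \<le> (real (m - 1))\<^sup>2 * inner (E q t) (E q t)"
        by (simp add: power2_eq_square mult.assoc)
    qed
    then have "Lp * dot n (de t) (de t) \<le> Lp * ((real (m - 1))\<^sup>2 * D t)"
      using Lp by (intro mult_left_mono) auto
    then have "bil n Pf (de t) (de t) \<le> Lp * ((real (m - 1))\<^sup>2 * D t)" using rP(2)[of "de t"] by linarith
    then have "inverse (real (m - 1)) * bil n Pf (de t) (de t) \<le> inverse (real (m - 1)) * (Lp * ((real (m - 1))\<^sup>2 * D t))"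
      using m1 by (intro mult_left_mono) auto
    also have "\<dots> = real (m - 1) * (Lp * D t)" using m1 by (simp add: power2_eq_square field_simps)
    finally have 1: "inverse (real (m - 1)) * bil n Pf (de t) (de t) \<le> real (m - 1) * (Lp * D t)" .
    have "2 * bil n Pf (e t) (\<lambda>i. (- 1) * de t i) \<le> real (m - 1) * bil n Pf (e t) (e t)
        + inverse (real (m - 1)) * bil n Pf (\<lambda>i. (- 1) * de t i) (\<lambda>i. (- 1) * de t i)"
      by (rule bil_young[OF Psym psd m1])
    then have "- (2 * bil n Pf (e t) (de t)) \<le> real (m - 1) * V t + inverse (real (m - 1)) * bil n Pf (de t) (de t)"
      unfolding bil_scale_left bil_scale_right V_def by simp
    also have "\<dots> \<le> real (m - 1) * (Lp * D t) + real (m - 1) * (Lp * D t)"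
      using m1 VD(2) 1 by (intro add_mono mult_left_mono) auto
    also have "\<dots> = 2 * real (m - 1) * (Lp / lp) * (lp * D t)" using lp by simp
    also have "\<dots> \<le> 2 * real (m - 1) * (Lp / lp) * V t"
      using m1 lp Lp VD(1) by (intro mult_left_mono) auto
    finally show ?thesis .
  qed
  define W where "W t = a t ^ m" for t
  \<comment> \<open>Young's inequality with parameter \<open>\<epsilon> a\<close>: the weighted
    forcing of size \<open>K a\<close> costs a multiple of \<open>(K a)^2 / (\<epsilon> a)\<close>,
    which is linear in \<open>a\<close>.\<close>
  have b3: "(W t)\<^sup>2 * (2 * bil n Pf (e t) (g t)) \<le> \<epsilon> * a t * ((W t)\<^sup>2 * V t) + Lp * (real (m - 1) * K\<^sup>2) / \<epsilon> * a t"
    if t: "t \<in> ?I" for t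
  proof -
    have at: "0 < a t" by (rule a(2)[OF t])
    have gg: "(W t)\<^sup>2 * dot n (g t) (g t) \<le> real (m - 1) * (K\<^sup>2 * (a t)\<^sup>2)"
    proof -
      have "(W t)\<^sup>2 * dot n (g t) (g t) = (\<Sum>q=1..m - 1. (W t * norm (G q t))\<^sup>2)"
        unfolding g_def n_def dot_flat by (simp add: sum_distrib_left power_mult_distrib power2_norm_eq_inner)
      also have "\<dots> \<le> (\<Sum>q=1..m - 1. (K * a t)\<^sup>2)"
        using G[OF _ t] at by (intro sum_mono power_mono) (auto simp: W_def)
      finally show ?thesis by (simp add: power_mult_distrib)
    qed
    have "2 * bil n Pf (e t) (g t) \<le> \<epsilon> * a t * bil n Pf (e t) (e t) + inverse (\<epsilon> * a t) * bil n Pf (g t) (g t)"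
      by (rule bil_young[OF Psym psd]) (use eps at in auto)
    also have "\<dots> \<le> \<epsilon> * a t * V t + inverse (\<epsilon> * a t) * (Lp * dot n (g t) (g t))"
      unfolding V_def using eps at rP(2) by (intro add_left_mono mult_left_mono) auto
    finally have "(W t)\<^sup>2 * (2 * bil n Pf (e t) (g t)) \<le>
        (W t)\<^sup>2 * (\<epsilon> * a t * V t + inverse (\<epsilon> * a t) * (Lp * dot n (g t) (g t)))"
      by (intro mult_left_mono) auto
    also have "\<dots> = \<epsilon> * a t * ((W t)\<^sup>2 * V t) + inverse (\<epsilon> * a t) * (Lp * ((W t)\<^sup>2 * dot n (g t) (g t)))"
      by (simp add: algebra_simps)
    also have "\<dots> \<le> \<epsilon> * a t * ((W t)\<^sup>2 * V t)
        + inverse (\<epsilon> * a t) * (Lp * (real (m - 1) * (K\<^sup>2 * (a t)\<^sup>2)))"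
      using gg eps at Lp by (intro add_left_mono mult_left_mono) auto
    also have "inverse (\<epsilon> * a t) * (Lp * (real (m - 1) * (K\<^sup>2 * (a t)\<^sup>2))) = Lp * (real (m - 1) * K\<^sup>2) / \<epsilon> * a t"
      using eps at by (simp add: power2_eq_square field_simps)
    finally show ?thesis .
  qed
  define C where "C = Lp * (real (m - 1) * K\<^sup>2) / \<epsilon>"
  define Y where "Y t = V t * (W t)\<^sup>2" for t
  define Y' where "Y' t = V t * (2 * (real m * dl t) * (W t)\<^sup>2) + V' t * (W t)\<^sup>2" for t
  have dY: "(Y has_real_derivative Y' t) (at t within ?I)" if "t \<in> ?I" for t
    using DERIV_mult'[OF dV[OF that] power_gain_derivative[where a=W and n=2,
        OF power_gain_derivative[where n=m, OF a(1)[OF that], folded W_def]]]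
    unfolding Y_def Y'_def by simp
  have Y'le: "Y' t \<le> a t * (C - \<epsilon> * Y t)" if t: "t \<in> ?I" for t
  proof -
    have at: "0 < a t" by (rule a(2)[OF t])
    have v2': "v1 / (2 * v2) = v1 * lp / (4 * real m * Lp)"
      using lp Lp m by (simp add: v2 lp_def Lp_def field_simps)
    have dl': "dl t \<le> v1 * lp / (4 * real m * Lp) * a t" using dl(2)[OF t] by (simp add: v2')
    have c1: "2 * (real m * dl t) \<le> v1 / 2 * a t"
    proof -
      have "2 * (real m * dl t) \<le> 2 * (real m * (v1 * lp / (4 * real m * Lp) * a t))"
        using dl' by (intro mult_left_mono) auto
      also have "\<dots> = v1 / 2 * a t * (lp / Lp)" using m Lp by (simp add: field_simps)
      also have "\<dots> \<le> v1 / 2 * a t * 1" using lp Lp v1pos at by (intro mult_left_mono) auto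
      finally show ?thesis by simp
    qed
    have c2: "dl t * (2 * real (m - 1) * (Lp / lp)) \<le> (v1 / 2 - 2 * \<epsilon>) * a t"
    proof -
      have "dl t * (2 * real (m - 1) * (Lp / lp)) \<le> v1 * lp / (4 * real m * Lp) * a t * (2 * real (m - 1) * (Lp / lp))"
        using dl' m1 lp Lp by (intro mult_right_mono) auto
      also have "\<dots> = (v1 / 2 - 2 * \<epsilon>) * a t"
        using m lp Lp by (simp add: \<epsilon>_def of_nat_diff field_simps)
      finally show ?thesis .
    qed
    have V'eq: "V' t = a t * (2 * bil n Pf (e t) (ce t)) + dl t * (- (2 * bil n Pf (e t) (de t))) + 2 * bil n Pf (e t) (g t)"
      unfolding V'_def e'_def bil_add_right bil_scale_right by (simp add: algebra_simps)
    have "a t * (2 * bil n Pf (e t) (ce t)) \<le> a t * (- (v1 * V t))"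
      using b1 at by (intro mult_left_mono) auto
    moreover have "dl t * (- (2 * bil n Pf (e t) (de t))) \<le> dl t * (2 * real (m - 1) * (Lp / lp) * V t)"
      using b2 dl(1)[OF t] by (intro mult_left_mono) auto
    moreover have "dl t * (2 * real (m - 1) * (Lp / lp)) * V t \<le> (v1 / 2 - 2 * \<epsilon>) * a t * V t"
      using c2 V0 by (intro mult_right_mono) auto
    ultimately have "V' t \<le> a t * (- (v1 * V t)) + (v1 / 2 - 2 * \<epsilon>) * a t * V t + 2 * bil n Pf (e t) (g t)"
      unfolding V'eq by (simp add: mult.assoc)
    then have "V' t * (W t)\<^sup>2 \<le>
        (a t * (- (v1 * V t)) + (v1 / 2 - 2 * \<epsilon>) * a t * V t + 2 * bil n Pf (e t) (g t)) * (W t)\<^sup>2"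
      by (intro mult_right_mono) auto
    also have "\<dots> = (a t * (- v1) + (v1 / 2 - 2 * \<epsilon>) * a t) * Y t + (W t)\<^sup>2 * (2 * bil n Pf (e t) (g t))"
      by (simp add: Y_def algebra_simps)
    finally have 1: "V' t * (W t)\<^sup>2 \<le> (a t * (- v1) + (v1 / 2 - 2 * \<epsilon>) * a t) * Y t
        + (W t)\<^sup>2 * (2 * bil n Pf (e t) (g t))" .
    have 2: "(W t)\<^sup>2 * (2 * bil n Pf (e t) (g t)) \<le> \<epsilon> * a t * Y t + C * a t"
      using b3[OF t] by (simp add: C_def Y_def mult.commute)
    have "2 * (real m * dl t) * Y t \<le> v1 / 2 * a t * Y t"
      using c1 V0 by (intro mult_right_mono) (auto simp: Y_def)
    then have 3: "V t * (2 * (real m * dl t) * (W t)\<^sup>2) \<le> v1 / 2 * a t * Y t"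
      by (simp add: Y_def mult_ac)
    have "Y' t \<le> v1 / 2 * a t * Y t + ((a t * (- v1) + (v1 / 2 - 2 * \<epsilon>) * a t) * Y t + (\<epsilon> * a t * Y t + C * a t))"
      unfolding Y'_def using 1 2 3 by linarith
    also have "\<dots> = a t * (C - \<epsilon> * Y t)" by (simp add: algebra_simps)
    finally show ?thesis .
  qed
  define M where "M = max (Y t0) (C / \<epsilon>)"
  have YM: "Y t \<le> M" if t: "t \<in> ?I" for t
    unfolding M_def
  proof (rule barrier_bound[OF dY _ t])
    fix t assume t: "t \<in> ?I" and gt: "C / \<epsilon> < Y t"
    have "a t * (C - \<epsilon> * Y t) \<le> 0"
      using gt eps a(2)[OF t] by (intro mult_nonneg_nonpos) (auto simp: field_simps)
    then show "Y' t \<le> 0" using Y'le[OF t] by linarith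
  qed
  show ?thesis
  proof (intro exI[of _ "sqrt (M / lp)"] ballI)
    fix q t assume q: "q \<in> {1..m - 1}" and t: "t \<in> ?I"
    have "inner (E q t) (E q t) \<le> (\<Sum>q=1..m - 1. inner (E q t) (E q t))"
      by (rule member_le_sum) (use q in auto)
    also have "\<dots> = D t" unfolding D_def e_def n_def dot_flat ..
    finally have "lp * (norm (E q t))\<^sup>2 \<le> lp * D t" using lp by (simp add: power2_norm_eq_inner)
    also have "\<dots> \<le> V t" by (rule VD)
    finally have "lp * (norm (E q t))\<^sup>2 * (W t)\<^sup>2 \<le> V t * (W t)\<^sup>2" by (intro mult_right_mono) auto
    then have "(W t * norm (E q t))\<^sup>2 \<le> M / lp"
      using YM[OF t] lp by (simp add: Y_def field_simps)
    then show "a t ^ m * norm (E q t) \<le> sqrt (M / lp)"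
      unfolding W_def by (rule real_le_rsqrt)
  qed
qed

section \<open>Closure properties of bounded families\<close>

lemma bounded_const_image:
  fixes c :: "'b::real_normed_vector"
  shows "bounded ((\<lambda>_. c) ` I)"
  by (auto simp: bounded_iff)

lemma bounded_scaleR_image:
  fixes f :: "'a \<Rightarrow> 'b::real_normed_vector" and c :: "'a \<Rightarrow> real"
  assumes "bounded (c ` I)" "bounded (f ` I)"
  shows "bounded ((\<lambda>t. c t *\<^sub>R f t) ` I)"
proof -
  obtain C F where C: "\<And>t. t \<in> I \<Longrightarrow> \<bar>c t\<bar> \<le> C" and F: "\<And>t. t \<in> I \<Longrightarrow> norm (f t) \<le> F"
    using assms unfolding bounded_iff by auto
  have "norm (c t *\<^sub>R f t) \<le> C * F" if "t \<in> I" for t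
    using mult_mono[OF C[OF that] F[OF that]] C[OF that] by simp
  then show ?thesis unfolding bounded_iff by blast
qed

lemma bounded_sum_image:
  fixes f :: "'c \<Rightarrow> 'a \<Rightarrow> 'b::real_normed_vector"
  assumes "\<And>q. q \<in> A \<Longrightarrow> bounded (f q ` I)"
  shows "bounded ((\<lambda>t. \<Sum>q\<in>A. f q t) ` I)"
  using assms
proof (induction A rule: infinite_finite_induct)
  case (insert q A)
  then show ?case by (simp add: bounded_plus_comp)
qed (auto simp: bounded_const_image)

lemma bounded_power_image:
  fixes c :: "'a \<Rightarrow> real"
  assumes "bounded (c ` I)"
  shows "bounded ((\<lambda>t. c t ^ n) ` I)"
proof (induction n)
  case (Suc n)
  then show ?case using bounded_scaleR_image[OF assms Suc] by simp
qed (auto simp: bounded_const_image)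

section \<open>A single agent\<close>

text \<open>Logarithmic differentiation of \<open>DC2\<close>: the power contributes
  \<open>m\<close> times the rate of \<open>\<alpha>x\<close>. The integrand
  \<open>\<alpha>x \<tau> / \<tau>^2\<close> contributes \<open>c * \<alpha>x s\<close>, as
  \<open>\<delta>\<close> multiplies by \<open>s^2\<close>.\<close>

lemma delta_exponential_gain:
  assumes x: "class_K_inf \<alpha>x" "\<alpha>x differentiable_on {0..}"
    and as: "\<And>s. 0 \<le> s \<Longrightarrow> (\<lambda>\<tau>. inverse (\<tau>\<^sup>2) * \<alpha>x \<tau>) integrable_on {0..s} \<and>
      \<alpha>s s = \<alpha>x s ^ m * exp (c * integral {0..s} (\<lambda>\<tau>. inverse (\<tau>\<^sup>2) * \<alpha>x \<tau>))"
    and s: "0 < s"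
  shows "\<delta> \<alpha>s s = real m * \<delta> \<alpha>x s + c * \<alpha>x s"
proof -
  let ?F = "\<lambda>\<tau>. inverse (\<tau>\<^sup>2) * \<alpha>x \<tau>"
  have dx: "(\<alpha>x has_real_derivative deriv \<alpha>x s) (at s)" by (rule class_K_inf_deriv(1)[OF x s])
  have pos: "0 < \<alpha>x s" by (rule class_K_inf_pos[OF x(1) s])
  \<comment> \<open>Differentiating the integral uses continuity at \<open>s\<close> alone, because
    the integrand may be unbounded near 0. The interval reaches to \<open>s + 1\<close> so that
    \<open>s\<close> is interior.\<close>
  have "isCont ?F s" using s DERIV_isCont[OF dx] by (intro continuous_intros) auto
  then have "continuous (at s within {0..s + 1}) ?F" by (rule continuous_at_imp_continuous_at_within)
  then have "((\<lambda>u. integral {0..u} ?F) has_vector_derivative ?F s) (at s within {0..s + 1})"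
    using integral_has_vector_derivative_continuous_at[of ?F 0 "s + 1" s "{}"] as[of "s + 1"] s by simp
  moreover have "at s within {0..s + 1} = at s" using s by (intro at_within_interior) auto
  ultimately have dI: "((\<lambda>u. integral {0..u} ?F) has_real_derivative ?F s) (at s)"
    by (simp add: has_real_derivative_iff_has_vector_derivative)
  have "(\<alpha>x has_real_derivative (deriv \<alpha>x s / \<alpha>x s) * \<alpha>x s) (at s)" using dx pos by simp
  from power_gain_derivative[OF this, of m]
  have d1: "((\<lambda>s. \<alpha>x s ^ m) has_real_derivative (real m * (deriv \<alpha>x s / \<alpha>x s)) * \<alpha>x s ^ m) (at s)" .
  have d2: "((\<lambda>s. exp (c * integral {0..s} ?F)) has_real_derivative
      exp (c * integral {0..s} ?F) * (c * ?F s)) (at s)"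
    by (rule DERIV_chain2[OF DERIV_exp DERIV_cmult[OF dI]])
  let ?D = "(real m * (deriv \<alpha>x s / \<alpha>x s) + c * ?F s) * \<alpha>s s"
  have "((\<lambda>s. \<alpha>x s ^ m * exp (c * integral {0..s} ?F)) has_real_derivative ?D) (at s)"
    by (rule DERIV_cong[OF DERIV_mult'[OF d1 d2]]) (use as[of s] s in \<open>simp add: algebra_simps\<close>)
  then have "(\<alpha>s has_real_derivative ?D) (at s)"
    by (rule has_field_derivative_transform_within_open[where S="{0<..}"]) (use as s in auto)
  then have "deriv \<alpha>s s = ?D" by (rule DERIV_imp_deriv)
  moreover have "0 < \<alpha>s s" using as[of s] s pos by simp
  ultimately show ?thesis using s pos by (simp add: \<delta>_def field_simps)
qed

lemma exponential_gain_ge: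
  assumes x: "class_K_inf \<alpha>x"
    and as: "(\<lambda>\<tau>. inverse (\<tau>\<^sup>2) * \<alpha>x \<tau>) integrable_on {0..s}"
      "\<alpha>s = \<alpha>x s ^ m * exp (c * integral {0..s} (\<lambda>\<tau>. inverse (\<tau>\<^sup>2) * \<alpha>x \<tau>))"
    and s: "0 \<le> s" "0 \<le> c"
  shows "\<alpha>x s ^ m \<le> \<alpha>s"
proof -
  have "0 \<le> integral {0..s} (\<lambda>\<tau>. inverse (\<tau>\<^sup>2) * \<alpha>x \<tau>)"
    by (rule integral_nonneg[OF as(1)]) (auto intro!: mult_nonneg_nonneg class_K_inf_nonneg[OF x])
  then have "\<alpha>x s ^ m * 1 \<le> \<alpha>s"
    unfolding as(2) using s class_K_inf_nonneg[OF x s(1)]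
    by (intro mult_left_mono) auto
  then show ?thesis by simp
qed

text \<open>Decouples the agents: the network is felt only through a bounded reference
  \<open>w\<close> whose velocity is of order \<open>a^(-(m-1))\<close>. Each agent is then treated
  alone, with its own order and gains.\<close>

lemma agent_bounded:
  fixes w w' u :: "real \<Rightarrow> real^'n" and x :: "real \<Rightarrow> nat \<Rightarrow> real^'n" and P Q :: "real mat"
    and \<phi> :: "(nat \<Rightarrow> real^'n) \<Rightarrow> (nat \<Rightarrow> real) \<Rightarrow> real^'n"
  assumes a_def: "a = (\<lambda>t. \<alpha>x (\<mu> T t0 t))"
    and T: "0 < T" and b: "t0 < b" "b \<le> T + t0" and m: "2 \<le> m"
    and phi: "\<And>t. t \<in> {t0..<b} \<Longrightarrow> norm (\<phi> (x t) (d t)) \<le> H * \<psi> (x t)"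
    and psi: "bounded ((\<lambda>t. \<psi> (x t)) ` {t0..<b})"
    and v: "0 < v"
    and alpha_x: "class_K_inf \<alpha>x" "\<alpha>x differentiable_on {0..}"
    and alpha_s: "class_K_inf \<alpha>s" "\<alpha>s differentiable_on {0..}"
    and PQ: "pos_def ((m - 1) * CARD('n)) P" "pos_def ((m - 1) * CARD('n)) Q"
    and lyapunov: "P * kronecker (companion m k) (1\<^sub>m CARD('n))
        + kronecker (transpose_mat (companion m k)) (1\<^sub>m CARD('n)) * P = - Q"
    and v1: "v1 = lambda_min Q / lambda_max P" "0 < v1"
    and v2: "v2 = 2 * real m * lambda_max P / lambda_min P"
    and DC1: "\<And>t. t \<in> {t0..<b} \<Longrightarrow> \<delta> \<alpha>x (\<mu> T t0 t) \<le> v1 / (2 * v2) * a t"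
    and DC2: "\<And>s. 0 \<le> s \<Longrightarrow> (\<lambda>\<tau>. inverse (\<tau>\<^sup>2) * \<alpha>x \<tau>) integrable_on {0..s} \<and>
      \<alpha>s s = \<alpha>x s ^ m * exp (v1 / 2 * integral {0..s} (\<lambda>\<tau>. inverse (\<tau>\<^sup>2) * \<alpha>x \<tau>))"
    and chain: "chain_trajectory m \<phi> {t0..<b} d u x"
    and control: "\<And>t. t \<in> {t0..<b} \<Longrightarrow> u t = controller m k \<alpha>x \<alpha>s v \<psi> (\<mu> T t0 t) (w t) (x t)"
    and dw: "\<And>t. t \<in> {t0..<b} \<Longrightarrow> (w has_vector_derivative w' t) (at t within {t0..<b})"
    and w_bdd: "bounded (w ` {t0..<b})"
    and w'_bdd: "\<And>t. t \<in> {t0..<b} \<Longrightarrow> a t ^ (m - 1) * norm (w' t) \<le> R"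
  shows "\<exists>M. \<forall>t\<in>{t0..<b}. stacked_norm m (x t) \<le> M"
    "bounded (u ` {t0..<b})"
    "\<exists>M. \<forall>t\<in>{t0..<b}. a t ^ m * norm (x t 1 - w t) \<le> M"
proof -
  let ?I = "{t0..<b}"
  have mu: "0 < \<mu> T t0 t" "1 / T \<le> \<mu> T t0 t" if "t \<in> ?I" for t
    using mu_ge[OF T, of t0 t] that b by auto
  have k1: "k 1 \<noteq> 0" by (rule lyapunov_gain_nonzero[OF m PQ lyapunov])
  define dl where "dl t = \<delta> \<alpha>x (\<mu> T t0 t)" for t
  define ds where "ds t = \<delta> \<alpha>s (\<mu> T t0 t)" for t
  define sg where "sg t = \<alpha>s (\<mu> T t0 t)" for t
  have da: "(a has_real_derivative dl t * a t) (at t within ?I)" "0 \<le> dl t" if "t \<in> ?I" for t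
    unfolding a_def dl_def using gain_derivative[OF alpha_x T] that b by auto
  have dsg: "(sg has_real_derivative ds t * sg t) (at t within ?I)" "0 \<le> ds t" if "t \<in> ?I" for t
    unfolding sg_def[abs_def] ds_def using gain_derivative[OF alpha_s T] that b by auto
  have apos: "0 < a t" if "t \<in> ?I" for t unfolding a_def by (rule class_K_inf_pos[OF alpha_x(1) mu(1)[OF that]])
  have sgpos: "0 < sg t" if "t \<in> ?I" for t unfolding sg_def by (rule class_K_inf_pos[OF alpha_s(1) mu(1)[OF that]])
  have ds_eq: "ds t = real m * dl t + v1 / 2 * a t" if "t \<in> ?I" for t
    unfolding ds_def dl_def a_def by (rule delta_exponential_gain[OF alpha_x DC2 mu(1)[OF that]])
  have sg_ge: "a t ^ m \<le> sg t" if "t \<in> ?I" for t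
    unfolding a_def sg_def
    by (rule exponential_gain_ge[OF alpha_x(1) conjunct1[OF DC2] conjunct2[OF DC2]]) (use mu[OF that] v1(2) in auto)
  define c where "c = v1 / (2 * v2)"
  have dl_le: "dl t \<le> c * a t" if "t \<in> ?I" for t using DC1[OF that] by (simp add: dl_def c_def)
  define E where "E q t = inverse (a t ^ (q - 1)) *\<^sub>R e_s (w t) (x t) q" for q t
  define St where "St t = s_tilde m k \<alpha>x (\<mu> T t0 t) (w t) (x t)" for t
  define B where "B t = B_gain m k \<alpha>x (\<mu> T t0 t)" for t
  define xd where "xd q t = (if q < m then x t (Suc q) else u t + \<phi> (x t) (d t))" for q t
  define wd where "wd q t = (if q = 1 then w' t else 0)" for q :: nat and t
  have B_eq: "B t = inverse (k 1) * inverse (a t ^ (m - 1))" for t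
    by (simp add: B_def B_gain_def a_def)
  have m_split: "{1..m} = insert m {1..m - 1}" "m \<notin> {1..m - 1}" using m by auto
  have St_eq: "k 1 *\<^sub>R St t = (\<Sum>q=1..m - 1. k q *\<^sub>R E q t) + E m t" for t
  proof -
    have "k 1 *\<^sub>R St t = (\<Sum>q=1..m. (K_tilde m k q * inverse (a t ^ (q - 1))) *\<^sub>R e_s (w t) (x t) q)"
      using k1 by (simp add: St_def s_tilde_def a_def)
    also have "\<dots> = (\<Sum>q=1..m. K_tilde m k q *\<^sub>R E q t)" by (simp add: E_def)
    also have "\<dots> = (\<Sum>q=1..m - 1. K_tilde m k q *\<^sub>R E q t) + E m t"
      unfolding m_split(1) using m_split(2) by (simp add: K_tilde_def add.commute)
    also have "(\<Sum>q=1..m - 1. K_tilde m k q *\<^sub>R E q t) = (\<Sum>q=1..m - 1. k q *\<^sub>R E q t)"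
      by (intro sum.cong refl) (auto simp: K_tilde_def)
    finally show ?thesis .
  qed
  have dx: "((\<lambda>t. x t q) has_vector_derivative xd q t) (at t within ?I)" if "q \<in> {1..m}" "t \<in> ?I" for q t
  proof (cases "q < m")
    case True
    then have "q \<in> {1..m - 1}" using that by auto
    then show ?thesis using chain that(2) True unfolding chain_trajectory_def xd_def by auto
  next
    case False
    then have "q = m" using that by auto
    then show ?thesis using chain that(2) unfolding chain_trajectory_def xd_def by auto
  qed
  have de_s: "((\<lambda>t. e_s (w t) (x t) q) has_vector_derivative xd q t - wd q t) (at t within ?I)"
    if "q \<in> {1..m}" "t \<in> ?I" for q t
    using dx[OF that] has_vector_derivative_diff[OF dx[OF that] dw[OF that(2)]]
    by (auto simp: e_s_def wd_def)
  have dE: "(E q has_vector_derivative inverse (a t ^ (q - 1)) *\<^sub>R (xd q t - wd q t)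
      - (real (q - 1) * dl t) *\<^sub>R E q t) (at t within ?I)" if "q \<in> {1..m}" "t \<in> ?I" for q t
  proof -
    have pw: "a t ^ (q - 1) \<noteq> 0" using apos[OF that(2)] by simp
    have "((\<lambda>t. inverse (a t ^ (q - 1))) has_real_derivative
        - ((real (q - 1) * dl t) * inverse (a t ^ (q - 1)))) (at t within ?I)"
    proof (rule DERIV_cong[OF DERIV_inverse_fun[OF power_gain_derivative[OF da(1)[OF that(2)]] pw]])
      have "- (r * p * inverse (p ^ Suc (Suc 0))) = - (r * inverse p)" if "p \<noteq> 0" for p r :: real
        using that by simp
      from this[OF pw] show "- ((real (q - 1) * dl t) * a t ^ (q - 1) * inverse ((a t ^ (q - 1)) ^ Suc (Suc 0))) =
          - ((real (q - 1) * dl t) * inverse (a t ^ (q - 1)))" .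
    qed
    from has_vector_derivative_scaleR[OF this de_s[OF that]]
    show ?thesis unfolding E_def[abs_def] by (simp add: algebra_simps)
  qed
  \<comment> \<open>Solving the definition of the sliding variable for \<open>E m\<close> closes the
    system on the blocks \<open>1..m - 1\<close>; the price is the forcing \<open>a k 1 St\<close>
    in the last of them. The reference velocity forces the first block. For \<open>m = 2\<close>
    both fall into the same block.\<close>
  define G where "G q t = (if q = m - 1 then (a t * k 1) *\<^sub>R St t else 0) - wd q t" for q t
  have dE': "(E q has_vector_derivative a t *\<^sub>R companion_map m k (\<lambda>q. E q t) q
      - (real (q - 1) * dl t) *\<^sub>R E q t + G q t) (at t within ?I)" if "q \<in> {1..m - 1}" "t \<in> ?I" for q t
  proof -
    have qm: "q \<in> {1..m}" "q < m" using that by auto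
    have at: "a t \<noteq> 0" using apos[OF that(2)] by simp
    have 1: "inverse (a t ^ (q - 1)) *\<^sub>R xd q t = a t *\<^sub>R E (Suc q) t"
    proof -
      have "a t * inverse (a t ^ q) = inverse (a t ^ (q - 1))"
        using at qm by (cases q) (auto simp: field_simps)
      then show ?thesis using qm by (simp add: xd_def E_def e_s_def)
    qed
    have 2: "inverse (a t ^ (q - 1)) *\<^sub>R wd q t = wd q t" by (simp add: wd_def)
    have 3: "a t *\<^sub>R E (Suc q) t = a t *\<^sub>R companion_map m k (\<lambda>q. E q t) q
        + (if q = m - 1 then (a t * k 1) *\<^sub>R St t else 0)"
    proof (cases "q = m - 1")
      case True
      then have "Suc q = m" using m by simp
      moreover have "E m t = k 1 *\<^sub>R St t - (\<Sum>q=1..m - 1. k q *\<^sub>R E q t)" using St_eq[of t] by simp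
      ultimately show ?thesis using True by (simp add: companion_map_def scaleR_diff_right)
    next
      case False
      then show ?thesis using that by (simp add: companion_map_def)
    qed
    have "inverse (a t ^ (q - 1)) *\<^sub>R (xd q t - wd q t) = a t *\<^sub>R companion_map m k (\<lambda>q. E q t) q + G q t"
      unfolding scaleR_diff_right 1 2 3 G_def by (rule add_diff_eq[symmetric])
    with dE[OF qm(1) that(2)] show ?thesis by (simp add: algebra_simps)
  qed
  define r1 where "r1 t = (\<Sum>q=1..m - 1. k q *\<^sub>R r1_dot \<alpha>x (\<mu> T t0 t) (x t) q)" for t
  have pi_eq: "\<pi>_term m k \<alpha>x (\<mu> T t0 t) (x t) = (a t ^ (m - 1)) *\<^sub>R r1 t - (real (m - 1) * dl t) *\<^sub>R x t m" for t
    by (simp add: \<pi>_term_def r1_def a_def dl_def)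
  have x_E: "E q t = inverse (a t ^ (q - 1)) *\<^sub>R x t q" if "2 \<le> q" for q t
    using that by (simp add: E_def e_s_def)
  have r1_dot_E: "r1_dot \<alpha>x (\<mu> T t0 t) (x t) q = a t *\<^sub>R E (Suc q) t - (real (q - 1) * dl t) *\<^sub>R E q t"
    if "q \<in> {1..m - 1}" "t \<in> ?I" for q t
  proof -
    have at: "a t \<noteq> 0" using apos[OF that(2)] by simp
    have 1: "a t * inverse (a t ^ q) = inverse (a t ^ (q - 1))"
      using at that by (cases q) (auto simp: field_simps)
    \<comment> \<open>\<open>E 1\<close> contains the reference while \<open>r1_dot\<close> does
      not. The discrepancy is harmless because its coefficient \<open>q - 1\<close> is zero at
      \<open>q = 1\<close>.\<close>
    have 2: "real (q - 1) *\<^sub>R (inverse (a t ^ (q - 1)) *\<^sub>R x t q) = real (q - 1) *\<^sub>R E q t"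
      using x_E[of q t] that by (cases "2 \<le> q") auto
    have "r1_dot \<alpha>x (\<mu> T t0 t) (x t) q =
        inverse (a t ^ (q - 1)) *\<^sub>R x t (Suc q) - dl t *\<^sub>R (real (q - 1) *\<^sub>R (inverse (a t ^ (q - 1)) *\<^sub>R x t q))"
      by (simp add: r1_dot_def a_def dl_def scaleR_diff_right mult_ac)
    also have "inverse (a t ^ (q - 1)) *\<^sub>R x t (Suc q) = a t *\<^sub>R E (Suc q) t"
      using x_E[of "Suc q" t] that 1 by simp
    finally show ?thesis unfolding 2 by (simp add: mult.commute)
  qed
  have dSt: "(St has_vector_derivative B t *\<^sub>R (\<pi>_term m k \<alpha>x (\<mu> T t0 t) (x t) + u t + \<phi> (x t) (d t)) - w' t) (at t within ?I)"
    if t: "t \<in> ?I" for t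
  proof -
    have at: "a t \<noteq> 0" using apos[OF t] by simp
    let ?E' = "\<lambda>q. inverse (a t ^ (q - 1)) *\<^sub>R (xd q t - wd q t) - (real (q - 1) * dl t) *\<^sub>R E q t"
    have d: "((\<lambda>t. inverse (k 1) *\<^sub>R ((\<Sum>q=1..m - 1. k q *\<^sub>R E q t) + E m t)) has_vector_derivative
        inverse (k 1) *\<^sub>R ((\<Sum>q=1..m - 1. k q *\<^sub>R ?E' q) + ?E' m)) (at t within ?I)"
      using m by (intro has_vector_derivative_scaleR_const has_vector_derivative_add has_vector_derivative_sum dE t) auto
    have f: "(\<lambda>t. inverse (k 1) *\<^sub>R ((\<Sum>q=1..m - 1. k q *\<^sub>R E q t) + E m t)) = St"
      unfolding St_eq[symmetric] using k1 by simp
    have s: "(\<Sum>q=1..m - 1. k q *\<^sub>R ?E' q) = r1 t - k 1 *\<^sub>R w' t"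
    proof -
      have "(\<Sum>q=1..m - 1. k q *\<^sub>R ?E' q) = (\<Sum>q=1..m - 1. k q *\<^sub>R r1_dot \<alpha>x (\<mu> T t0 t) (x t) q - (if q = 1 then k 1 *\<^sub>R w' t else 0))"
      proof (intro sum.cong refl)
        fix q assume q: "q \<in> {1..m - 1}"
        then have "q < m" by auto
        have "inverse (a t ^ (q - 1)) *\<^sub>R xd q t = a t *\<^sub>R E (Suc q) t"
        proof -
          have "a t * inverse (a t ^ q) = inverse (a t ^ (q - 1))"
            using at q by (cases q) (auto simp: field_simps)
          then show ?thesis using q \<open>q < m\<close> by (simp add: xd_def E_def e_s_def)
        qed
        then have "?E' q = r1_dot \<alpha>x (\<mu> T t0 t) (x t) q - wd q t"
          unfolding r1_dot_E[OF q t] by (simp add: scaleR_diff_right wd_def)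
        then show "k q *\<^sub>R ?E' q = k q *\<^sub>R r1_dot \<alpha>x (\<mu> T t0 t) (x t) q - (if q = 1 then k 1 *\<^sub>R w' t else 0)"
          by (simp add: wd_def scaleR_diff_right)
      qed
      also have "\<dots> = r1 t - k 1 *\<^sub>R w' t"
        using m by (simp add: sum_subtractf r1_def sum.delta)
      finally show ?thesis .
    qed
    have e: "?E' m = inverse (a t ^ (m - 1)) *\<^sub>R (u t + \<phi> (x t) (d t)) - (real (m - 1) * dl t) *\<^sub>R E m t"
      using m by (simp add: xd_def wd_def)
    have c: "inverse (k 1) *\<^sub>R (r1 t - k 1 *\<^sub>R w' t +
        (inverse (a t ^ (m - 1)) *\<^sub>R (u t + \<phi> (x t) (d t)) - (real (m - 1) * dl t) *\<^sub>R E m t)) =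
        B t *\<^sub>R (\<pi>_term m k \<alpha>x (\<mu> T t0 t) (x t) + u t + \<phi> (x t) (d t)) - w' t"
    proof -
      have "inverse \<gamma> *\<^sub>R (y1 - \<gamma> *\<^sub>R y2 + (inverse A *\<^sub>R (y3 + y4) - l *\<^sub>R (inverse A *\<^sub>R y5))) =
          (inverse \<gamma> * inverse A) *\<^sub>R ((A *\<^sub>R y1 - l *\<^sub>R y5) + y3 + y4) - y2"
        if "\<gamma> \<noteq> 0" "A \<noteq> 0" for \<gamma> A l :: real and y1 y2 y3 y4 y5 :: "real^'n"
      proof -
        have h1: "(inverse \<gamma> * inverse A) *\<^sub>R (A *\<^sub>R y1) = inverse \<gamma> *\<^sub>R y1" using that by simp
        have h2: "inverse \<gamma> *\<^sub>R (\<gamma> *\<^sub>R y2) = y2" using that by simp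
        have h3: "inverse \<gamma> *\<^sub>R (l *\<^sub>R (inverse A *\<^sub>R y5)) = (inverse \<gamma> * inverse A) *\<^sub>R (l *\<^sub>R y5)"
          by (simp add: mult_ac)
        have h4: "inverse \<gamma> *\<^sub>R (inverse A *\<^sub>R y) = (inverse \<gamma> * inverse A) *\<^sub>R y" for y :: "real^'n"
          by simp
        show ?thesis unfolding scaleR_diff_right scaleR_add_right h1 h2 h3 h4 by (simp only: algebra_simps)
      qed
      from this[OF k1, of "a t ^ (m - 1)"] show ?thesis unfolding pi_eq B_eq x_E[OF m, of t] using at by simp
    qed
    from d show ?thesis unfolding f s e c .
  qed
  define et where "et t = sg t *\<^sub>R St t" for t
  define \<beta> where "\<beta> t = sg t * \<bar>B t\<bar>" for t
  have u_eq: "u t = - (((v + (\<psi> (x t))\<^sup>2 + 1) * sgn (k 1)) *\<^sub>R et t) - \<pi>_term m k \<alpha>x (\<mu> T t0 t) (x t)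
      - (inverse (B t) * ds t) *\<^sub>R St t" if "t \<in> ?I" for t
    using control[OF that] by (simp add: controller_def et_def sg_def St_def B_def ds_def)
  have Bnz: "B t \<noteq> 0" if "t \<in> ?I" for t using k1 apos[OF that] by (simp add: B_eq)
  \<comment> \<open>The input acts through \<open>B\<close>, whose sign is that of
    \<open>k 1\<close>. The factor \<open>sgn (k 1)\<close> in the controller ensures damping in
    either case.\<close>
  have Bsgn: "B t * sgn (k 1) = \<bar>B t\<bar>" if "t \<in> ?I" for t
    using apos[OF that] k1 by (auto simp: B_eq abs_mult sgn_if)
  \<comment> \<open>In the controller \<open>\<pi>_term\<close> removes the known dynamics of the
    chain, and the \<open>\<delta>\<close> term cancels the growth of \<open>sg\<close>. Damping,
    disturbance and reference velocity remain.\<close>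
  have det: "(et has_vector_derivative - ((\<beta> t * (v + (\<psi> (x t))\<^sup>2 + 1)) *\<^sub>R et t)
      + sg t *\<^sub>R (B t *\<^sub>R \<phi> (x t) (d t) - w' t)) (at t within ?I)" if t: "t \<in> ?I" for t
  proof -
    have 1: "B t *\<^sub>R (\<pi>_term m k \<alpha>x (\<mu> T t0 t) (x t) + u t + \<phi> (x t) (d t)) =
        - ((\<bar>B t\<bar> * (v + (\<psi> (x t))\<^sup>2 + 1)) *\<^sub>R et t) - ds t *\<^sub>R St t + B t *\<^sub>R \<phi> (x t) (d t)"
    proof -
      have h1: "B t *\<^sub>R ((inverse (B t) * ds t) *\<^sub>R St t) = ds t *\<^sub>R St t" using Bnz[OF t] by simp
      have h2: "B t *\<^sub>R (((v + (\<psi> (x t))\<^sup>2 + 1) * sgn (k 1)) *\<^sub>R et t) = (\<bar>B t\<bar> * (v + (\<psi> (x t))\<^sup>2 + 1)) *\<^sub>R et t"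
        unfolding Bsgn[OF t, symmetric] by (simp add: mult_ac)
      have "\<pi>_term m k \<alpha>x (\<mu> T t0 t) (x t) + u t + \<phi> (x t) (d t) =
          - (((v + (\<psi> (x t))\<^sup>2 + 1) * sgn (k 1)) *\<^sub>R et t) - (inverse (B t) * ds t) *\<^sub>R St t + \<phi> (x t) (d t)"
        unfolding u_eq[OF t] by simp
      then show ?thesis
        by (simp only: scaleR_add_right scaleR_diff_right scaleR_minus_right h1 h2)
    qed
    show ?thesis
      using has_vector_derivative_scaleR[OF dsg(1)[OF t] dSt[OF t]]
      unfolding et_def[abs_def, symmetric] 1
      by (simp add: \<beta>_def et_def algebra_simps)
  qed
  have et_bdd: "inner (et t) (et t) \<le> max (inner (et t0) (et t0)) ((H\<^sup>2 + (\<bar>k 1\<bar> * R)\<^sup>2) / (4 * v))"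
    if "t \<in> ?I" for t
  proof (rule sliding_variable_bound[where \<beta>=\<beta> and \<psi>="\<lambda>t. \<psi> (x t)", OF det _ _ v that])
    fix t assume t: "t \<in> ?I"
    show "0 \<le> \<beta> t" using sgpos[OF t] by (simp add: \<beta>_def)
    have at: "0 < a t ^ (m - 1)" using apos[OF t] by simp
    have "norm (B t *\<^sub>R \<phi> (x t) (d t) - w' t) \<le> \<bar>B t\<bar> * norm (\<phi> (x t) (d t)) + norm (w' t)"
      using norm_triangle_ineq4[of "B t *\<^sub>R \<phi> (x t) (d t)" "w' t"] by simp
    \<comment> \<open>Factoring out \<open>B\<close> puts the reference velocity on the same footing
      as the disturbance; the remaining factor is bounded by \<open>R\<close>.\<close>
    also have "norm (w' t) = \<bar>B t\<bar> * (\<bar>k 1\<bar> * (a t ^ (m - 1) * norm (w' t)))"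
      using at k1 apos[OF t] by (simp add: B_eq abs_mult field_simps)
    also have "\<bar>B t\<bar> * norm (\<phi> (x t) (d t)) + \<bar>B t\<bar> * (\<bar>k 1\<bar> * (a t ^ (m - 1) * norm (w' t)))
        \<le> \<bar>B t\<bar> * (H * \<psi> (x t)) + \<bar>B t\<bar> * (\<bar>k 1\<bar> * R)"
      by (intro add_mono mult_left_mono phi[OF t] w'_bdd[OF t]) auto
    finally have "sg t * norm (B t *\<^sub>R \<phi> (x t) (d t) - w' t) \<le> sg t * (\<bar>B t\<bar> * (H * \<psi> (x t)) + \<bar>B t\<bar> * (\<bar>k 1\<bar> * R))"
      using sgpos[OF t] by (intro mult_left_mono) auto
    moreover have "norm (sg t *\<^sub>R (B t *\<^sub>R \<phi> (x t) (d t) - w' t)) = sg t * norm (B t *\<^sub>R \<phi> (x t) (d t) - w' t)"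
      using sgpos[OF t] by simp
    ultimately show "norm (sg t *\<^sub>R (B t *\<^sub>R \<phi> (x t) (d t) - w' t)) \<le> \<beta> t * (H * \<psi> (x t) + \<bar>k 1\<bar> * R)"
      by (simp only: \<beta>_def distrib_left mult.assoc)
  qed
  define Me where "Me = sqrt (max (inner (et t0) (et t0)) ((H\<^sup>2 + (\<bar>k 1\<bar> * R)\<^sup>2) / (4 * v)))"
  have et_norm: "norm (et t) \<le> Me" if "t \<in> ?I" for t
    unfolding Me_def norm_eq_sqrt_inner using et_bdd[OF that] by (rule real_sqrt_le_mono)
  have aSt: "a t ^ m * norm (St t) \<le> Me" if "t \<in> ?I" for t
  proof -
    have "a t ^ m * norm (St t) \<le> sg t * norm (St t)" by (intro mult_right_mono sg_ge that) auto
    also have "\<dots> = norm (et t)" using sgpos[OF that] by (simp add: et_def)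
    finally show ?thesis using et_norm[OF that] by linarith
  qed
  have "\<exists>M. \<forall>q\<in>{1..m - 1}. \<forall>t\<in>?I. a t ^ m * norm (E q t) \<le> M"
  proof (rule chain_error_bound[OF m PQ lyapunov v1(1) v2 dE' da(1) apos da(2)])
    show "dl t \<le> v1 / (2 * v2) * a t" if "t \<in> ?I" for t using dl_le[OF that] by (simp add: c_def)
    fix q t assume q: "q \<in> {1..m - 1}" and t: "t \<in> ?I"
    have at: "0 < a t" by (rule apos[OF t])
    have R: "0 \<le> R" using w'_bdd[OF t] at by (meson mult_nonneg_nonneg norm_ge_zero order_trans zero_le_power less_imp_le)
    have Me0: "0 \<le> Me" using et_norm[OF t] norm_ge_zero order_trans by blast
    have "norm (G q t) \<le> a t * \<bar>k 1\<bar> * norm (St t) + norm (w' t)"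
      unfolding G_def wd_def using norm_triangle_ineq4[of "(a t * k 1) *\<^sub>R St t" "w' t"] at
      by (auto simp: abs_mult)
    then have "a t ^ m * norm (G q t) \<le> a t ^ m * (a t * \<bar>k 1\<bar> * norm (St t) + norm (w' t))"
      using at by (intro mult_left_mono) auto
    also have "\<dots> = a t * \<bar>k 1\<bar> * (a t ^ m * norm (St t)) + a t * (a t ^ (m - 1) * norm (w' t))"
      using m by (cases m) (auto simp: algebra_simps)
    also have "\<dots> \<le> a t * \<bar>k 1\<bar> * Me + a t * R"
      using at by (intro add_mono mult_left_mono aSt w'_bdd t) auto
    finally show "a t ^ m * norm (G q t) \<le> (\<bar>k 1\<bar> * Me + R) * a t" by (simp add: algebra_simps)
  qed
  then obtain M where M: "\<And>q t. q \<in> {1..m - 1} \<Longrightarrow> t \<in> ?I \<Longrightarrow> a t ^ m * norm (E q t) \<le> M" by blast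
  have "E 1 t = x t 1 - w t" for t by (simp add: E_def e_s_def)
  then show "\<exists>M. \<forall>t\<in>?I. a t ^ m * norm (x t 1 - w t) \<le> M"
    using M[of 1] m by fastforce
  have an: "norm (a t ^ m *\<^sub>R X) = a t ^ m * norm X" if "t \<in> ?I" for t and X :: "real^'n"
    using apos[OF that] by simp
  have bSt: "bounded ((\<lambda>t. a t ^ m *\<^sub>R St t) ` ?I)"
  proof -
    have "norm (a t ^ m *\<^sub>R St t) \<le> Me" if "t \<in> ?I" for t
      using an[OF that] aSt[OF that] by (simp only:)
    then show ?thesis unfolding bounded_iff by blast
  qed
  have bE1: "bounded ((\<lambda>t. a t ^ m *\<^sub>R E q t) ` ?I)" if "q \<in> {1..m - 1}" for q
  proof -
    have "norm (a t ^ m *\<^sub>R E q t) \<le> M" if "t \<in> ?I" for t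
      using an[OF that] M[OF \<open>q \<in> {1..m - 1}\<close> that] by (simp only:)
    then show ?thesis unfolding bounded_iff by blast
  qed
  have bEm: "bounded ((\<lambda>t. a t ^ m *\<^sub>R E m t) ` ?I)"
  proof -
    have em: "a t ^ m *\<^sub>R E m t = k 1 *\<^sub>R (a t ^ m *\<^sub>R St t) - (\<Sum>q=1..m - 1. k q *\<^sub>R (a t ^ m *\<^sub>R E q t))" for t
    proof -
      have "E m t = k 1 *\<^sub>R St t - (\<Sum>q=1..m - 1. k q *\<^sub>R E q t)" using St_eq[of t] by simp
      then show ?thesis by (simp add: scaleR_diff_right scaleR_sum_right mult.commute)
    qed
    show ?thesis
      unfolding em by (intro bounded_minus_comp bounded_sum_image bounded_scaleR_image bounded_const_image bSt bE1)
  qed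
  have bE: "bounded ((\<lambda>t. a t ^ m *\<^sub>R E q t) ` ?I)" if "q \<in> {1..m}" for q
    using bE1[of q] bEm that by (cases "q = m") auto
  have binv: "bounded ((\<lambda>t. inverse (a t)) ` ?I)"
  proof -
    have "norm (inverse (a t)) \<le> inverse (\<alpha>x (1 / T))" if t: "t \<in> ?I" for t
    proof -
      have "0 < \<alpha>x (1 / T)" using T by (intro class_K_inf_pos[OF alpha_x(1)]) auto
      moreover have "\<alpha>x (1 / T) \<le> a t"
        unfolding a_def using T by (intro class_K_inf_mono[OF alpha_x(1)] mu[OF t]) auto
      ultimately show ?thesis using apos[OF t] by (simp add: le_imp_inverse_le)
    qed
    then show ?thesis unfolding bounded_iff by blast
  qed
  have bdl: "bounded ((\<lambda>t. dl t * inverse (a t)) ` ?I)"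
  proof -
    have "norm (dl t * inverse (a t)) \<le> c" if t: "t \<in> ?I" for t
      using da(2)[OF t] dl_le[OF t] apos[OF t] by (simp add: field_simps)
    then show ?thesis unfolding bounded_iff by blast
  qed
  have bx: "bounded ((\<lambda>t. x t q) ` ?I)" if q: "q \<in> {1..m}" for q
  proof -
    \<comment> \<open>Block \<open>q\<close> of \<open>e_s\<close> is \<open>a^(q-1)\<close> times
      \<open>E q\<close>, so \<open>a^(m-q+1)\<close> times it is bounded. The exponent is positive
      and \<open>a\<close> is bounded below by its value at \<open>1 / T\<close>, so the power can
      be divided out.\<close>
    have id: "inverse (a t) ^ (m - (q - 1)) *\<^sub>R (a t ^ m *\<^sub>R E q t) = e_s (w t) (x t) q" if t: "t \<in> ?I" for t
    proof -
      have "a t ^ m = a t ^ (m - (q - 1)) * a t ^ (q - 1)"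
        using q by (subst power_add[symmetric]) (auto intro: arg_cong[where f="power (a t)"])
      moreover have "inverse X * (X * Y * inverse Y) = 1" if "X \<noteq> 0" "Y \<noteq> 0" for X Y :: real
        using that by (simp add: field_simps)
      ultimately have "inverse (a t) ^ (m - (q - 1)) * (a t ^ m * inverse (a t ^ (q - 1))) = 1"
        using apos[OF t] by (metis power_inverse power_not_zero less_numeral_extra(3))
      then show ?thesis by (simp only: E_def scaleR_scaleR mult.assoc scaleR_one)
    qed
    have "bounded ((\<lambda>t. inverse (a t) ^ (m - (q - 1)) *\<^sub>R (a t ^ m *\<^sub>R E q t)) ` ?I)"
      by (intro bounded_scaleR_image bounded_power_image binv bE q)
    moreover have "(\<lambda>t. inverse (a t) ^ (m - (q - 1)) *\<^sub>R (a t ^ m *\<^sub>R E q t)) ` ?I = (\<lambda>t. e_s (w t) (x t) q) ` ?I"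
      by (intro image_cong refl id)
    ultimately have es: "bounded ((\<lambda>t. e_s (w t) (x t) q) ` ?I)" by (simp only:)
    show ?thesis
    proof (cases "q = 1")
      case True
      then have "bounded ((\<lambda>t. e_s (w t) (x t) q + w t) ` ?I)" by (intro bounded_plus_comp es w_bdd)
      then show ?thesis using True by (simp add: e_s_def)
    next
      case False
      then show ?thesis using es by (simp add: e_s_def)
    qed
  qed
  show "\<exists>M. \<forall>t\<in>?I. stacked_norm m (x t) \<le> M"
  proof -
    have "bounded ((\<lambda>t. \<Sum>q=1..m. norm (x t q)) ` ?I)"
      by (intro bounded_sum_image) (use bx in \<open>simp add: bounded_iff\<close>)
    then obtain M where "\<forall>y\<in>(\<lambda>t. \<Sum>q=1..m. norm (x t q)) ` ?I. norm y \<le> M"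
      unfolding bounded_iff by blast
    then have M: "norm (\<Sum>q=1..m. norm (x t q)) \<le> M" if "t \<in> ?I" for t using that by blast
    have "stacked_norm m (x t) \<le> M" if "t \<in> ?I" for t
    proof -
      have "stacked_norm m (x t) \<le> (\<Sum>q=1..m. norm (x t q))"
        unfolding stacked_norm_def using L2_set_le_sum[of "{1..m}" "\<lambda>q. norm (x t q)"] by (simp add: L2_set_def)
      then show ?thesis using M[OF that] by simp
    qed
    then show ?thesis by blast
  qed
  show "bounded (u ` ?I)"
  proof -
    have bet: "bounded (et ` ?I)" unfolding bounded_iff using et_norm by blast
    \<comment> \<open>The input rewritten so that every power of \<open>a\<close> is attached to an
      error as \<open>a^m\<close>, leaving coefficients built from the bounded ratio
      \<open>dl / a\<close>. This is possible since \<open>dl\<close> and \<open>ds\<close> are at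
      most of order \<open>a\<close>.\<close>
    define U where "U t = - (((v + (\<psi> (x t))\<^sup>2 + 1) * sgn (k 1)) *\<^sub>R et t)
      - ((\<Sum>q=1..m - 1. k q *\<^sub>R (a t ^ m *\<^sub>R E (Suc q) t - (real (q - 1) * (dl t * inverse (a t))) *\<^sub>R (a t ^ m *\<^sub>R E q t)))
        - (real (m - 1) * (dl t * inverse (a t))) *\<^sub>R (a t ^ m *\<^sub>R E m t))
      - (k 1 * (real m * (dl t * inverse (a t)) + v1 / 2)) *\<^sub>R (a t ^ m *\<^sub>R St t)" for t
    have uU: "u t = U t" if t: "t \<in> ?I" for t
    proof -
      have at: "a t \<noteq> 0" using apos[OF t] by simp
      have am: "a t ^ m = a t ^ (m - 1) * a t" using m by (cases m) auto
      have am': "inverse (a t) * a t ^ m = a t ^ (m - 1)" using at by (simp add: am)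
      have 1: "(a t ^ (m - 1)) *\<^sub>R r1 t = (\<Sum>q=1..m - 1. k q *\<^sub>R (a t ^ m *\<^sub>R E (Suc q) t
          - (real (q - 1) * (dl t * inverse (a t))) *\<^sub>R (a t ^ m *\<^sub>R E q t)))"
        unfolding r1_def scaleR_sum_right
      proof (intro sum.cong refl)
        fix q assume q: "q \<in> {1..m - 1}"
        have "p *\<^sub>R (\<kappa> *\<^sub>R (\<gamma> *\<^sub>R X - (c * l) *\<^sub>R Y)) =
            \<kappa> *\<^sub>R ((p * \<gamma>) *\<^sub>R X - (c * (l * inverse \<gamma>)) *\<^sub>R ((p * \<gamma>) *\<^sub>R Y))"
          if "\<gamma> \<noteq> 0" for p \<kappa> \<gamma> c l :: real and X Y :: "real^'n"
          unfolding scaleR_diff_right scaleR_scaleR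
          by (intro arg_cong2[where f="(-)"] arg_cong2[where f=scaleR] refl) (use that in \<open>simp_all add: field_simps\<close>)
        from this[OF at] show "a t ^ (m - 1) *\<^sub>R k q *\<^sub>R r1_dot \<alpha>x (\<mu> T t0 t) (x t) q = k q *\<^sub>R (a t ^ m *\<^sub>R E (Suc q) t
          - (real (q - 1) * (dl t * inverse (a t))) *\<^sub>R (a t ^ m *\<^sub>R E q t))"
          unfolding r1_dot_E[OF q t] am .
      qed
      have 2: "(real (m - 1) * dl t) *\<^sub>R x t m = (real (m - 1) * (dl t * inverse (a t))) *\<^sub>R (a t ^ m *\<^sub>R E m t)"
      proof -
        have "x t m = a t ^ (m - 1) *\<^sub>R E m t" using x_E[OF m, of t] at by simp
        moreover have "real (m - 1) * (dl t * inverse (a t)) * a t ^ m = real (m - 1) * dl t * a t ^ (m - 1)"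
          by (simp add: mult.assoc am')
        ultimately show ?thesis by (simp only: scaleR_scaleR)
      qed
      have 3: "(inverse (B t) * ds t) *\<^sub>R St t = (k 1 * (real m * (dl t * inverse (a t)) + v1 / 2)) *\<^sub>R (a t ^ m *\<^sub>R St t)"
      proof -
        have "inverse (B t) * ds t = k 1 * (real m * (dl t * inverse (a t)) + v1 / 2) * a t ^ m"
        proof -
          have "inverse (inverse \<kappa> * inverse A) * (l1 * l2 + l3 * \<gamma>) = \<kappa> * (l1 * (l2 * inverse \<gamma>) + l3) * (A * \<gamma>)"
            if "\<kappa> \<noteq> 0" "A \<noteq> 0" "\<gamma> \<noteq> 0" for \<kappa> A \<gamma> l1 l2 l3 :: real
            using that by (simp add: field_simps)
          moreover have "a t ^ (m - 1) \<noteq> 0" using at by simp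
          ultimately show ?thesis unfolding ds_eq[OF t] B_eq am using k1 at by blast
        qed
        then show ?thesis by simp
      qed
      show ?thesis unfolding u_eq[OF t] U_def pi_eq 1 2 3 ..
    qed
    have "bounded (U ` ?I)"
    proof -
      have c1: "bounded ((\<lambda>t. (v + (\<psi> (x t))\<^sup>2 + 1) * sgn (k 1)) ` ?I)"
        using bounded_scaleR_image[OF bounded_plus_comp[OF bounded_plus_comp[OF bounded_const_image[of v] bounded_power_image[OF psi, of 2]]
            bounded_const_image[of 1]] bounded_const_image[of "sgn (k 1)"]] by simp
      have c2: "bounded ((\<lambda>t. r * (dl t * inverse (a t))) ` ?I)" for r
        using bounded_scaleR_image[OF bounded_const_image[of r] bdl] by simp
      have c3: "bounded ((\<lambda>t. k 1 * (real m * (dl t * inverse (a t)) + v1 / 2)) ` ?I)"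
        using bounded_scaleR_image[OF bounded_const_image[of "k 1"] bounded_plus_comp[OF c2 bounded_const_image]] by simp
      have bEq: "bounded ((\<lambda>t. a t ^ m *\<^sub>R E (Suc q) t) ` ?I)" "bounded ((\<lambda>t. a t ^ m *\<^sub>R E q t) ` ?I)"
        if "q \<in> {1..m - 1}" for q using that by (auto intro!: bE)
      have n: "bounded ((\<lambda>t. - (((v + (\<psi> (x t))\<^sup>2 + 1) * sgn (k 1)) *\<^sub>R et t)) ` ?I)"
        using bounded_scaleR_image[OF c1 bet] by (simp add: bounded_iff)
      have bm: "bounded ((\<lambda>t. a t ^ m *\<^sub>R E m t) ` ?I)" by (rule bEm)
      show ?thesis unfolding U_def[abs_def]
        by (intro bounded_minus_comp n bounded_sum_image bounded_scaleR_image bounded_const_image c2 c3 bSt bm bEq)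
    qed
    moreover have "u ` ?I = U ` ?I" by (intro image_cong refl uU)
    ultimately show ?thesis by (simp only:)
  qed
qed

section \<open>The closed-loop system\<close>

text \<open>Compactness of the disturbance set replaces the unknown function \<open>h\<close> by a
  constant. This constant enters the bounds but not the controller.\<close>

lemma class_K_inf_bounded_on_compact:
  fixes D :: "(nat \<Rightarrow> real) set"
  assumes "compact D" "class_K_inf h"
  shows "\<exists>H. \<forall>\<theta>\<in>D. h (stacked_norm nd \<theta>) \<le> H"
proof -
  have c: "continuous_on D (\<lambda>\<theta>::nat \<Rightarrow> real. \<theta> q)" for q
    by (rule continuous_on_subset[OF continuous_on_product_coordinates]) simp
  have "continuous_on D (\<lambda>\<theta>::nat \<Rightarrow> real. stacked_norm nd \<theta>)"
    unfolding stacked_norm_def by (intro continuous_intros c)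
  then have "bounded (stacked_norm nd ` D)"
    by (intro compact_imp_bounded compact_continuous_image assms(1))
  then obtain M where M: "\<And>\<theta>. \<theta> \<in> D \<Longrightarrow> \<bar>stacked_norm nd \<theta>\<bar> \<le> M"
    unfolding bounded_iff by auto
  have "h (stacked_norm nd \<theta>) \<le> h M" if "\<theta> \<in> D" for \<theta>
  proof (rule class_K_inf_mono[OF assms(2)])
    show "0 \<le> stacked_norm nd \<theta>" by (simp add: stacked_norm_def sum_nonneg)
    show "stacked_norm nd \<theta> \<le> M" using M[OF that] by linarith
  qed
  then show ?thesis by blast
qed

lemma delta_le:
  assumes "0 < s" "0 < \<alpha> s" "deriv \<alpha> s \<le> c * inverse (s\<^sup>2) * (\<alpha> s)\<^sup>2"
  shows "\<delta> \<alpha> s \<le> c * \<alpha> s"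
proof -
  have "deriv \<alpha> s * s\<^sup>2 * inverse (\<alpha> s) \<le> (c * inverse (s\<^sup>2) * (\<alpha> s)\<^sup>2) * s\<^sup>2 * inverse (\<alpha> s)"
    using assms by (intro mult_right_mono) auto
  also have "\<dots> = c * \<alpha> s" using assms(1,2) by (simp add: power2_eq_square field_simps)
  finally show ?thesis by (simp add: \<delta>_def)
qed

text \<open>By the choice of \<open>v2\<close>, the quotient \<open>v1 / (2 v2)\<close> equals
  \<open>v1 / (4 m)\<close> times an eigenvalue ratio not exceeding 1. Hence \<open>m - 1\<close>
  such rates fit into \<open>v1 / 4\<close>.\<close>

lemma design_rates:
  assumes PQ: "pos_def n P" "pos_def n Q" and n: "0 < n" and m: "2 \<le> m"
    and v1: "v1 = lambda_min Q / lambda_max P"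
    and v2: "v2 = 2 * real m * lambda_max P / lambda_min P"
  shows "0 < v1" "real (m - 1) * (v1 / (2 * v2)) \<le> v1 / 4"
proof -
  have lp: "0 < lambda_min P" "lambda_min P \<le> lambda_max P" and lq: "0 < lambda_min Q"
    by (rule pos_def_rayleigh[OF PQ(1) n] pos_def_rayleigh[OF PQ(2) n])+
  then have Lp: "0 < lambda_max P" by simp
  show v: "0 < v1" using lq Lp by (simp add: v1)
  have "real (m - 1) * (v1 / (2 * v2)) = v1 / 4 * ((real (m - 1) / real m) * (lambda_min P / lambda_max P))"
    using m lp Lp by (simp add: v2 field_simps)
  also have "\<dots> \<le> v1 / 4 * (1 * 1)"
    using v m lp Lp by (intro mult_left_mono mult_mono) auto
  finally show "real (m - 1) * (v1 / (2 * v2)) \<le> v1 / 4" by simp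
qed

theorem theoremV1:
  fixes T t0 b :: real
    and N :: nat and a :: "nat \<Rightarrow> nat \<Rightarrow> real"
    and f :: "nat \<Rightarrow> real^'n \<Rightarrow> real" and \<rho> \<kappa> :: real and z :: "real^'n"
    and \<alpha> :: "real \<Rightarrow> real"
    and m nd :: "nat \<Rightarrow> nat"
    and D :: "nat \<Rightarrow> (nat \<Rightarrow> real) set"
    and \<phi> :: "nat \<Rightarrow> (nat \<Rightarrow> real^'n) \<Rightarrow> (nat \<Rightarrow> real) \<Rightarrow> real^'n"
    and h :: "nat \<Rightarrow> real \<Rightarrow> real"
    and \<psi> :: "nat \<Rightarrow> (nat \<Rightarrow> real^'n) \<Rightarrow> real"
    and k :: "nat \<Rightarrow> nat \<Rightarrow> real"
    and \<alpha>x \<alpha>s :: "nat \<Rightarrow> real \<Rightarrow> real"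
    and P Q :: "nat \<Rightarrow> real mat"
    and v v1 v2 :: "nat \<Rightarrow> real"
    and cs :: real
    and w p u y :: "nat \<Rightarrow> real \<Rightarrow> real^'n"
    and d :: "nat \<Rightarrow> real \<Rightarrow> nat \<Rightarrow> real"
    and x :: "nat \<Rightarrow> real \<Rightarrow> nat \<Rightarrow> real^'n"
  assumes T: "0 < T"
    \<comment> \<open>graph and optimization problem\<close>
    and N: "2 \<le> N"
    and graph: "connected_weighted_graph N a"
    and const_pos: "0 < \<rho>" "0 < \<kappa>"
    and f_diff: "\<And>i. i \<in> {1..N} \<Longrightarrow> f i differentiable_on UNIV"
    and f_strong: "\<And>i \<xi> \<eta>. i \<in> {1..N} \<Longrightarrow>
      inner (gradient (f i) \<xi> - gradient (f i) \<eta>) (\<xi> - \<eta>) \<ge> \<rho> * (norm (\<xi> - \<eta>))\<^sup>2"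
    and f_lip: "\<And>i \<xi> \<eta>. i \<in> {1..N} \<Longrightarrow>
      norm (gradient (f i) \<xi> - gradient (f i) \<eta>) \<le> \<kappa> * norm (\<xi> - \<eta>)"
    and opt_value: "bdd_below (total_cost N f ` consensus_profiles N)"
    and opt_set: "optimum_set N f \<noteq> {}" "compact (optimum_set N f)"
    and opt: "replicate_profile N z \<in> optimum_set N f"
    and cs: "cs = c_star (lambda2 N a) \<rho> \<kappa>"
    \<comment> \<open>agents\<close>
    and m: "\<And>i. i \<in> {1..N} \<Longrightarrow> 2 \<le> m i"
    and D: "\<And>i. i \<in> {1..N} \<Longrightarrow> D i \<subseteq> stacked (nd i) \<and> compact (D i)"
    and phi_smooth: "\<And>i. i \<in> {1..N} \<Longrightarrow> C1_state_disturbance (m i) (nd i) (D i) (\<phi> i)"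
    and phi_bounded: "\<And>i \<theta>. i \<in> {1..N} \<Longrightarrow> \<theta> \<in> D i \<Longrightarrow> bounded ((\<lambda>\<xi>. \<phi> i \<xi> \<theta>) ` stacked (m i))"
    and h: "\<And>i. i \<in> {1..N} \<Longrightarrow> class_K_inf (h i)"
    and psi: "\<And>i. i \<in> {1..N} \<Longrightarrow>
      (\<forall>\<xi>\<in>stacked (m i). 0 < \<psi> i \<xi>) \<and> bounded (\<psi> i ` stacked (m i))"
    and phi_bound: "\<And>i \<xi> \<theta>. i \<in> {1..N} \<Longrightarrow> \<xi> \<in> stacked (m i) \<Longrightarrow> \<theta> \<in> D i \<Longrightarrow>
      norm (\<phi> i \<xi> \<theta>) \<le> h i (stacked_norm (nd i) \<theta>) * \<psi> i \<xi>"
    \<comment> \<open>controller parameters\<close>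
    and K: "\<And>i. i \<in> {1..N} \<Longrightarrow> hurwitz (companion (m i) (k i))"
    and v: "\<And>i. i \<in> {1..N} \<Longrightarrow> 0 < v i"
    and alpha_x: "\<And>i. i \<in> {1..N} \<Longrightarrow> class_K_inf (\<alpha>x i) \<and> \<alpha>x i differentiable_on {0..}"
    and alpha_s: "\<And>i. i \<in> {1..N} \<Longrightarrow> class_K_inf (\<alpha>s i) \<and> \<alpha>s i differentiable_on {0..}"
    and alpha: "class_K_inf \<alpha>" "\<alpha> differentiable_on {0..}"
    and alpha_growth: "\<And>s. 0 < s \<Longrightarrow> deriv \<alpha> s \<le> cs / 2 * inverse (s\<^sup>2) * (\<alpha> s)\<^sup>2"
    \<comment> \<open>design criteria\<close>
    and PQ: "\<And>i. i \<in> {1..N} \<Longrightarrow>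
      pos_def ((m i - 1) * CARD('n)) (P i) \<and> pos_def ((m i - 1) * CARD('n)) (Q i)"
    and lyapunov: "\<And>i. i \<in> {1..N} \<Longrightarrow>
      P i * kronecker (companion (m i) (k i)) (1\<^sub>m CARD('n))
        + kronecker (transpose_mat (companion (m i) (k i))) (1\<^sub>m CARD('n)) * P i = - Q i"
    and v1: "\<And>i. i \<in> {1..N} \<Longrightarrow> v1 i = lambda_min (Q i) / lambda_max (P i)"
    and v2: "\<And>i. i \<in> {1..N} \<Longrightarrow> v2 i = 2 * real (m i) * lambda_max (P i) / lambda_min (P i)"
    and DC1: "\<And>i s. i \<in> {1..N} \<Longrightarrow> 1 / T \<le> s \<Longrightarrow>
      deriv (\<alpha>x i) s \<le> v1 i / (2 * v2 i) * inverse (s\<^sup>2) * (\<alpha>x i s)\<^sup>2 \<and>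
      \<alpha>x i s \<le> cs / v1 i * \<alpha> s"
    and DC2: "\<And>i s. i \<in> {1..N} \<Longrightarrow> 0 \<le> s \<Longrightarrow>
      (\<lambda>\<tau>. inverse (\<tau>\<^sup>2) * \<alpha>x i \<tau>) integrable_on {0..s} \<and>
      \<alpha>s i s = (\<alpha>x i s) ^ m i *
        exp (v1 i / 2 * integral {0..s} (\<lambda>\<tau>. inverse (\<tau>\<^sup>2) * \<alpha>x i \<tau>))"
    \<comment> \<open>closed-loop trajectory on an interval of existence; \<open>b = T + t0\<close> is the whole of it\<close>
    and b: "t0 < b" "b \<le> T + t0"
    and disturbance: "\<And>i t. i \<in> {1..N} \<Longrightarrow> t \<in> {t0..<b} \<Longrightarrow> d i t \<in> D i"
    and p_init: "(\<Sum>i=1..N. p i t0) = 0"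
    and generator: "generator_trajectory N a f \<alpha> T t0 {t0..<b} w p"
    and chain: "\<And>i. i \<in> {1..N} \<Longrightarrow> chain_trajectory (m i) (\<phi> i) {t0..<b} (d i) (u i) (x i)"
    and control: "\<And>i t. i \<in> {1..N} \<Longrightarrow> t \<in> {t0..<b} \<Longrightarrow>
      u i t = controller (m i) (k i) (\<alpha>x i) (\<alpha>s i) (v i) (\<psi> i) (\<mu> T t0 t) (w i t) (x i t)"
    and output_eq: "\<And>i t. i \<in> {1..N} \<Longrightarrow> t \<in> {t0..<b} \<Longrightarrow> y i t = x i t 1"
  shows "(\<forall>i\<in>{1..N}.
            (\<exists>M. \<forall>t\<in>{t0..<b}. stacked_norm (m i) (x i t) \<le> M) \<and>
            bounded (y i ` {t0..<b}) \<and> bounded (u i ` {t0..<b}))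
       \<and> (b = T + t0 \<longrightarrow> (\<forall>i\<in>{1..N}. ((\<lambda>t. y i t - z) \<longlongrightarrow> 0) (at_left (T + t0))))"
proof -
  let ?I = "{t0..<b}"
  define g where "g t = \<alpha> (\<mu> T t0 t)" for t
  have mu: "0 < \<mu> T t0 t" "1 / T \<le> \<mu> T t0 t" if "t \<in> ?I" for t
    using mu_ge[OF T, of t0 t] that b by auto
  have gpos: "0 < g t" if "t \<in> ?I" for t
    unfolding g_def by (rule class_K_inf_pos[OF alpha(1) mu(1)[OF that]])
  have dg: "(g has_real_derivative \<delta> \<alpha> (\<mu> T t0 t) * g t) (at t within ?I)" if "t \<in> ?I" for t
    unfolding g_def[abs_def] using gain_derivative(1)[OF alpha T] that b by auto
  have dg_le: "\<delta> \<alpha> (\<mu> T t0 t) \<le> cs / 2 * g t" if "t \<in> ?I" for t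
    unfolding g_def
    by (rule delta_le[OF mu(1)[OF that] _ alpha_growth[OF mu(1)[OF that]]])
      (rule class_K_inf_pos[OF alpha(1) mu(1)[OF that]])
  have g0: "0 \<le> \<alpha> (\<mu> T t0 t)" if "t \<in> ?I" for t using gpos[OF that] by (simp add: g_def)
  obtain E E' w' C where csp: "0 < c_star (lambda2 N a) \<rho> \<kappa>" and C: "0 \<le> C"
    and dE: "\<And>t. t \<in> ?I \<Longrightarrow> (E has_real_derivative E' t) (at t within ?I)"
    and E'le: "\<And>t. t \<in> ?I \<Longrightarrow> E' t \<le> - 2 * c_star (lambda2 N a) \<rho> \<kappa> * \<alpha> (\<mu> T t0 t) * E t"
    and E0: "\<And>t. t \<in> ?I \<Longrightarrow> 0 \<le> E t"
    and wz: "\<And>i t. i \<in> {1..N} \<Longrightarrow> t \<in> ?I \<Longrightarrow> (norm (w i t - z))\<^sup>2 \<le> C * E t"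
    and dw: "\<And>i t. i \<in> {1..N} \<Longrightarrow> t \<in> ?I \<Longrightarrow> (w i has_vector_derivative w' i t) (at t within ?I)"
    and w'C: "\<And>i t. i \<in> {1..N} \<Longrightarrow> t \<in> ?I \<Longrightarrow> (norm (w' i t))\<^sup>2 \<le> C * (\<alpha> (\<mu> T t0 t))\<^sup>2 * E t"
    by (rule generator_energy[OF N graph const_pos f_strong f_lip optimum_sum_gradient[OF f_diff opt] b(1) p_init generator g0]; blast)
  have cs_pos: "0 < cs" using csp by (simp add: cs)
  have E'le: "E' t \<le> - 2 * cs * g t * E t" if "t \<in> ?I" for t
    using E'le[OF that] by (simp add: cs g_def)
  have weighted: "E t * (g t)\<^sup>2 * (c t ^ n)\<^sup>2 \<le> E t0 * (g t0)\<^sup>2 * (c t0 ^ n)\<^sup>2"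
    if "\<And>t. t \<in> ?I \<Longrightarrow> (c has_real_derivative dc t * c t) (at t within ?I)"
      "\<And>t. t \<in> ?I \<Longrightarrow> real n * dc t \<le> cs / 4 * g t" "t \<in> ?I" for c dc :: "real \<Rightarrow> real" and n t
    by (rule weighted_energy_nonincreasing[where E=E and E'=E' and da=dc, OF dE E'le E0 dg dg_le gpos that(1,2) cs_pos that(3)])
  define Z where "Z = sqrt (C * (E t0 * (g t0)\<^sup>2))"
  \<comment> \<open>Exponent \<open>n = 0\<close>: only the weight \<open>g^2\<close> is kept, and
    the gain inserted for \<open>c\<close> is immaterial.\<close>
  have wz_g: "g t * norm (w i t - z) \<le> Z" if i: "i \<in> {1..N}" and t: "t \<in> ?I" for i t
  proof -
    have "E t * (g t)\<^sup>2 * (g t ^ 0)\<^sup>2 \<le> E t0 * (g t0)\<^sup>2 * (g t0 ^ 0)\<^sup>2"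
    proof (rule weighted[OF dg _ t])
      fix s assume "s \<in> ?I"
      then have "0 \<le> cs / 4 * g s" using cs_pos gpos by (intro mult_nonneg_nonneg) (auto simp: less_imp_le)
      then show "real 0 * \<delta> \<alpha> (\<mu> T t0 s) \<le> cs / 4 * g s" by simp
    qed
    then have "E t * (g t)\<^sup>2 \<le> E t0 * (g t0)\<^sup>2" by simp
    then have "C * (E t * (g t)\<^sup>2) \<le> C * (E t0 * (g t0)\<^sup>2)" using C by (intro mult_left_mono)
    moreover have "(g t)\<^sup>2 * (norm (w i t - z))\<^sup>2 \<le> (g t)\<^sup>2 * (C * E t)"
      by (intro mult_left_mono wz i t) auto
    ultimately have "(g t * norm (w i t - z))\<^sup>2 \<le> C * (E t0 * (g t0)\<^sup>2)"
      by (simp add: power_mult_distrib mult_ac)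
    then show ?thesis unfolding Z_def by (rule real_le_rsqrt)
  qed
  have agent: "(\<exists>M. \<forall>t\<in>?I. stacked_norm (m i) (x i t) \<le> M) \<and> bounded (u i ` ?I) \<and>
      (\<exists>M. \<forall>t\<in>?I. \<alpha>x i (\<mu> T t0 t) ^ m i * norm (x i t 1 - w i t) \<le> M)" if i: "i \<in> {1..N}" for i
  proof -
    define c where "c = (\<lambda>t. \<alpha>x i (\<mu> T t0 t))"
    define R where "R = sqrt (C * (E t0 * (g t0)\<^sup>2 * (c t0 ^ (m i - 1))\<^sup>2))"
    note mi = m[OF i] and ax = alpha_x[OF i] and as = alpha_s[OF i] and PQi = PQ[OF i]
    have np: "0 < (m i - 1) * CARD('n)" using mi by simp
    have rates: "0 < v1 i" "real (m i - 1) * (v1 i / (2 * v2 i)) \<le> v1 i / 4"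
      by (rule design_rates[OF conjunct1[OF PQi] conjunct2[OF PQi] np mi v1[OF i] v2[OF i]])+
    have cpos: "0 < c t" if "t \<in> ?I" for t
      unfolding c_def by (rule class_K_inf_pos[OF conjunct1[OF ax] mu(1)[OF that]])
    have dl: "\<delta> (\<alpha>x i) (\<mu> T t0 t) \<le> v1 i / (2 * v2 i) * c t" if t: "t \<in> ?I" for t
      unfolding c_def
      by (rule delta_le[OF mu(1)[OF t] _ conjunct1[OF DC1[OF i mu(2)[OF t]]]])
        (rule class_K_inf_pos[OF conjunct1[OF ax] mu(1)[OF t]])
    have dc: "(c has_real_derivative \<delta> (\<alpha>x i) (\<mu> T t0 t) * c t) (at t within ?I)" if "t \<in> ?I" for t
      unfolding c_def using gain_derivative(1)[OF conjunct1[OF ax] conjunct2[OF ax] T] that b by auto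
    \<comment> \<open>The second half of \<open>DC1\<close> links the two time scales:
      \<open>v1 / 4 * a\<close> is at most \<open>cs / 4 * g\<close>, the share of the generator's
      decay reserved for the weight \<open>a^(2(m-1))\<close>.\<close>
    have rate: "real (m i - 1) * \<delta> (\<alpha>x i) (\<mu> T t0 t) \<le> cs / 4 * g t" if t: "t \<in> ?I" for t
    proof -
      have "real (m i - 1) * \<delta> (\<alpha>x i) (\<mu> T t0 t) \<le> real (m i - 1) * (v1 i / (2 * v2 i)) * c t"
        using mult_left_mono[OF dl[OF t], of "real (m i - 1)"] by (simp add: mult_ac)
      also have "\<dots> \<le> v1 i / 4 * c t" using rates(2) cpos[OF t] by (intro mult_right_mono) auto
      also have "\<dots> \<le> v1 i / 4 * (cs / v1 i * g t)"
        using conjunct2[OF DC1[OF i mu(2)[OF t]]] rates(1)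
        by (intro mult_left_mono) (auto simp: c_def g_def)
      also have "\<dots> = cs / 4 * g t" using rates(1) by simp
      finally show ?thesis .
    qed
    have w'R: "c t ^ (m i - 1) * norm (w' i t) \<le> R" if t: "t \<in> ?I" for t
    proof -
      have "(c t ^ (m i - 1))\<^sup>2 * (norm (w' i t))\<^sup>2 \<le> (c t ^ (m i - 1))\<^sup>2 * (C * (g t)\<^sup>2 * E t)"
        unfolding g_def by (intro mult_left_mono w'C i t) auto
      also have "\<dots> = C * (E t * (g t)\<^sup>2 * (c t ^ (m i - 1))\<^sup>2)" by (simp add: mult_ac)
      also have "\<dots> \<le> C * (E t0 * (g t0)\<^sup>2 * (c t0 ^ (m i - 1))\<^sup>2)"
        by (rule mult_left_mono[OF weighted[OF dc rate t] C])
      finally have "(c t ^ (m i - 1) * norm (w' i t))\<^sup>2 \<le> C * (E t0 * (g t0)\<^sup>2 * (c t0 ^ (m i - 1))\<^sup>2)"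
        by (simp only: power_mult_distrib)
      then show ?thesis unfolding R_def by (rule real_le_rsqrt)
    qed
    have wb: "bounded (w i ` ?I)"
    proof -
      have "norm (w i t) \<le> Z / \<alpha> (1 / T) + norm z" if t: "t \<in> ?I" for t
      proof -
        have p: "0 < \<alpha> (1 / T)" using T by (intro class_K_inf_pos[OF alpha(1)]) simp
        have "\<alpha> (1 / T) \<le> g t"
          unfolding g_def using T by (intro class_K_inf_mono[OF alpha(1)] mu[OF t]) simp
        then have "\<alpha> (1 / T) * norm (w i t - z) \<le> g t * norm (w i t - z)" by (intro mult_right_mono) auto
        then have "norm (w i t - z) \<le> Z / \<alpha> (1 / T)"
          using wz_g[OF i t] p by (simp add: field_simps)
        then show ?thesis using norm_triangle_sub[of "w i t" z] by linarith
      qed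
      then show ?thesis unfolding bounded_iff by blast
    qed
    have xs: "x i t \<in> stacked (m i)" if "t \<in> ?I" for t
      using chain[OF i] that unfolding chain_trajectory_def by blast
    obtain H where H: "\<And>\<theta>. \<theta> \<in> D i \<Longrightarrow> h i (stacked_norm (nd i) \<theta>) \<le> H"
      using class_K_inf_bounded_on_compact[OF conjunct2[OF D[OF i]] h[OF i], of "nd i"] by blast
    have ph: "norm (\<phi> i (x i t) (d i t)) \<le> H * \<psi> i (x i t)" if t: "t \<in> ?I" for t
    proof -
      have "norm (\<phi> i (x i t) (d i t)) \<le> h i (stacked_norm (nd i) (d i t)) * \<psi> i (x i t)"
        by (rule phi_bound[OF i xs[OF t] disturbance[OF i t]])
      also have "\<dots> \<le> H * \<psi> i (x i t)"
        using psi[OF i] xs[OF t] by (intro mult_right_mono H disturbance i t) (auto simp: less_imp_le)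
      finally show ?thesis .
    qed
    have psb: "bounded ((\<lambda>t. \<psi> i (x i t)) ` ?I)"
      by (rule bounded_subset[OF conjunct2[OF psi[OF i]]]) (use xs in auto)
    note result = agent_bounded[OF c_def T b mi, where \<phi>="\<phi> i" and x="x i" and d="d i" and H=H and \<psi>="\<psi> i"
        and v="v i" and \<alpha>s="\<alpha>s i" and P="P i" and Q="Q i" and k="k i" and ?v1.0="v1 i" and ?v2.0="v2 i"
        and u="u i" and w="w i" and w'="w' i" and R=R, OF ph psb v[OF i] conjunct1[OF ax] conjunct2[OF ax]
        conjunct1[OF as] conjunct2[OF as] conjunct1[OF PQi] conjunct2[OF PQi] lyapunov[OF i] v1[OF i] rates(1)
        v2[OF i] dl DC2[OF i] chain[OF i] control[OF i] dw[OF i] wb w'R]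
    show ?thesis using result by (simp add: c_def)
  qed
  have y_bdd: "bounded (y i ` ?I)" if i: "i \<in> {1..N}" for i
  proof -
    obtain M where M: "\<And>t. t \<in> ?I \<Longrightarrow> stacked_norm (m i) (x i t) \<le> M" using agent[OF i] by blast
    have "norm (y i t) \<le> M" if t: "t \<in> ?I" for t
    proof -
      have "(norm (x i t 1))\<^sup>2 \<le> (\<Sum>q=1..m i. (norm (x i t q))\<^sup>2)"
        by (rule member_le_sum) (use m[OF i] in auto)
      then have "norm (x i t 1) \<le> stacked_norm (m i) (x i t)"
        unfolding stacked_norm_def by (rule real_le_rsqrt)
      then show ?thesis using M[OF t] output_eq[OF i t] by simp
    qed
    then show ?thesis unfolding bounded_iff by blast
  qed
  \<comment> \<open>With \<open>b = T + t0\<close> the interval is a left neighbourhood of the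
    terminal time, so both error bounds can be followed into the limit, where the gains in their
    denominators diverge.\<close>
  have conv: "((\<lambda>t. y i t - z) \<longlongrightarrow> 0) (at_left (T + t0))" if bT: "b = T + t0" and i: "i \<in> {1..N}" for i
  proof -
    let ?F = "at_left (T + t0)"
    obtain M where M: "\<And>t. t \<in> ?I \<Longrightarrow> \<alpha>x i (\<mu> T t0 t) ^ m i * norm (x i t 1 - w i t) \<le> M"
      using agent[OF i] by blast
    have ev: "eventually (\<lambda>t. t \<in> ?I) ?F"
      using T bT by (auto simp: eventually_at_left_field intro!: exI[of _ t0])
    have ax: "filterlim (\<lambda>t. \<alpha>x i (\<mu> T t0 t)) at_top ?F"
      by (rule filterlim_compose[OF class_K_inf_at_top[OF conjunct1[OF alpha_x[OF i]]] filterlim_mu])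
    have axm: "filterlim (\<lambda>t. \<alpha>x i (\<mu> T t0 t) ^ m i) at_top ?F"
      by (rule filterlim_pow_at_top[OF _ ax]) (use m[OF i] in simp)
    have gl: "filterlim g at_top ?F"
      unfolding g_def[abs_def] by (rule filterlim_compose[OF class_K_inf_at_top[OF alpha(1)] filterlim_mu])
    have lim: "((\<lambda>t. M / \<alpha>x i (\<mu> T t0 t) ^ m i + Z / g t) \<longlongrightarrow> 0 + 0) ?F"
      by (intro tendsto_add real_tendsto_divide_at_top[OF tendsto_const axm] real_tendsto_divide_at_top[OF tendsto_const gl])
    show ?thesis
    proof (rule Lim_null_comparison)
      show "eventually (\<lambda>t. norm (y i t - z) \<le> M / \<alpha>x i (\<mu> T t0 t) ^ m i + Z / g t) ?F"
        using ev
      proof eventually_elim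
        case (elim t)
        have "0 < \<alpha>x i (\<mu> T t0 t) ^ m i"
          using class_K_inf_pos[OF conjunct1[OF alpha_x[OF i]] mu(1)[OF elim]] by simp
        then have 1: "norm (x i t 1 - w i t) \<le> M / \<alpha>x i (\<mu> T t0 t) ^ m i"
          using M[OF elim] by (simp add: le_divide_eq mult.commute)
        have 2: "norm (w i t - z) \<le> Z / g t"
          using wz_g[OF i elim] gpos[OF elim] by (simp add: le_divide_eq mult.commute)
        have "y i t - z = (x i t 1 - w i t) + (w i t - z)" using output_eq[OF i elim] by simp
        then show ?case using norm_triangle_ineq[of "x i t 1 - w i t" "w i t - z"] 1 2 by simp
      qed
      show "((\<lambda>t. M / \<alpha>x i (\<mu> T t0 t) ^ m i + Z / g t) \<longlongrightarrow> 0) ?F" using lim by simp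
    qed
  qed
  show ?thesis using agent y_bdd conv by blast
qed

end
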